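(* Let $k$ be a field, let $(A,\mu_A,1_A)$ and $(C,\mu_C,1_C)$ be two associative unital $k$-algebras and let $V$ be a $k$-linear space equipped with a distinguished nonzero element $1_V\in V$. Assume that we are given linear maps $$R_1:V\otimes A\to A\otimes V,\quad R_2:C\otimes V\to V\otimes C,\quad R_3:C\otimes A\to A\otimes C,\quad E:V\otimes V\to A\otimes V\otimes C$$ such that the following conditions are satisfied: (i) $R_3$ is a twisting map between $A$ and $C$, that is, for all $a,a'\in A$, $c,c'\in C$: $R_3(c\otimes 1_A)=1_A\otimes c$, $R_3(1_C\otimes a)=a\otimes 1_C$, $(aa')_{R_3}\otimes c_{R_3}=a_{R_3}a'_{r_3}\otimes (c_{R_3})_{r_3}$, and $a_{R_3}\otimes (cc')_{R_3}=(a_{R_3})_{r_3}\otimes c_{r_3}c'_{R_3}$; (ii) $R_1(1_V\otimes a)=a\otimes 1_V$ and $R_1(v\otimes 1_A)=1_A\otimes v$ for all $a\in A$, $v\in V$; (iii) $R_2(c\otimes 1_V)=1_V\otimes c$ and $R_2(1_C\otimes v)=v\otimes 1_C$ for all $v\in V$, $c\in C$; (iv) $E(1_V\otimes v)=E(v\otimes 1_V)=1_A\otimes v\otimes 1_C$ for all $v\in V$; (v) the following relations hold: $$R_1\circ(id_V\otimes\mu_A)=(\mu_A\otimes id_V)\circ(id_A\otimes R_1)\circ(R_1\otimes id_A),$$ $$R_2\circ(\mu_C\otimes id_V)=(id_V\otimes\mu_C)\circ(R_2\otimes id_C)\circ(id_C\otimes R_2),$$ $$(id_A\otimes R_2)\circ(R_3\otimes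 id_V)\circ(id_C\otimes R_1)=(R_1\otimes id_C)\circ(id_V\otimes R_3)\circ(R_2\otimes id_A),$$ $$(\mu_A\otimes id_V\otimes id_C)\circ(id_A\otimes E)\circ(R_1\otimes id_V)\circ(id_V\otimes R_1)=(\mu_A\otimes id_V\otimes id_C)\circ(id_A\otimes R_1\otimes id_C)\circ(id_A\otimes id_V\otimes R_3)\circ(E\otimes id_A),$$ $$(id_A\otimes id_V\otimes\mu_C)\circ(E\otimes id_C)\circ(id_V\otimes R_2)\circ(R_2\otimes id_V)=(id_A\otimes id_V\otimes\mu_C)\circ(id_A\otimes R_2\otimes id_C)\circ(R_3\otimes id_V\otimes id_C)\circ(id_C\otimes E),$$ $$(\mu_A\otimes id_V\otimes\mu_C)\circ(id_A\otimes E\otimes id_C)\circ(R_1\otimes id_V\otimes id_C)\circ(id_V\otimes E)=(\mu_A\otimes id_V\otimes\mu_C)\circ(id_A\otimes E\otimes id_C)\circ(id_A\otimes id_V\otimes R_2)\circ(E\otimes id_V).$$ Define the linear maps $$R:(V\otimes C)\otimes A\to A\otimes(V\otimes C),\quad R=(R_1\otimes id_C)\circ(id_V\otimes R_3),$$ $$P:C\otimes(A\otimes V)\to(A\otimes V)\otimes C,\quad P=(id_A\otimes R_2)\circ(R_3\otimes id_V),$$ $$\sigma:(V\otimes C)\otimes(V\otimes C)\to A\otimes(V\otimes C),\quad \sigma=(id_A\otimes id_V\otimes\mu_C)\circ(E\otimes\mu_C)\circ(id_V\otimes R_2\otimes id_C),$$ $$\nu:(A\otimes V)\otimes(A\otimes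 V)\to(A\otimes V)\otimes C,\quad \nu=(\mu_A\otimes id_V\otimes id_C)\circ(\mu_A\otimes E)\circ(id_A\otimes R_1\otimes id_V).$$ Then we have the crossed products $A\otimes_{R,\sigma}(V\otimes C)$ (with distinguished element $1_V\otimes 1_C$ of $V\otimes C$) and $(A\otimes V)\overline{\otimes}_{P,\nu}C$ (with distinguished element $1_A\otimes 1_V$ of $A\otimes V$), i.e. the data $(A,V\otimes C,R,\sigma)$ and $(A\otimes V,C,P,\nu)$ satisfy the respective defining conditions, and the trivial identification $A\otimes(V\otimes C)\cong(A\otimes V)\otimes C$ is an algebra isomorphism between them. The resulting associative unital algebra structure on $A\otimes V\otimes C$ has unit $1_A\otimes 1_V\otimes 1_C$ and multiplication, for all $a,a'\in A$, $v,v'\in V$, $c,c'\in C$, $$(a\otimes v\otimes c)(a'\otimes v'\otimes c')=a(a'_{R_3})_{R_1}E_A(v_{R_1},v'_{R_2})\otimes E_V(v_{R_1},v'_{R_2})\otimes E_C(v_{R_1},v'_{R_2})(c_{R_3})_{R_2}c'.$$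
   Context: All algebras and linear spaces are over a field $k$, $\otimes=\otimes_k$, and all algebras are associative and unital. Sweedler-type notation (summation understood): $R_1(v\otimes a)=a_{R_1}\otimes v_{R_1}=a_{r_1}\otimes v_{r_1}$, $R_2(c\otimes v)=v_{R_2}\otimes c_{R_2}=v_{r_2}\otimes c_{r_2}$, $R_3(c\otimes a)=a_{R_3}\otimes c_{R_3}=a_{r_3}\otimes c_{r_3}$, $E(v\otimes v')=E_A(v,v')\otimes E_V(v,v')\otimes E_C(v,v')$; different letters ($R_i$, $r_i$) denote different copies of the same map. Brzeziński crossed product. Let $(A,\mu,1_A)$ be an algebra, $W$ a linear space with distinguished element $1_W$, and $R:W\otimes A\to A\otimes W$, $\sigma:W\otimes W\to A\otimes W$ linear maps. One says that we have the crossed product $A\otimes_{R,\sigma}W$ if, for all $a\in A$, $w\in W$: $R(1_W\otimes a)=a\otimes 1_W$, $R(w\otimes 1_A)=1_A\otimes w$; $\sigma(1_W\otimes w)=\sigma(w\otimes 1_W)=1_A\otimes w$; $R\circ(id_W\otimes\mu)=(\mu\otimes id_W)\circ(id_A\otimes R)\circ(R\otimes id_A)$; $(\mu\otimes id_W)\circ(id_A\otimes\sigma)\circ(R\otimes id_W)\circ(id_W\otimes\sigma)=(\mu\otimes id_W)\circ(id_A\otimes\sigma)\circ(\sigma\otimes id_W)$; $(\mu\otimes id_W)\circ(id_A\otimes\sigma)\circ(R\otimes id_W)\circ(id_W\otimes R)=(\mu\otimes id_W)\circ(id_A\otimes R)\circ(\sigma\otimes id_A)$. In that case $A\otimes_{R,\sigma}W$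 denotes the linear space $A\otimes W$ with the associative multiplication $(\mu_2\otimes id_W)\circ(id_A\otimes id_A\otimes\sigma)\circ(id_A\otimes R\otimes id_W)$, where $\mu_2=\mu\circ(id_A\otimes\mu)$, and unit $1_A\otimes 1_W$. Mirror version. Let $(B,\mu,1_B)$ be an algebra, $W$ a linear space with distinguished element $1_W$, and $P:B\otimes W\to W\otimes B$, $\nu:W\otimes W\to W\otimes B$ linear maps. One says that we have the crossed product $W\overline{\otimes}_{P,\nu}B$ if, for all $b\in B$, $w\in W$: $P(b\otimes 1_W)=1_W\otimes b$, $P(1_B\otimes w)=w\otimes 1_B$; $\nu(w\otimes 1_W)=\nu(1_W\otimes w)=w\otimes 1_B$; $P\circ(\mu\otimes id_W)=(id_W\otimes\mu)\circ(P\otimes id_B)\circ(id_B\otimes P)$; $(id_W\otimes\mu)\circ(\nu\otimes id_B)\circ(id_W\otimes P)\circ(\nu\otimes id_W)=(id_W\otimes\mu)\circ(\nu\otimes id_B)\circ(id_W\otimes\nu)$; $(id_W\otimes\mu)\circ(\nu\otimes id_B)\circ(id_W\otimes P)\circ(P\otimes id_W)=(id_W\otimes\mu)\circ(P\otimes id_B)\circ(id_B\otimes\nu)$. In that case $W\overline{\otimes}_{P,\nu}B$ denotes the linear space $W\otimes B$ with the associative multiplication $(id_W\otimes\mu_2)\circ(\nu\otimes id_B\otimes id_B)\circ(id_W\otimes P\otimes id_B)$, where $\mu_2=\mu\circ(id_B\otimes\mu)$, and unit $1_W\otimes 1_B$. The algebra structure obtained on $A\otimes V\otimes C$ is called the two-sided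 crossed product afforded by $R_1,R_2,R_3,E$. *)

theory Defs
  imports "HOL-Algebra.Module" "HOL-Algebra.QuotRing"
begin

text \<open>
  A \<open>K\<close>-linear space is a record \<open>M\<close> with \<^prop>\<open>module K M\<close> for a field \<open>K\<close>. The fields
  \<^const>\<open>monoid.mult\<close> and \<^const>\<open>one\<close> that such a record inherits from \<^typ>\<open>'a ring\<close> carry no
  information unless \<open>M\<close> is an algebra.
\<close>

text \<open>The library's \<^locale>\<open>algebra\<close> is commutative. The zero algebra is allowed here.\<close>

locale assoc_algebra = module K A + ring A for K (structure) and A (structure) +
  assumes smult_mult_left:
      "\<lbrakk>r \<in> carrier K; x \<in> carrier A; y \<in> carrier A\<rbrakk> \<Longrightarrow>
        (r \<odot>\<^bsub>A\<^esub> x) \<otimes>\<^bsub>A\<^esub> y = r \<odot>\<^bsub>A\<^esub> (x \<otimes>\<^bsub>A\<^esub> y)"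
    and smult_mult_right:
      "\<lbrakk>r \<in> carrier K; x \<in> carrier A; y \<in> carrier A\<rbrakk> \<Longrightarrow>
        x \<otimes>\<^bsub>A\<^esub> (r \<odot>\<^bsub>A\<^esub> y) = r \<odot>\<^bsub>A\<^esub> (x \<otimes>\<^bsub>A\<^esub> y)"

definition linmaps ::
    "('k, 'p) ring_scheme \<Rightarrow> ('k, 'm, 'q) module_scheme \<Rightarrow> ('k, 'n, 'r) module_scheme \<Rightarrow> ('m \<Rightarrow> 'n) set" where
  "linmaps K M N = {f \<in> carrier M \<rightarrow> carrier N.
     (\<forall>x\<in>carrier M. \<forall>y\<in>carrier M. f (x \<oplus>\<^bsub>M\<^esub> y) = f x \<oplus>\<^bsub>N\<^esub> f y) \<and>
     (\<forall>r\<in>carrier K. \<forall>x\<in>carrier M. f (r \<odot>\<^bsub>M\<^esub> x) = r \<odot>\<^bsub>N\<^esub> f x)}"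

text \<open>Equality of two maps on a space; their values outside its carrier are irrelevant.\<close>

definition eq_on :: "('a, 'p) partial_object_scheme \<Rightarrow> ('a \<Rightarrow> 'b) \<Rightarrow> ('a \<Rightarrow> 'b) \<Rightarrow> bool" where
  "eq_on M f g \<longleftrightarrow> (\<forall>x\<in>carrier M. f x = g x)"


section \<open>Tensor products\<close>

definition free_module :: "('k, 'p) ring_scheme \<Rightarrow> 'x set \<Rightarrow> ('k, 'x \<Rightarrow> 'k) module" where
  "free_module K S =
    \<lparr>carrier = {f. (\<forall>x. f x \<in> carrier K) \<and> (\<forall>x. x \<notin> S \<longrightarrow> f x = \<zero>\<^bsub>K\<^esub>) \<and> finite {x. f x \<noteq> \<zero>\<^bsub>K\<^esub>}},
     monoid.mult = undefined, one = undefined,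
     zero = (\<lambda>x. \<zero>\<^bsub>K\<^esub>), add = (\<lambda>f g x. f x \<oplus>\<^bsub>K\<^esub> g x), smult = (\<lambda>r f x. r \<otimes>\<^bsub>K\<^esub> f x)\<rparr>"

definition free_gen :: "('k, 'p) ring_scheme \<Rightarrow> 'x \<Rightarrow> 'x \<Rightarrow> 'k" where
  "free_gen K x = (\<lambda>y. if y = x then \<one>\<^bsub>K\<^esub> else \<zero>\<^bsub>K\<^esub>)"

definition tensor_rels ::
    "('k, 'p) ring_scheme \<Rightarrow> ('k, 'm, 'q) module_scheme \<Rightarrow> ('k, 'n, 'r) module_scheme \<Rightarrow> ('m \<times> 'n \<Rightarrow> 'k) set" where
  "tensor_rels K M N = (let F = free_module K (carrier M \<times> carrier N); \<delta> = free_gen K in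
     {\<delta> (x \<oplus>\<^bsub>M\<^esub> x', y) \<ominus>\<^bsub>F\<^esub> (\<delta> (x, y) \<oplus>\<^bsub>F\<^esub> \<delta> (x', y)) | x x' y.
        x \<in> carrier M \<and> x' \<in> carrier M \<and> y \<in> carrier N} \<union>
     {\<delta> (x, y \<oplus>\<^bsub>N\<^esub> y') \<ominus>\<^bsub>F\<^esub> (\<delta> (x, y) \<oplus>\<^bsub>F\<^esub> \<delta> (x, y')) | x y y'.
        x \<in> carrier M \<and> y \<in> carrier N \<and> y' \<in> carrier N} \<union>
     {\<delta> (r \<odot>\<^bsub>M\<^esub> x, y) \<ominus>\<^bsub>F\<^esub> (r \<odot>\<^bsub>F\<^esub> \<delta> (x, y)) | r x y.
        r \<in> carrier K \<and> x \<in> carrier M \<and> y \<in> carrier N} \<union>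
     {\<delta> (x, r \<odot>\<^bsub>N\<^esub> y) \<ominus>\<^bsub>F\<^esub> (r \<odot>\<^bsub>F\<^esub> \<delta> (x, y)) | r x y.
        r \<in> carrier K \<and> x \<in> carrier M \<and> y \<in> carrier N})"

definition tensor_null ::
    "('k, 'p) ring_scheme \<Rightarrow> ('k, 'm, 'q) module_scheme \<Rightarrow> ('k, 'n, 'r) module_scheme \<Rightarrow> ('m \<times> 'n \<Rightarrow> 'k) set" where
  "tensor_null K M N =
    \<Inter>{H. submodule H K (free_module K (carrier M \<times> carrier N)) \<and> tensor_rels K M N \<subseteq> H}"

type_synonym ('k, 'm, 'n) tensor = "('m \<times> 'n \<Rightarrow> 'k) set"

definition tensor ::
    "('k, 'm, 'q) module_scheme \<Rightarrow> ('k, 'p) ring_scheme \<Rightarrow> ('k, 'n, 'r) module_scheme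
      \<Rightarrow> ('k, ('k, 'm, 'n) tensor) module"
    (\<open>(_ \<boxtimes>\<^bsub>_\<^esub>/ _)\<close> [71, 0, 70] 70) where
  "M \<boxtimes>\<^bsub>K\<^esub> N = (let F = free_module K (carrier M \<times> carrier N); H = tensor_null K M N in
    \<lparr>carrier = a_rcosets\<^bsub>F\<^esub> H, monoid.mult = undefined, one = undefined,
     zero = H, add = set_add F, smult = (\<lambda>r X. \<Union>f\<in>X. H +>\<^bsub>F\<^esub> (r \<odot>\<^bsub>F\<^esub> f))\<rparr>)"

text \<open>The pure tensor \<open>m \<otimes> n\<close> of \<open>M \<otimes> N\<close>.\<close>

definition tens ::
    "('k, 'p) ring_scheme \<Rightarrow> ('k, 'm, 'q) module_scheme \<Rightarrow> ('k, 'n, 'r) module_scheme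
      \<Rightarrow> 'm \<Rightarrow> 'n \<Rightarrow> ('k, 'm, 'n) tensor" where
  "tens K M N m n =
    tensor_null K M N +>\<^bsub>free_module K (carrier M \<times> carrier N)\<^esub> free_gen K (m, n)"

text \<open>
  Sweedler-type sums: for a bilinear \<open>b\<close> with values in \<open>T\<close> and \<open>X = \<Sum>\<^sub>i m\<^sub>i \<otimes> n\<^sub>i\<close>, the value
  of \<open>sweedler K T X b\<close> is \<open>\<Sum>\<^sub>i b m\<^sub>i n\<^sub>i\<close>. It is computed from some representative \<open>p\<close> of the
  class \<open>X\<close>; the choice is immaterial because \<open>b\<close> is bilinear.
\<close>

definition sweedler ::
    "('k, 'p) ring_scheme \<Rightarrow> ('k, 't, 's) module_scheme \<Rightarrow> ('k, 'm, 'n) tensor \<Rightarrow> ('m \<Rightarrow> 'n \<Rightarrow> 't) \<Rightarrow> 't" where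
  "sweedler K T X b = (let p = (SOME p. p \<in> X) in
    \<Oplus>\<^bsub>T\<^esub>z\<in>{z. p z \<noteq> \<zero>\<^bsub>K\<^esub>}. p z \<odot>\<^bsub>T\<^esub> b (fst z) (snd z))"

text \<open>
  \<open>f \<otimes> g\<close>, for maps \<open>f\<close> into \<open>M\<close> and \<open>g\<close> into \<open>N\<close>. The arguments \<open>M\<close> and \<open>N\<close> are the
  \<^emph>\<open>codomains\<close>.
\<close>

definition tmap ::
    "('k, 'p) ring_scheme \<Rightarrow> ('k, 'm, 'q) module_scheme \<Rightarrow> ('k, 'n, 'r) module_scheme
      \<Rightarrow> ('x \<Rightarrow> 'm) \<Rightarrow> ('y \<Rightarrow> 'n) \<Rightarrow> ('k, 'x, 'y) tensor \<Rightarrow> ('k, 'm, 'n) tensor" where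
  "tmap K M N f g X = sweedler K (M \<boxtimes>\<^bsub>K\<^esub> N) X (\<lambda>x y. tens K M N (f x) (g y))"

text \<open>The trivial identifications \<open>(M \<otimes> N) \<otimes> P \<rightarrow> M \<otimes> (N \<otimes> P)\<close> and back.\<close>

definition assocr ::
    "('k, 'p) ring_scheme \<Rightarrow> ('k, 'a, 'q) module_scheme \<Rightarrow> ('k, 'b, 'r) module_scheme \<Rightarrow> ('k, 'c, 's) module_scheme
      \<Rightarrow> ('k, ('k, 'a, 'b) tensor, 'c) tensor \<Rightarrow> ('k, 'a, ('k, 'b, 'c) tensor) tensor" where
  "assocr K M N P X =
    sweedler K (M \<boxtimes>\<^bsub>K\<^esub> (N \<boxtimes>\<^bsub>K\<^esub> P)) X (\<lambda>Y p.
      sweedler K (M \<boxtimes>\<^bsub>K\<^esub> (N \<boxtimes>\<^bsub>K\<^esub> P)) Y (\<lambda>m n.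
        tens K M (N \<boxtimes>\<^bsub>K\<^esub> P) m (tens K N P n p)))"

definition assocl ::
    "('k, 'p) ring_scheme \<Rightarrow> ('k, 'a, 'q) module_scheme \<Rightarrow> ('k, 'b, 'r) module_scheme \<Rightarrow> ('k, 'c, 's) module_scheme
      \<Rightarrow> ('k, 'a, ('k, 'b, 'c) tensor) tensor \<Rightarrow> ('k, ('k, 'a, 'b) tensor, 'c) tensor" where
  "assocl K M N P X =
    sweedler K ((M \<boxtimes>\<^bsub>K\<^esub> N) \<boxtimes>\<^bsub>K\<^esub> P) X (\<lambda>m Y.
      sweedler K ((M \<boxtimes>\<^bsub>K\<^esub> N) \<boxtimes>\<^bsub>K\<^esub> P) Y (\<lambda>n p.
        tens K (M \<boxtimes>\<^bsub>K\<^esub> N) P (tens K M N m n) p))"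

text \<open>The multiplication of an algebra as a linear map \<open>A \<otimes> A \<rightarrow> A\<close>.\<close>

definition mul :: "('k, 'p) ring_scheme \<Rightarrow> ('k, 'a, 'q) module_scheme \<Rightarrow> ('k, 'a, 'a) tensor \<Rightarrow> 'a" where
  "mul K A X = sweedler K A X (\<lambda>a a'. a \<otimes>\<^bsub>A\<^esub> a')"


section \<open>Crossed products\<close>

text \<open>
  In the chains of compositions below the factors \<^const>\<open>assocr\<close> and \<^const>\<open>assocl\<close> only
  rebracket; all other factors occur in the order of the usual formulas. Maps on threefold tensor
  products are compared on the product bracketed to the right.
\<close>

definition crossed_product ::
    "'k ring \<Rightarrow> ('k, 'a) module \<Rightarrow> ('k, 'w) module \<Rightarrow> 'w
      \<Rightarrow> (('k, 'w, 'a) tensor \<Rightarrow> ('k, 'a, 'w) tensor)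
      \<Rightarrow> (('k, 'w, 'w) tensor \<Rightarrow> ('k, 'a, 'w) tensor) \<Rightarrow> bool" where
  "crossed_product K A W e R \<sigma> \<longleftrightarrow>
    assoc_algebra K A \<and> module K W \<and> e \<in> carrier W \<and>
    R \<in> linmaps K (W \<boxtimes>\<^bsub>K\<^esub> A) (A \<boxtimes>\<^bsub>K\<^esub> W) \<and>
    \<sigma> \<in> linmaps K (W \<boxtimes>\<^bsub>K\<^esub> W) (A \<boxtimes>\<^bsub>K\<^esub> W) \<and>
    (\<forall>a\<in>carrier A. R (tens K W A e a) = tens K A W a e) \<and>
    (\<forall>w\<in>carrier W. R (tens K W A w \<one>\<^bsub>A\<^esub>) = tens K A W \<one>\<^bsub>A\<^esub> w) \<and>
    (\<forall>w\<in>carrier W. \<sigma> (tens K W W e w) = tens K A W \<one>\<^bsub>A\<^esub> w \<and>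
                   \<sigma> (tens K W W w e) = tens K A W \<one>\<^bsub>A\<^esub> w) \<and>
    eq_on (W \<boxtimes>\<^bsub>K\<^esub> (A \<boxtimes>\<^bsub>K\<^esub> A))
      (R \<circ> tmap K W A id (mul K A))
      (tmap K A W (mul K A) id \<circ> assocl K A A W \<circ> tmap K A (A \<boxtimes>\<^bsub>K\<^esub> W) id R \<circ> assocr K A W A
        \<circ> tmap K (A \<boxtimes>\<^bsub>K\<^esub> W) A R id \<circ> assocl K W A A) \<and>
    eq_on (W \<boxtimes>\<^bsub>K\<^esub> (W \<boxtimes>\<^bsub>K\<^esub> W))
      (tmap K A W (mul K A) id \<circ> assocl K A A W \<circ> tmap K A (A \<boxtimes>\<^bsub>K\<^esub> W) id \<sigma> \<circ> assocr K A W W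
        \<circ> tmap K (A \<boxtimes>\<^bsub>K\<^esub> W) W R id \<circ> assocl K W A W \<circ> tmap K W (A \<boxtimes>\<^bsub>K\<^esub> W) id \<sigma>)
      (tmap K A W (mul K A) id \<circ> assocl K A A W \<circ> tmap K A (A \<boxtimes>\<^bsub>K\<^esub> W) id \<sigma> \<circ> assocr K A W W
        \<circ> tmap K (A \<boxtimes>\<^bsub>K\<^esub> W) W \<sigma> id \<circ> assocl K W W W) \<and>
    eq_on (W \<boxtimes>\<^bsub>K\<^esub> (W \<boxtimes>\<^bsub>K\<^esub> A))
      (tmap K A W (mul K A) id \<circ> assocl K A A W \<circ> tmap K A (A \<boxtimes>\<^bsub>K\<^esub> W) id \<sigma> \<circ> assocr K A W W
        \<circ> tmap K (A \<boxtimes>\<^bsub>K\<^esub> W) W R id \<circ> assocl K W A W \<circ> tmap K W (A \<boxtimes>\<^bsub>K\<^esub> W) id R)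
      (tmap K A W (mul K A) id \<circ> assocl K A A W \<circ> tmap K A (A \<boxtimes>\<^bsub>K\<^esub> W) id R \<circ> assocr K A W A
        \<circ> tmap K (A \<boxtimes>\<^bsub>K\<^esub> W) A \<sigma> id \<circ> assocl K W W A)"

text \<open>\<open>(\<mu>\<^sub>2 \<otimes> id) \<circ> (id \<otimes> id \<otimes> \<sigma>) \<circ> (id \<otimes> R \<otimes> id)\<close> with \<open>\<mu>\<^sub>2 = \<mu> \<circ> (id \<otimes> \<mu>)\<close>.\<close>

definition crossed_mult ::
    "'k ring \<Rightarrow> ('k, 'a) module \<Rightarrow> ('k, 'w) module
      \<Rightarrow> (('k, 'w, 'a) tensor \<Rightarrow> ('k, 'a, 'w) tensor)
      \<Rightarrow> (('k, 'w, 'w) tensor \<Rightarrow> ('k, 'a, 'w) tensor)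
      \<Rightarrow> ('k, ('k, 'a, 'w) tensor, ('k, 'a, 'w) tensor) tensor \<Rightarrow> ('k, 'a, 'w) tensor" where
  "crossed_mult K A W R \<sigma> =
    tmap K A W (mul K A \<circ> tmap K A A id (mul K A)) id
    \<circ> assocl K A (A \<boxtimes>\<^bsub>K\<^esub> A) W
    \<circ> tmap K A ((A \<boxtimes>\<^bsub>K\<^esub> A) \<boxtimes>\<^bsub>K\<^esub> W) id (assocl K A A W)
    \<circ> tmap K A (A \<boxtimes>\<^bsub>K\<^esub> (A \<boxtimes>\<^bsub>K\<^esub> W)) id (tmap K A (A \<boxtimes>\<^bsub>K\<^esub> W) id \<sigma>)
    \<circ> tmap K A (A \<boxtimes>\<^bsub>K\<^esub> (W \<boxtimes>\<^bsub>K\<^esub> W)) id (assocr K A W W)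
    \<circ> tmap K A ((A \<boxtimes>\<^bsub>K\<^esub> W) \<boxtimes>\<^bsub>K\<^esub> W) id (tmap K (A \<boxtimes>\<^bsub>K\<^esub> W) W R id)
    \<circ> tmap K A ((W \<boxtimes>\<^bsub>K\<^esub> A) \<boxtimes>\<^bsub>K\<^esub> W) id (assocl K W A W)
    \<circ> assocr K A W (A \<boxtimes>\<^bsub>K\<^esub> W)"

definition crossed_algebra ::
    "'k ring \<Rightarrow> ('k, 'a) module \<Rightarrow> ('k, 'w) module \<Rightarrow> 'w
      \<Rightarrow> (('k, 'w, 'a) tensor \<Rightarrow> ('k, 'a, 'w) tensor)
      \<Rightarrow> (('k, 'w, 'w) tensor \<Rightarrow> ('k, 'a, 'w) tensor) \<Rightarrow> ('k, ('k, 'a, 'w) tensor) module" where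
  "crossed_algebra K A W e R \<sigma> = (A \<boxtimes>\<^bsub>K\<^esub> W)
    \<lparr>monoid.mult := (\<lambda>x y. crossed_mult K A W R \<sigma> (tens K (A \<boxtimes>\<^bsub>K\<^esub> W) (A \<boxtimes>\<^bsub>K\<^esub> W) x y)),
     one := tens K A W \<one>\<^bsub>A\<^esub> e\<rparr>"

definition mirror_crossed_product ::
    "'k ring \<Rightarrow> ('k, 'w) module \<Rightarrow> ('k, 'b) module \<Rightarrow> 'w
      \<Rightarrow> (('k, 'b, 'w) tensor \<Rightarrow> ('k, 'w, 'b) tensor)
      \<Rightarrow> (('k, 'w, 'w) tensor \<Rightarrow> ('k, 'w, 'b) tensor) \<Rightarrow> bool" where
  "mirror_crossed_product K W B e P \<nu> \<longleftrightarrow>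
    assoc_algebra K B \<and> module K W \<and> e \<in> carrier W \<and>
    P \<in> linmaps K (B \<boxtimes>\<^bsub>K\<^esub> W) (W \<boxtimes>\<^bsub>K\<^esub> B) \<and>
    \<nu> \<in> linmaps K (W \<boxtimes>\<^bsub>K\<^esub> W) (W \<boxtimes>\<^bsub>K\<^esub> B) \<and>
    (\<forall>b\<in>carrier B. P (tens K B W b e) = tens K W B e b) \<and>
    (\<forall>w\<in>carrier W. P (tens K B W \<one>\<^bsub>B\<^esub> w) = tens K W B w \<one>\<^bsub>B\<^esub>) \<and>
    (\<forall>w\<in>carrier W. \<nu> (tens K W W w e) = tens K W B w \<one>\<^bsub>B\<^esub> \<and>
                   \<nu> (tens K W W e w) = tens K W B w \<one>\<^bsub>B\<^esub>) \<and>
    eq_on (B \<boxtimes>\<^bsub>K\<^esub> (B \<boxtimes>\<^bsub>K\<^esub> W))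
      (P \<circ> tmap K B W (mul K B) id \<circ> assocl K B B W)
      (tmap K W B id (mul K B) \<circ> assocr K W B B \<circ> tmap K (W \<boxtimes>\<^bsub>K\<^esub> B) B P id \<circ> assocl K B W B
        \<circ> tmap K B (W \<boxtimes>\<^bsub>K\<^esub> B) id P) \<and>
    eq_on (W \<boxtimes>\<^bsub>K\<^esub> (W \<boxtimes>\<^bsub>K\<^esub> W))
      (tmap K W B id (mul K B) \<circ> assocr K W B B \<circ> tmap K (W \<boxtimes>\<^bsub>K\<^esub> B) B \<nu> id \<circ> assocl K W W B
        \<circ> tmap K W (W \<boxtimes>\<^bsub>K\<^esub> B) id P \<circ> assocr K W B W \<circ> tmap K (W \<boxtimes>\<^bsub>K\<^esub> B) W \<nu> id \<circ> assocl K W W W)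
      (tmap K W B id (mul K B) \<circ> assocr K W B B \<circ> tmap K (W \<boxtimes>\<^bsub>K\<^esub> B) B \<nu> id \<circ> assocl K W W B
        \<circ> tmap K W (W \<boxtimes>\<^bsub>K\<^esub> B) id \<nu>) \<and>
    eq_on (B \<boxtimes>\<^bsub>K\<^esub> (W \<boxtimes>\<^bsub>K\<^esub> W))
      (tmap K W B id (mul K B) \<circ> assocr K W B B \<circ> tmap K (W \<boxtimes>\<^bsub>K\<^esub> B) B \<nu> id \<circ> assocl K W W B
        \<circ> tmap K W (W \<boxtimes>\<^bsub>K\<^esub> B) id P \<circ> assocr K W B W \<circ> tmap K (W \<boxtimes>\<^bsub>K\<^esub> B) W P id \<circ> assocl K B W W)
      (tmap K W B id (mul K B) \<circ> assocr K W B B \<circ> tmap K (W \<boxtimes>\<^bsub>K\<^esub> B) B P id \<circ> assocl K B W B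
        \<circ> tmap K B (W \<boxtimes>\<^bsub>K\<^esub> B) id \<nu>)"

text \<open>\<open>(id \<otimes> \<mu>\<^sub>2) \<circ> (\<nu> \<otimes> id \<otimes> id) \<circ> (id \<otimes> P \<otimes> id)\<close> with \<open>\<mu>\<^sub>2 = \<mu> \<circ> (id \<otimes> \<mu>)\<close>.\<close>

definition mirror_crossed_mult ::
    "'k ring \<Rightarrow> ('k, 'w) module \<Rightarrow> ('k, 'b) module
      \<Rightarrow> (('k, 'b, 'w) tensor \<Rightarrow> ('k, 'w, 'b) tensor)
      \<Rightarrow> (('k, 'w, 'w) tensor \<Rightarrow> ('k, 'w, 'b) tensor)
      \<Rightarrow> ('k, ('k, 'w, 'b) tensor, ('k, 'w, 'b) tensor) tensor \<Rightarrow> ('k, 'w, 'b) tensor" where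
  "mirror_crossed_mult K W B P \<nu> =
    tmap K W B id (mul K B \<circ> tmap K B B id (mul K B))
    \<circ> assocr K W B (B \<boxtimes>\<^bsub>K\<^esub> B)
    \<circ> tmap K (W \<boxtimes>\<^bsub>K\<^esub> B) (B \<boxtimes>\<^bsub>K\<^esub> B) \<nu> id
    \<circ> assocl K W W (B \<boxtimes>\<^bsub>K\<^esub> B)
    \<circ> tmap K W (W \<boxtimes>\<^bsub>K\<^esub> (B \<boxtimes>\<^bsub>K\<^esub> B)) id (assocr K W B B)
    \<circ> tmap K W ((W \<boxtimes>\<^bsub>K\<^esub> B) \<boxtimes>\<^bsub>K\<^esub> B) id (tmap K (W \<boxtimes>\<^bsub>K\<^esub> B) B P id)
    \<circ> tmap K W ((B \<boxtimes>\<^bsub>K\<^esub> W) \<boxtimes>\<^bsub>K\<^esub> B) id (assocl K B W B)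
    \<circ> assocr K W B (W \<boxtimes>\<^bsub>K\<^esub> B)"

definition mirror_crossed_algebra ::
    "'k ring \<Rightarrow> ('k, 'w) module \<Rightarrow> ('k, 'b) module \<Rightarrow> 'w
      \<Rightarrow> (('k, 'b, 'w) tensor \<Rightarrow> ('k, 'w, 'b) tensor)
      \<Rightarrow> (('k, 'w, 'w) tensor \<Rightarrow> ('k, 'w, 'b) tensor) \<Rightarrow> ('k, ('k, 'w, 'b) tensor) module" where
  "mirror_crossed_algebra K W B e P \<nu> = (W \<boxtimes>\<^bsub>K\<^esub> B)
    \<lparr>monoid.mult := (\<lambda>x y. mirror_crossed_mult K W B P \<nu> (tens K (W \<boxtimes>\<^bsub>K\<^esub> B) (W \<boxtimes>\<^bsub>K\<^esub> B) x y)),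
     one := tens K W B e \<one>\<^bsub>B\<^esub>\<rparr>"


section \<open>Two-sided crossed products\<close>

definition twisting_map ::
    "'k ring \<Rightarrow> ('k, 'a) module \<Rightarrow> ('k, 'c) module
      \<Rightarrow> (('k, 'c, 'a) tensor \<Rightarrow> ('k, 'a, 'c) tensor) \<Rightarrow> bool" where
  "twisting_map K A C R \<longleftrightarrow>
    R \<in> linmaps K (C \<boxtimes>\<^bsub>K\<^esub> A) (A \<boxtimes>\<^bsub>K\<^esub> C) \<and>
    (\<forall>c\<in>carrier C. R (tens K C A c \<one>\<^bsub>A\<^esub>) = tens K A C \<one>\<^bsub>A\<^esub> c) \<and>
    (\<forall>a\<in>carrier A. R (tens K C A \<one>\<^bsub>C\<^esub> a) = tens K A C a \<one>\<^bsub>C\<^esub>) \<and>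
    (\<forall>a\<in>carrier A. \<forall>a'\<in>carrier A. \<forall>c\<in>carrier C.
      R (tens K C A c (a \<otimes>\<^bsub>A\<^esub> a')) =
        sweedler K (A \<boxtimes>\<^bsub>K\<^esub> C) (R (tens K C A c a)) (\<lambda>a\<^sub>R c\<^sub>R.
        sweedler K (A \<boxtimes>\<^bsub>K\<^esub> C) (R (tens K C A c\<^sub>R a')) (\<lambda>a'\<^sub>r c\<^sub>R\<^sub>r.
          tens K A C (a\<^sub>R \<otimes>\<^bsub>A\<^esub> a'\<^sub>r) c\<^sub>R\<^sub>r))) \<and>
    (\<forall>a\<in>carrier A. \<forall>c\<in>carrier C. \<forall>c'\<in>carrier C.
      R (tens K C A (c \<otimes>\<^bsub>C\<^esub> c') a) =
        sweedler K (A \<boxtimes>\<^bsub>K\<^esub> C) (R (tens K C A c' a)) (\<lambda>a\<^sub>R c'\<^sub>R.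
        sweedler K (A \<boxtimes>\<^bsub>K\<^esub> C) (R (tens K C A c a\<^sub>R)) (\<lambda>a\<^sub>R\<^sub>r c\<^sub>r.
          tens K A C a\<^sub>R\<^sub>r (c\<^sub>r \<otimes>\<^bsub>C\<^esub> c'\<^sub>R))))"

text \<open>\<open>R = (R\<^sub>1 \<otimes> id) \<circ> (id \<otimes> R\<^sub>3)\<close>\<close>

definition two_sided_R ::
    "'k ring \<Rightarrow> ('k, 'a) module \<Rightarrow> ('k, 'v) module \<Rightarrow> ('k, 'c) module
      \<Rightarrow> (('k, 'v, 'a) tensor \<Rightarrow> ('k, 'a, 'v) tensor)
      \<Rightarrow> (('k, 'c, 'a) tensor \<Rightarrow> ('k, 'a, 'c) tensor)
      \<Rightarrow> ('k, ('k, 'v, 'c) tensor, 'a) tensor \<Rightarrow> ('k, 'a, ('k, 'v, 'c) tensor) tensor" where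
  "two_sided_R K A V C R1 R3 =
    assocr K A V C
    \<circ> tmap K (A \<boxtimes>\<^bsub>K\<^esub> V) C R1 id
    \<circ> assocl K V A C
    \<circ> tmap K V (A \<boxtimes>\<^bsub>K\<^esub> C) id R3
    \<circ> assocr K V C A"

text \<open>\<open>P = (id \<otimes> R\<^sub>2) \<circ> (R\<^sub>3 \<otimes> id)\<close>\<close>

definition two_sided_P ::
    "'k ring \<Rightarrow> ('k, 'a) module \<Rightarrow> ('k, 'v) module \<Rightarrow> ('k, 'c) module
      \<Rightarrow> (('k, 'c, 'v) tensor \<Rightarrow> ('k, 'v, 'c) tensor)
      \<Rightarrow> (('k, 'c, 'a) tensor \<Rightarrow> ('k, 'a, 'c) tensor)
      \<Rightarrow> ('k, 'c, ('k, 'a, 'v) tensor) tensor \<Rightarrow> ('k, ('k, 'a, 'v) tensor, 'c) tensor" where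
  "two_sided_P K A V C R2 R3 =
    assocl K A V C
    \<circ> tmap K A (V \<boxtimes>\<^bsub>K\<^esub> C) id R2
    \<circ> assocr K A C V
    \<circ> tmap K (A \<boxtimes>\<^bsub>K\<^esub> C) V R3 id
    \<circ> assocl K C A V"

text \<open>\<open>\<sigma> = (id \<otimes> id \<otimes> \<mu>\<^sub>C) \<circ> (E \<otimes> \<mu>\<^sub>C) \<circ> (id \<otimes> R\<^sub>2 \<otimes> id)\<close>\<close>

definition two_sided_sigma ::
    "'k ring \<Rightarrow> ('k, 'a) module \<Rightarrow> ('k, 'v) module \<Rightarrow> ('k, 'c) module
      \<Rightarrow> (('k, 'c, 'v) tensor \<Rightarrow> ('k, 'v, 'c) tensor)
      \<Rightarrow> (('k, 'v, 'v) tensor \<Rightarrow> ('k, 'a, ('k, 'v, 'c) tensor) tensor)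
      \<Rightarrow> ('k, ('k, 'v, 'c) tensor, ('k, 'v, 'c) tensor) tensor \<Rightarrow> ('k, 'a, ('k, 'v, 'c) tensor) tensor" where
  "two_sided_sigma K A V C R2 E =
    tmap K A (V \<boxtimes>\<^bsub>K\<^esub> C) id (tmap K V C id (mul K C))
    \<circ> tmap K A (V \<boxtimes>\<^bsub>K\<^esub> (C \<boxtimes>\<^bsub>K\<^esub> C)) id (assocr K V C C)
    \<circ> assocr K A (V \<boxtimes>\<^bsub>K\<^esub> C) C
    \<circ> tmap K (A \<boxtimes>\<^bsub>K\<^esub> (V \<boxtimes>\<^bsub>K\<^esub> C)) C E (mul K C)
    \<circ> assocl K V V (C \<boxtimes>\<^bsub>K\<^esub> C)
    \<circ> tmap K V (V \<boxtimes>\<^bsub>K\<^esub> (C \<boxtimes>\<^bsub>K\<^esub> C)) id (assocr K V C C)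
    \<circ> tmap K V ((V \<boxtimes>\<^bsub>K\<^esub> C) \<boxtimes>\<^bsub>K\<^esub> C) id (tmap K (V \<boxtimes>\<^bsub>K\<^esub> C) C R2 id)
    \<circ> tmap K V ((C \<boxtimes>\<^bsub>K\<^esub> V) \<boxtimes>\<^bsub>K\<^esub> C) id (assocl K C V C)
    \<circ> assocr K V C (V \<boxtimes>\<^bsub>K\<^esub> C)"

text \<open>\<open>\<nu> = (\<mu>\<^sub>A \<otimes> id \<otimes> id) \<circ> (\<mu>\<^sub>A \<otimes> E) \<circ> (id \<otimes> R\<^sub>1 \<otimes> id)\<close>\<close>

definition two_sided_nu ::
    "'k ring \<Rightarrow> ('k, 'a) module \<Rightarrow> ('k, 'v) module \<Rightarrow> ('k, 'c) module
      \<Rightarrow> (('k, 'v, 'a) tensor \<Rightarrow> ('k, 'a, 'v) tensor)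
      \<Rightarrow> (('k, 'v, 'v) tensor \<Rightarrow> ('k, 'a, ('k, 'v, 'c) tensor) tensor)
      \<Rightarrow> ('k, ('k, 'a, 'v) tensor, ('k, 'a, 'v) tensor) tensor \<Rightarrow> ('k, ('k, 'a, 'v) tensor, 'c) tensor" where
  "two_sided_nu K A V C R1 E =
    assocl K A V C
    \<circ> tmap K A (V \<boxtimes>\<^bsub>K\<^esub> C) (mul K A) id
    \<circ> assocl K A A (V \<boxtimes>\<^bsub>K\<^esub> C)
    \<circ> tmap K A (A \<boxtimes>\<^bsub>K\<^esub> (V \<boxtimes>\<^bsub>K\<^esub> C)) (mul K A) E
    \<circ> assocl K A A (V \<boxtimes>\<^bsub>K\<^esub> V)
    \<circ> tmap K A (A \<boxtimes>\<^bsub>K\<^esub> (V \<boxtimes>\<^bsub>K\<^esub> V)) id (assocr K A V V)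
    \<circ> tmap K A ((A \<boxtimes>\<^bsub>K\<^esub> V) \<boxtimes>\<^bsub>K\<^esub> V) id (tmap K (A \<boxtimes>\<^bsub>K\<^esub> V) V R1 id)
    \<circ> tmap K A ((V \<boxtimes>\<^bsub>K\<^esub> A) \<boxtimes>\<^bsub>K\<^esub> V) id (assocl K V A V)
    \<circ> assocr K A V (A \<boxtimes>\<^bsub>K\<^esub> V)"

end

theory Submission
  imports Defs
begin

text \<open>
  Write \<open>T = A \<otimes> V \<otimes> C\<close>, with the multiplication of the crossed product built from \<open>R\<close> and \<open>\<sigma>\<close>. The
  whole theorem follows from one fact, the associativity of this multiplication (\<open>mult_assoc\<close>).

  \<^emph>\<open>Associativity.\<close> Multiplying by \<open>a \<otimes> v \<otimes> c\<close> from the left is multiplying by \<open>c\<close>, then by \<open>v\<close>, then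
  by \<open>a\<close>; from the right it is multiplying by \<open>a\<close>, then by \<open>v\<close>, then by \<open>c\<close> (\<open>pure_mult_left\<close>,
  \<open>pure_mult_right\<close>). So associativity says that each of the three kinds of left multiplications
  commutes with each of the three kinds of right multiplications. Left multiplication by \<open>a\<close> and right
  multiplication by \<open>c\<close> change only an outer tensor factor and commute with everything. There remain
  the four pairs of a left multiplication by \<open>v\<close> or \<open>c\<close> and a right multiplication by \<open>a\<close> or \<open>v\<close>. As
  \<open>R\<^sub>1\<close>, \<open>R\<^sub>2\<close>, \<open>R\<^sub>3\<close> are compatible with the products of \<open>A\<close> and \<open>C\<close>, the former move past left
  multiplications by \<open>A\<close> and the latter past right multiplications by \<open>C\<close>, at the price of applying
  the maps \<open>R\<^sub>i\<close>. Because \<open>T\<close> is generated by the elements \<open>1 \<otimes> v \<otimes> 1\<close> under these outer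
  multiplications, it is enough that the pairs commute on such elements (\<open>exchange\<close>), and there the
  four commutation rules are literally the hexagon relation for \<open>R\<^sub>1, R\<^sub>2, R\<^sub>3\<close> and the three relations
  for \<open>E\<close> (\<open>iC_iV_iA\<close>, \<open>iV_iV_iA\<close>, \<open>iC_iV_iV\<close>, \<open>iV_iV_iV\<close>).

  \<^emph>\<open>The crossed product conditions.\<close> In \<open>A \<otimes> W\<close> one has \<open>R (w \<otimes> a) = (1 \<otimes> w) (a \<otimes> 1)\<close> and
  \<open>\<sigma> (w \<otimes> w') = (1 \<otimes> w) (1 \<otimes> w')\<close>, so the three conditions on \<open>R\<close> and \<open>\<sigma>\<close> are the associativity of
  the triple products \<open>w a a'\<close>, \<open>w w' w''\<close> and \<open>w w' a\<close>. This is the converse half of Brzezinski's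
  characterization of crossed products; it is proved for arbitrary data (\<open>crossed_product_of_assoc\<close>) and
  again in mirrored form. The mirrored product on \<open>(A \<otimes> V) \<otimes> C\<close> is the product of \<open>T\<close> after
  rebracketing: the two formulas differ in whether \<open>R\<^sub>1\<close> or \<open>R\<^sub>2\<close> is applied first, and these act on
  different factors (\<open>rebracket_mult\<close>).

  \<^emph>\<open>Calculating with tensors.\<close> A linear map is determined by its values on pure tensors, and a composition
  of the structure maps evaluated at a pure tensor becomes an iterated Sweedler-type sum of pure tensors.
  The lemmas \<open>sweedler_calculus\<close> let the simplifier compute this normal form, so that most identities are
  proved by comparing normal forms.
\<close>

section \<open>Linear and bilinear maps\<close>

lemma linmapsI:
  assumes "\<And>x. x \<in> carrier M \<Longrightarrow> f x \<in> carrier N"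
    and "\<And>x y. \<lbrakk>x \<in> carrier M; y \<in> carrier M\<rbrakk> \<Longrightarrow> f (x \<oplus>\<^bsub>M\<^esub> y) = f x \<oplus>\<^bsub>N\<^esub> f y"
    and "\<And>r x. \<lbrakk>r \<in> carrier K; x \<in> carrier M\<rbrakk> \<Longrightarrow> f (r \<odot>\<^bsub>M\<^esub> x) = r \<odot>\<^bsub>N\<^esub> f x"
  shows "f \<in> linmaps K M N"
  using assms by (auto simp: linmaps_def)

lemma
  assumes "f \<in> linmaps K M N"
  shows linmaps_closed: "x \<in> carrier M \<Longrightarrow> f x \<in> carrier N"
    and linmaps_add: "\<lbrakk>x \<in> carrier M; y \<in> carrier M\<rbrakk> \<Longrightarrow> f (x \<oplus>\<^bsub>M\<^esub> y) = f x \<oplus>\<^bsub>N\<^esub> f y"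
    and linmaps_smult: "\<lbrakk>r \<in> carrier K; x \<in> carrier M\<rbrakk> \<Longrightarrow> f (r \<odot>\<^bsub>M\<^esub> x) = r \<odot>\<^bsub>N\<^esub> f x"
  using assms by (auto simp: linmaps_def)

lemma linmaps_id: "id \<in> linmaps K M M" "(\<lambda>x. x) \<in> linmaps K M M"
  by (auto simp: linmaps_def)

lemma linmaps_o: "\<lbrakk>f \<in> linmaps K M N; g \<in> linmaps K N P\<rbrakk> \<Longrightarrow> g \<circ> f \<in> linmaps K M P"
  by (auto simp: linmaps_def Pi_iff)

lemma linmaps_compose:
  "\<lbrakk>g \<in> linmaps K N P; f \<in> linmaps K M N\<rbrakk> \<Longrightarrow> (\<lambda>x. g (f x)) \<in> linmaps K M P"
  by (auto simp: linmaps_def Pi_iff)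

lemma linmaps_finsum:
  assumes "module K M" "module K N" "f \<in> linmaps K M N" "g \<in> S \<rightarrow> carrier M"
  shows "f (\<Oplus>\<^bsub>M\<^esub>i\<in>S. g i) = (\<Oplus>\<^bsub>N\<^esub>i\<in>S. f (g i))"
proof -
  interpret M: module K M by fact
  interpret N: module K N by fact
  note f = linmaps_closed[OF assms(3)] linmaps_add[OF assms(3)] linmaps_smult[OF assms(3)]
  have f0: "f \<zero>\<^bsub>M\<^esub> = \<zero>\<^bsub>N\<^esub>"
    using f(3)[of "\<zero>\<^bsub>K\<^esub>" "\<zero>\<^bsub>M\<^esub>"] by (simp add: f(1))
  show ?thesis
    using assms(4)
  proof (induction S rule: infinite_finite_induct)
    case (insert x S)
    have "(\<Oplus>\<^bsub>M\<^esub>i\<in>S. g i) \<in> carrier M"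
      using insert.prems by (intro M.M.finsum_closed) auto
    then show ?case using insert
      by (simp add: Pi_iff f)
  qed (auto simp: f0)
qed

definition bilinear ::
    "('k, 'p) ring_scheme \<Rightarrow> ('k, 'm, 'q) module_scheme \<Rightarrow> ('k, 'n, 'r) module_scheme
      \<Rightarrow> ('k, 't, 's) module_scheme \<Rightarrow> ('m \<Rightarrow> 'n \<Rightarrow> 't) \<Rightarrow> bool" where
  "bilinear K M N T b \<longleftrightarrow> (\<forall>m\<in>carrier M. b m \<in> linmaps K N T) \<and>
    (\<forall>n\<in>carrier N. (\<lambda>m. b m n) \<in> linmaps K M T)"

lemma bilinearI:
  assumes "\<And>m. m \<in> carrier M \<Longrightarrow> b m \<in> linmaps K N T"
    and "\<And>n. n \<in> carrier N \<Longrightarrow> (\<lambda>m. b m n) \<in> linmaps K M T"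
  shows "bilinear K M N T b"
  using assms by (auto simp: bilinear_def)

lemma bilinear_linear_right: "\<lbrakk>bilinear K M N T b; m \<in> carrier M\<rbrakk> \<Longrightarrow> b m \<in> linmaps K N T"
  and bilinear_linear_left: "\<lbrakk>bilinear K M N T b; n \<in> carrier N\<rbrakk> \<Longrightarrow> (\<lambda>m. b m n) \<in> linmaps K M T"
  by (auto simp: bilinear_def)

lemma bilinear_closed:
  "\<lbrakk>bilinear K M N T b; m \<in> carrier M; n \<in> carrier N\<rbrakk> \<Longrightarrow> b m n \<in> carrier T"
  by (auto simp: bilinear_def linmaps_def)

lemma
  assumes "bilinear K M N T b"
  shows bilinear_add_left: "\<lbrakk>m \<in> carrier M; m' \<in> carrier M; n \<in> carrier N\<rbrakk>
        \<Longrightarrow> b (m \<oplus>\<^bsub>M\<^esub> m') n = b m n \<oplus>\<^bsub>T\<^esub> b m' n"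
    and bilinear_add_right: "\<lbrakk>m \<in> carrier M; n \<in> carrier N; n' \<in> carrier N\<rbrakk>
        \<Longrightarrow> b m (n \<oplus>\<^bsub>N\<^esub> n') = b m n \<oplus>\<^bsub>T\<^esub> b m n'"
    and bilinear_smult_left: "\<lbrakk>r \<in> carrier K; m \<in> carrier M; n \<in> carrier N\<rbrakk>
        \<Longrightarrow> b (r \<odot>\<^bsub>M\<^esub> m) n = r \<odot>\<^bsub>T\<^esub> b m n"
    and bilinear_smult_right: "\<lbrakk>r \<in> carrier K; m \<in> carrier M; n \<in> carrier N\<rbrakk>
        \<Longrightarrow> b m (r \<odot>\<^bsub>N\<^esub> n) = r \<odot>\<^bsub>T\<^esub> b m n"
  using assms by (simp_all add: bilinear_def linmaps_def)

lemma bilinear_compose: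
  "\<lbrakk>bilinear K M N T b; f \<in> linmaps K T T'\<rbrakk> \<Longrightarrow> bilinear K M N T' (\<lambda>m n. f (b m n))"
  by (auto simp: bilinear_def intro: linmaps_compose)

text \<open>
  A fold looks only at the values on its index set, also where these leave the carrier. The congruence
  rule for Sweedler-type sums derived from this has no side condition on the summands, so that the
  simplifier can use it as it descends under the binder.
\<close>

lemma foldSetD_cong:
  assumes "(A, z) \<in> foldSetD D f e" "\<And>x. x \<in> A \<Longrightarrow> f x = g x"
  shows "(A, z) \<in> foldSetD D g e"
  using assms
proof (induction rule: foldSetD.induct)
  case emptyI
  then show ?case by (simp add: foldSetD.emptyI)
next
  case (insertI x A y)
  then show ?case by (metis foldSetD.insertI insertCI)
qed

lemma finsum_cong_strong:
  assumes "\<And>i. i \<in> I \<Longrightarrow> f i = g i"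
  shows "finsum G f I = finsum G g I"
proof -
  have "(I, z) \<in> foldSetD (carrier G) (m \<circ> f) e \<longleftrightarrow> (I, z) \<in> foldSetD (carrier G) (m \<circ> g) e" for z m e
    using assms by (auto elim!: foldSetD_cong)
  then show ?thesis
    by (simp add: finsum_def finprod_def foldD_def)
qed

section \<open>The tensor product of two modules\<close>

locale base_ring = cring K for K :: "('k, 'p) ring_scheme" (structure)
begin

subsection \<open>The free module\<close>

lemma free_module_module: "module K (free_module K S)"
proof (rule moduleI)
  show "cring K" ..
  have fin: "finite {x. f x \<oplus> g x \<noteq> \<zero>}" if "finite {x. f x \<noteq> \<zero>}" "finite {x. g x \<noteq> \<zero>}"
    for f g :: "'x \<Rightarrow> 'k"
    by (rule finite_subset[of _ "{x. f x \<noteq> \<zero>} \<union> {x. g x \<noteq> \<zero>}"]) (use that in auto)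
  have fin': "finite {x. r \<otimes> f x \<noteq> \<zero>}" if "finite {x. f x \<noteq> \<zero>}" "r \<in> carrier K"
    for r and f :: "'x \<Rightarrow> 'k"
    by (rule finite_subset[OF _ that(1)]) (use that in auto)
  show "abelian_group (free_module K S)"
  proof (rule abelian_groupI)
    fix f assume f: "f \<in> carrier (free_module K S)"
    have "finite {x. \<ominus> f x \<noteq> \<zero>}"
      using f by (auto simp: free_module_def elim!: finite_subset[rotated])
    then show "\<exists>g\<in>carrier (free_module K S). g \<oplus>\<^bsub>free_module K S\<^esub> f = \<zero>\<^bsub>free_module K S\<^esub>"
      using f by (intro bexI[of _ "\<lambda>x. \<ominus> f x"]) (auto simp: free_module_def l_neg)
  qed (auto simp: free_module_def fin a_ac fun_eq_iff)
  show "\<And>a x. \<lbrakk>a \<in> carrier K; x \<in> carrier (free_module K S)\<rbrakk>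
    \<Longrightarrow> a \<odot>\<^bsub>free_module K S\<^esub> x \<in> carrier (free_module K S)"
    by (auto simp: free_module_def fin')
qed (auto simp: free_module_def fun_eq_iff l_distr r_distr m_assoc)

lemma free_module_ops:
  "\<zero>\<^bsub>free_module K S\<^esub> = (\<lambda>x. \<zero>)"
  "f \<oplus>\<^bsub>free_module K S\<^esub> g = (\<lambda>x. f x \<oplus> g x)"
  by (simp_all add: free_module_def)

lemma free_gen_closed: "x \<in> S \<Longrightarrow> free_gen K x \<in> carrier (free_module K S)"
  by (auto simp: free_module_def free_gen_def)

text \<open>
  The value of a Sweedler-type sum on a given representative \<open>p\<close>, linear in \<open>p\<close> for every function \<open>b\<close>.
\<close>

definition lin_ext :: "('k, 't, 's) module_scheme \<Rightarrow> ('m \<Rightarrow> 'n \<Rightarrow> 't) \<Rightarrow> ('m \<times> 'n \<Rightarrow> 'k) \<Rightarrow> 't" where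
  "lin_ext T b p = (\<Oplus>\<^bsub>T\<^esub>z\<in>{z. p z \<noteq> \<zero>}. p z \<odot>\<^bsub>T\<^esub> b (fst z) (snd z))"

lemma lin_ext_superset:
  assumes "module K T" "p \<in> carrier (free_module K S)" "finite S'" "{z. p z \<noteq> \<zero>} \<subseteq> S'"
    and "\<And>z. z \<in> S' \<Longrightarrow> b (fst z) (snd z) \<in> carrier T"
  shows "lin_ext T b p = (\<Oplus>\<^bsub>T\<^esub>z\<in>S'. p z \<odot>\<^bsub>T\<^esub> b (fst z) (snd z))"
proof -
  interpret T: module K T by fact
  have [simp]: "p z \<in> carrier K" for z
    using assms(2) by (cases z) (simp add: free_module_def)
  show ?thesis
    unfolding lin_ext_def
    by (rule T.M.add.finprod_mono_neutral_cong_left) (use assms in auto)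
qed

lemma lin_ext_linear:
  assumes "module K T" "\<And>m n. (m, n) \<in> S \<Longrightarrow> b m n \<in> carrier T"
  shows "lin_ext T b \<in> linmaps K (free_module K S) T"
proof -
  interpret T: module K T by fact
  let ?F = "free_module K S"
  have b: "b (fst z) (snd z) \<in> carrier T" if "z \<in> S" for z
    using assms(2)[of "fst z" "snd z"] that by simp
  have F: "finite {z. p z \<noteq> \<zero>}" "{z. p z \<noteq> \<zero>} \<subseteq> S" "p z \<in> carrier K"
    if "p \<in> carrier ?F" for p z
    using that by (cases z; auto simp: free_module_def)+
  interpret F: module K ?F by (rule free_module_module)
  show ?thesis
  proof (rule linmapsI)
    fix p assume p: "p \<in> carrier ?F"
    show "lin_ext T b p \<in> carrier T"
      unfolding lin_ext_def
      using F[OF p] b by (intro T.M.finsum_closed) blast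
  next
    fix p q assume p: "p \<in> carrier ?F" and q: "q \<in> carrier ?F"
    let ?S = "{z. p z \<noteq> \<zero>} \<union> {z. q z \<noteq> \<zero>}"
    have fin: "finite ?S" and sub: "?S \<subseteq> S"
      using F[OF p] F[OF q] by auto
    have pq: "p \<oplus>\<^bsub>?F\<^esub> q = (\<lambda>z. p z \<oplus> q z)" by (simp add: free_module_def)
    have "lin_ext T b (p \<oplus>\<^bsub>?F\<^esub> q)
        = (\<Oplus>\<^bsub>T\<^esub>z\<in>?S. (p \<oplus>\<^bsub>?F\<^esub> q) z \<odot>\<^bsub>T\<^esub> b (fst z) (snd z))"
      by (rule lin_ext_superset[OF assms(1) F.M.a_closed[OF p q] fin])
        (use sub b F[OF p] F[OF q] in \<open>auto simp: pq\<close>)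
    also have "\<dots> = (\<Oplus>\<^bsub>T\<^esub>z\<in>?S. p z \<odot>\<^bsub>T\<^esub> b (fst z) (snd z) \<oplus>\<^bsub>T\<^esub> q z \<odot>\<^bsub>T\<^esub> b (fst z) (snd z))"
      unfolding pq
      by (rule T.M.finsum_cong') (use sub b F(3)[OF p] F(3)[OF q] in \<open>auto simp: T.smult_l_distr subset_iff\<close>)
    also have "\<dots> = (\<Oplus>\<^bsub>T\<^esub>z\<in>?S. p z \<odot>\<^bsub>T\<^esub> b (fst z) (snd z)) \<oplus>\<^bsub>T\<^esub>
        (\<Oplus>\<^bsub>T\<^esub>z\<in>?S. q z \<odot>\<^bsub>T\<^esub> b (fst z) (snd z))"
      by (rule T.M.finsum_addf) (use sub b F(3)[OF p] F(3)[OF q] in blast)+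
    also have "(\<Oplus>\<^bsub>T\<^esub>z\<in>?S. p z \<odot>\<^bsub>T\<^esub> b (fst z) (snd z)) = lin_ext T b p"
      by (rule lin_ext_superset[OF assms(1) p fin, symmetric]) (use sub b in blast)+
    also have "(\<Oplus>\<^bsub>T\<^esub>z\<in>?S. q z \<odot>\<^bsub>T\<^esub> b (fst z) (snd z)) = lin_ext T b q"
      by (rule lin_ext_superset[OF assms(1) q fin, symmetric]) (use sub b in blast)+
    finally show "lin_ext T b (p \<oplus>\<^bsub>?F\<^esub> q) = lin_ext T b p \<oplus>\<^bsub>T\<^esub> lin_ext T b q" .
  next
    fix r p assume r: "r \<in> carrier K" and p: "p \<in> carrier ?F"
    have rp: "r \<odot>\<^bsub>?F\<^esub> p = (\<lambda>z. r \<otimes> p z)" by (simp add: free_module_def)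
    have "lin_ext T b (r \<odot>\<^bsub>?F\<^esub> p)
        = (\<Oplus>\<^bsub>T\<^esub>z\<in>{z. p z \<noteq> \<zero>}. (r \<odot>\<^bsub>?F\<^esub> p) z \<odot>\<^bsub>T\<^esub> b (fst z) (snd z))"
      by (rule lin_ext_superset[OF assms(1) F.smult_closed[OF r p] F(1)[OF p]])
        (use b F[OF p] r in \<open>auto simp: rp\<close>)
    also have "\<dots> = (\<Oplus>\<^bsub>T\<^esub>z\<in>{z. p z \<noteq> \<zero>}. r \<odot>\<^bsub>T\<^esub> (p z \<odot>\<^bsub>T\<^esub> b (fst z) (snd z)))"
      unfolding rp
      by (rule T.M.finsum_cong') (use b F[OF p] r in \<open>auto simp: T.smult_assoc1 subset_iff\<close>)
    also have "\<dots> = r \<odot>\<^bsub>T\<^esub> lin_ext T b p"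
      unfolding lin_ext_def
      by (rule T.finsum_smult_ldistr[symmetric]) (use b F[OF p] r in blast)+
    finally show "lin_ext T b (r \<odot>\<^bsub>?F\<^esub> p) = r \<odot>\<^bsub>T\<^esub> lin_ext T b p" .
  qed
qed

lemma lin_ext_free_gen:
  assumes "module K T" "b m n \<in> carrier T"
  shows "lin_ext T b (free_gen K (m, n)) = b m n"
proof -
  interpret T: module K T by fact
  have "lin_ext T b (free_gen K (m, n)) =
      (\<Oplus>\<^bsub>T\<^esub>z\<in>{(m, n)}. free_gen K (m, n) z \<odot>\<^bsub>T\<^esub> b (fst z) (snd z))"
    by (rule lin_ext_superset[OF assms(1) free_gen_closed[of _ "{(m, n)}"]])
      (use assms in \<open>auto simp: free_gen_def\<close>)
  then show ?thesis
    using assms by (simp add: free_gen_def)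
qed

end

subsection \<open>The quotient construction\<close>

locale tensor_pair = base_ring K + M: module K M + N: module K N
  for K :: "('k, 'p) ring_scheme" (structure)
    and M :: "('k, 'm, 'q) module_scheme" and N :: "('k, 'n, 'r) module_scheme"
begin

abbreviation "S \<equiv> carrier M \<times> carrier N"
abbreviation "F \<equiv> free_module K S"
abbreviation "H \<equiv> tensor_null K M N"

sublocale F: module K F
  by (rule free_module_module)

lemma tensor_rels_subset: "tensor_rels K M N \<subseteq> carrier F"
  by (auto simp: tensor_rels_def Let_def F.M.minus_eq free_gen_closed)

lemma tensor_null_submodule: "submodule H K F"
proof -
  let ?C = "{H. submodule H K F \<and> tensor_rels K M N \<subseteq> H}"
  have sub: "submodule X K F" if "X \<in> ?C" for X using that by simp
  note E = F.submoduleE[OF sub]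
  have C: "carrier F \<in> ?C"
    using F.carrier_is_submodule tensor_rels_subset by simp
  show ?thesis
    unfolding tensor_null_def
  proof (rule F.submoduleI)
    show "\<Inter>?C \<subseteq> carrier F" by (rule Inter_lower[OF C])
    show "\<zero>\<^bsub>F\<^esub> \<in> \<Inter>?C"
    proof (rule InterI)
      fix X assume "X \<in> ?C"
      then show "\<zero>\<^bsub>F\<^esub> \<in> X"
        using subgroup.one_closed[OF submodule.axioms(1)[OF sub]] by simp
    qed
    show "\<ominus>\<^bsub>F\<^esub> a \<in> \<Inter>?C" if "a \<in> \<Inter>?C" for a
      using that E(3) by (intro InterI) (meson InterE)
    show "a \<oplus>\<^bsub>F\<^esub> b \<in> \<Inter>?C" if "a \<in> \<Inter>?C" "b \<in> \<Inter>?C" for a b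
      using that E(5) by (intro InterI) (meson InterE)
    show "r \<odot>\<^bsub>F\<^esub> a \<in> \<Inter>?C" if "r \<in> carrier K" "a \<in> \<Inter>?C" for r a
      using that E(4) by (intro InterI) (meson InterE)
  qed
qed

lemma tensor_rels_null: "tensor_rels K M N \<subseteq> H"
  by (auto simp: tensor_null_def)

lemma tensor_null_least: "\<lbrakk>submodule X K F; tensor_rels K M N \<subseteq> X\<rbrakk> \<Longrightarrow> H \<subseteq> X"
  by (auto simp: tensor_null_def)

sublocale H: abelian_subgroup H F
  by (rule abelian_subgroupI3)
    (use tensor_null_submodule in \<open>auto simp: additive_subgroup_def submodule_def F.M.abelian_group_axioms\<close>)

lemma tensor_null_smult: "\<lbrakk>r \<in> carrier K; f \<in> H\<rbrakk> \<Longrightarrow> r \<odot>\<^bsub>F\<^esub> f \<in> H"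
  using F.submoduleE(4)[OF tensor_null_submodule] .

definition cls :: "('m \<times> 'n \<Rightarrow> 'k) \<Rightarrow> ('m \<times> 'n \<Rightarrow> 'k) set" where
  "cls f = H +>\<^bsub>F\<^esub> f"

lemma cls_eq_iff: "\<lbrakk>f \<in> carrier F; g \<in> carrier F\<rbrakk> \<Longrightarrow> cls f = cls g \<longleftrightarrow> f \<ominus>\<^bsub>F\<^esub> g \<in> H"
  unfolding cls_def
  by (metis F.M.minus_eq H.a_rcos_module H.a_rcos_self H.a_repr_independence' )

lemma in_cls: "f \<in> carrier F \<Longrightarrow> f \<in> cls f"
  unfolding cls_def by (rule H.a_rcos_self)

lemma cls_memD: "\<lbrakk>g \<in> cls f; f \<in> carrier F\<rbrakk> \<Longrightarrow> g \<in> carrier F \<and> cls g = cls f"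
  unfolding cls_def
  by (metis H.a_elemrcos_carrier H.a_repr_independence')

lemma tensor_carrier: "carrier (M \<boxtimes>\<^bsub>K\<^esub> N) = cls ` carrier F"
  by (auto simp: tensor_def Let_def A_RCOSETS_def' cls_def)

lemma tensor_zero: "\<zero>\<^bsub>M \<boxtimes>\<^bsub>K\<^esub> N\<^esub> = cls \<zero>\<^bsub>F\<^esub>"
  using H.a_subset by (simp add: tensor_def Let_def cls_def)

lemma tensor_add:
  "\<lbrakk>f \<in> carrier F; g \<in> carrier F\<rbrakk> \<Longrightarrow> cls f \<oplus>\<^bsub>M \<boxtimes>\<^bsub>K\<^esub> N\<^esub> cls g = cls (f \<oplus>\<^bsub>F\<^esub> g)"
  using H.a_rcos_sum by (simp add: tensor_def Let_def cls_def)

lemma tensor_smult: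
  assumes "r \<in> carrier K" "f \<in> carrier F"
  shows "r \<odot>\<^bsub>M \<boxtimes>\<^bsub>K\<^esub> N\<^esub> cls f = cls (r \<odot>\<^bsub>F\<^esub> f)"
proof -
  have "cls (r \<odot>\<^bsub>F\<^esub> g) = cls (r \<odot>\<^bsub>F\<^esub> f)" if "g \<in> cls f" for g
  proof -
    have g: "g \<in> carrier F" "g \<ominus>\<^bsub>F\<^esub> f \<in> H"
      using cls_memD[OF that assms(2)] cls_eq_iff assms(2) by auto
    have "r \<odot>\<^bsub>F\<^esub> g \<ominus>\<^bsub>F\<^esub> r \<odot>\<^bsub>F\<^esub> f = r \<odot>\<^bsub>F\<^esub> (g \<ominus>\<^bsub>F\<^esub> f)"
      using g assms by (simp add: F.M.minus_eq F.smult_r_distr F.smult_r_minus)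
    then show ?thesis
      using g assms by (simp add: cls_eq_iff tensor_null_smult)
  qed
  then have "(\<Union>g\<in>cls f. cls (r \<odot>\<^bsub>F\<^esub> g)) = cls (r \<odot>\<^bsub>F\<^esub> f)"
    using in_cls[OF assms(2)] by blast
  then show ?thesis
    by (simp add: tensor_def Let_def cls_def)
qed

lemma tens_cls: "tens K M N m n = cls (free_gen K (m, n))"
  by (simp add: tens_def cls_def)

lemma tensor_module: "module K (M \<boxtimes>\<^bsub>K\<^esub> N)"
proof (rule moduleI)
  show "abelian_group (M \<boxtimes>\<^bsub>K\<^esub> N)"
  proof (rule abelian_groupI)
    fix X assume "X \<in> carrier (M \<boxtimes>\<^bsub>K\<^esub> N)"
    then obtain f where "f \<in> carrier F" "X = cls f" by (auto simp: tensor_carrier)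
    then show "\<exists>Y\<in>carrier (M \<boxtimes>\<^bsub>K\<^esub> N). Y \<oplus>\<^bsub>M \<boxtimes>\<^bsub>K\<^esub> N\<^esub> X = \<zero>\<^bsub>M \<boxtimes>\<^bsub>K\<^esub> N\<^esub>"
      by (intro bexI[of _ "cls (\<ominus>\<^bsub>F\<^esub> f)"])
        (auto simp: tensor_carrier tensor_add tensor_zero F.M.l_neg)
  qed (auto simp: tensor_carrier tensor_add tensor_zero F.M.a_ac)
qed (auto simp: tensor_carrier tensor_add tensor_smult F.smult_l_distr F.smult_r_distr F.smult_assoc1
    intro: cring_axioms)

sublocale T: module K "M \<boxtimes>\<^bsub>K\<^esub> N"
  by (rule tensor_module)

lemma tens_bilinear: "bilinear K M N (M \<boxtimes>\<^bsub>K\<^esub> N) (tens K M N)"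
proof -
  have gen: "free_gen K (m, n) \<in> carrier F" if "m \<in> carrier M" "n \<in> carrier N" for m n
    using that by (intro free_gen_closed) auto
  have rel: "cls f = cls g" if "f \<ominus>\<^bsub>F\<^esub> g \<in> tensor_rels K M N" "f \<in> carrier F" "g \<in> carrier F" for f g
    using that tensor_rels_null by (auto simp: cls_eq_iff)
  show ?thesis
  proof (intro bilinearI linmapsI)
    fix m n assume m: "m \<in> carrier M" and n: "n \<in> carrier N"
    show "tens K M N m n \<in> carrier (M \<boxtimes>\<^bsub>K\<^esub> N)" "tens K M N m n \<in> carrier (M \<boxtimes>\<^bsub>K\<^esub> N)"
      using gen[OF m n] by (auto simp: tens_cls tensor_carrier)
    fix m' assume m': "m' \<in> carrier M"
    show "tens K M N (m \<oplus>\<^bsub>M\<^esub> m') n = tens K M N m n \<oplus>\<^bsub>M \<boxtimes>\<^bsub>K\<^esub> N\<^esub> tens K M N m' n"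
      unfolding tens_cls tensor_add[OF gen[OF m n] gen[OF m' n]]
      by (rule rel; (use m m' n in \<open>unfold tensor_rels_def Let_def, blast\<close>)?) (use m m' n in \<open>simp_all add: gen\<close>)
  next
    fix m n n' assume m: "m \<in> carrier M" and n: "n \<in> carrier N" and n': "n' \<in> carrier N"
    show "tens K M N m (n \<oplus>\<^bsub>N\<^esub> n') = tens K M N m n \<oplus>\<^bsub>M \<boxtimes>\<^bsub>K\<^esub> N\<^esub> tens K M N m n'"
      unfolding tens_cls tensor_add[OF gen[OF m n] gen[OF m n']]
      by (rule rel; (use m n n' in \<open>unfold tensor_rels_def Let_def, blast\<close>)?) (use m n n' in \<open>simp_all add: gen\<close>)
  next
    fix m n r assume m: "m \<in> carrier M" and n: "n \<in> carrier N" and r: "r \<in> carrier K"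
    show "tens K M N (r \<odot>\<^bsub>M\<^esub> m) n = r \<odot>\<^bsub>M \<boxtimes>\<^bsub>K\<^esub> N\<^esub> tens K M N m n"
      unfolding tens_cls tensor_smult[OF r gen[OF m n]]
      by (rule rel; (use m n r in \<open>unfold tensor_rels_def Let_def, blast\<close>)?) (use m n r in \<open>simp_all add: gen\<close>)
    show "tens K M N m (r \<odot>\<^bsub>N\<^esub> n) = r \<odot>\<^bsub>M \<boxtimes>\<^bsub>K\<^esub> N\<^esub> tens K M N m n"
      unfolding tens_cls tensor_smult[OF r gen[OF m n]]
      by (rule rel; (use m n r in \<open>unfold tensor_rels_def Let_def, blast\<close>)?) (use m n r in \<open>simp_all add: gen\<close>)
  qed
qed

subsection \<open>The universal property\<close>

text \<open>
  The formal combinations annihilated by the extension of a bilinear \<open>b\<close> form a submodule that contains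
  the defining relations, hence contains everything that is divided out.
\<close>

lemma lin_ext_cls_cong:
  assumes "module K T" and b: "bilinear K M N T b"
    and f: "f \<in> carrier F" and g: "g \<in> carrier F" and fg: "cls f = cls g"
  shows "lin_ext T b f = lin_ext T b g"
proof -
  interpret T: module K T by fact
  note bl = bilinear_linear_right[OF b] bilinear_linear_left[OF b] bilinear_closed[OF b]
  have lin: "lin_ext T b \<in> linmaps K F T"
    using lin_ext_linear[OF assms(1), of S b] bl by auto
  note lin' = linmaps_closed[OF lin] linmaps_add[OF lin] linmaps_smult[OF lin]
  have minus: "lin_ext T b (p \<ominus>\<^bsub>F\<^esub> q) = lin_ext T b p \<ominus>\<^bsub>T\<^esub> lin_ext T b q"
    if "p \<in> carrier F" "q \<in> carrier F" for p q
  proof -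
    have "\<ominus>\<^bsub>F\<^esub> q = (\<ominus> \<one>) \<odot>\<^bsub>F\<^esub> q" "\<ominus>\<^bsub>T\<^esub> lin_ext T b q = (\<ominus> \<one>) \<odot>\<^bsub>T\<^esub> lin_ext T b q"
      using that lin'(1) by (simp_all add: F.smult_l_minus T.smult_l_minus)
    then show ?thesis
      using that by (simp add: F.M.minus_eq T.M.minus_eq lin')
  qed
  have gen: "free_gen K (m, n) \<in> carrier F" if "m \<in> carrier M" "n \<in> carrier N" for m n
    using that by (intro free_gen_closed) auto
  have ext_gen: "lin_ext T b (free_gen K (m, n)) = b m n" if "m \<in> carrier M" "n \<in> carrier N" for m n
    using lin_ext_free_gen[OF assms(1), of b m n] bl(3) that by simp
  let ?X = "{p \<in> carrier F. lin_ext T b p = \<zero>\<^bsub>T\<^esub>}"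
  have zero: "lin_ext T b \<zero>\<^bsub>F\<^esub> = \<zero>\<^bsub>T\<^esub>"
    using lin'(3)[of "\<zero>" "\<zero>\<^bsub>F\<^esub>"] lin'(1) by simp
  have "submodule ?X K F"
  proof (rule F.submoduleI)
    fix p assume "p \<in> ?X"
    then show "\<ominus>\<^bsub>F\<^esub> p \<in> ?X"
      using minus[of "\<zero>\<^bsub>F\<^esub>" p] by (simp add: F.M.minus_eq zero T.M.minus_eq)
  qed (auto simp: lin' zero)
  moreover have "tensor_rels K M N \<subseteq> ?X"
    using bl(3)
    by (auto simp: tensor_rels_def Let_def gen minus lin' ext_gen bilinear_add_left[OF b] bilinear_add_right[OF b]
        bilinear_smult_left[OF b] bilinear_smult_right[OF b] T.M.minus_eq T.M.r_neg)
  ultimately have "H \<subseteq> ?X" by (rule tensor_null_least)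
  then have "lin_ext T b f \<ominus>\<^bsub>T\<^esub> lin_ext T b g = \<zero>\<^bsub>T\<^esub>"
    using fg f g minus by (auto simp: cls_eq_iff)
  then show ?thesis
    using lin'(1)[OF f] lin'(1)[OF g]
    by (metis T.M.minus_eq T.M.minus_equality T.M.minus_minus T.M.a_inv_closed)
qed

definition rep :: "('m \<times> 'n \<Rightarrow> 'k) set \<Rightarrow> 'm \<times> 'n \<Rightarrow> 'k" where
  "rep X = (SOME p. p \<in> X)"

lemma
  assumes "X \<in> carrier (M \<boxtimes>\<^bsub>K\<^esub> N)"
  shows rep_closed: "rep X \<in> carrier F" and cls_rep: "cls (rep X) = X"
proof -
  obtain f where f: "f \<in> carrier F" "X = cls f" using assms by (auto simp: tensor_carrier)
  then have "rep X \<in> cls f"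
    using in_cls unfolding rep_def by (metis someI)
  then show "rep X \<in> carrier F" "cls (rep X) = X"
    using cls_memD[OF _ f(1)] f(2) by simp_all
qed

lemma sweedler_rep: "sweedler K T X b = lin_ext T b (rep X)"
  by (simp add: sweedler_def lin_ext_def Let_def rep_def)

lemma sweedler_cls:
  assumes "module K T" "bilinear K M N T b" "f \<in> carrier F"
  shows "sweedler K T (cls f) b = lin_ext T b f"
proof -
  have "cls f \<in> carrier (M \<boxtimes>\<^bsub>K\<^esub> N)" using assms(3) by (simp add: tensor_carrier)
  then show ?thesis
    unfolding sweedler_rep
    by (intro lin_ext_cls_cong[OF assms(1,2)]) (simp_all add: rep_closed cls_rep assms(3))
qed

lemma sweedler_linear:
  assumes "module K T" "bilinear K M N T b"
  shows "(\<lambda>X. sweedler K T X b) \<in> linmaps K (M \<boxtimes>\<^bsub>K\<^esub> N) T"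
proof -
  have lin: "lin_ext T b \<in> linmaps K F T"
    using lin_ext_linear[OF assms(1), of S b] bilinear_closed[OF assms(2)] by auto
  show ?thesis
    by (intro linmapsI)
      (auto simp: tensor_carrier tensor_add tensor_smult sweedler_cls[OF assms]
        linmaps_closed[OF lin] linmaps_add[OF lin] linmaps_smult[OF lin])
qed

lemma sweedler_tens:
  assumes "module K T" "bilinear K M N T b" "m \<in> carrier M" "n \<in> carrier N"
  shows "sweedler K T (tens K M N m n) b = b m n"
proof -
  have "free_gen K (m, n) \<in> carrier F"
    using assms(3,4) by (intro free_gen_closed) simp
  then show ?thesis
    unfolding tens_cls
    by (simp add: sweedler_cls[OF assms(1,2)] lin_ext_free_gen[OF assms(1)] bilinear_closed[OF assms(2)] assms(3,4))
qed

lemma free_module_support: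
  assumes "p \<in> carrier F"
  shows "finite {z. p z \<noteq> \<zero>}" "p z \<in> carrier K"
    "p z \<noteq> \<zero> \<Longrightarrow> fst z \<in> carrier M \<and> snd z \<in> carrier N"
  using assms by (cases z; force simp: free_module_def)+

text \<open>
  The next facts hold for every function \<open>b\<close>, because each compares finite sums over one and the same
  representative of \<open>X\<close>.
\<close>

lemma sweedler_closed:
  assumes "module K T" "X \<in> carrier (M \<boxtimes>\<^bsub>K\<^esub> N)"
    and "\<And>m n. \<lbrakk>m \<in> carrier M; n \<in> carrier N\<rbrakk> \<Longrightarrow> b m n \<in> carrier T"
  shows "sweedler K T X b \<in> carrier T"
proof -
  interpret T: module K T by fact
  let ?p = "rep X"
  note p = rep_closed[OF assms(2)] sweedler_rep[of _ X]
  then show ?thesis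
    using lin_ext_linear[OF assms(1), of S b] assms(3) by (auto simp: linmaps_closed p)
qed

lemma sweedler_cong:
  assumes "X \<in> carrier (M \<boxtimes>\<^bsub>K\<^esub> N)"
    and "\<And>m n. \<lbrakk>m \<in> carrier M; n \<in> carrier N\<rbrakk> \<Longrightarrow> b m n = b' m n"
  shows "sweedler K T X b = sweedler K T X b'"
  unfolding sweedler_rep lin_ext_def
  by (rule finsum_cong_strong)
    (use free_module_support(3)[OF rep_closed[OF assms(1)]] assms(2) in simp)

text \<open>
  \<open>f\<close> distributes over the finite sum that defines the Sweedler-type sum. This is how every structure
  map is moved under the binders later on.
\<close>

lemma linmaps_sweedler:
  assumes "module K T" "module K T'" "X \<in> carrier (M \<boxtimes>\<^bsub>K\<^esub> N)" "f \<in> linmaps K T T'"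
    and "\<And>m n. \<lbrakk>m \<in> carrier M; n \<in> carrier N\<rbrakk> \<Longrightarrow> b m n \<in> carrier T"
  shows "f (sweedler K T X b) = sweedler K T' X (\<lambda>m n. f (b m n))"
proof -
  interpret T: module K T by fact
  interpret T': module K T' by fact
  let ?p = "rep X"
  note p = rep_closed[OF assms(3)] sweedler_rep[of _ X]
  note supp = free_module_support[OF p(1)]
  have "f (lin_ext T b ?p) = (\<Oplus>\<^bsub>T'\<^esub>z\<in>{z. ?p z \<noteq> \<zero>}. f (?p z \<odot>\<^bsub>T\<^esub> b (fst z) (snd z)))"
    unfolding lin_ext_def
    by (rule linmaps_finsum[OF assms(1,2,4)]) (use supp assms(5) in auto)
  also have "\<dots> = lin_ext T' (\<lambda>m n. f (b m n)) ?p"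
    unfolding lin_ext_def
    by (rule T'.M.finsum_cong')
      (use supp assms(5) in \<open>auto simp: linmaps_smult[OF assms(4)] linmaps_closed[OF assms(4)]\<close>)
  finally show ?thesis by (simp add: p)
qed

lemma sweedler_add:
  assumes "module K T" "X \<in> carrier (M \<boxtimes>\<^bsub>K\<^esub> N)"
    and "\<And>m n. \<lbrakk>m \<in> carrier M; n \<in> carrier N\<rbrakk> \<Longrightarrow> b m n \<in> carrier T"
    and "\<And>m n. \<lbrakk>m \<in> carrier M; n \<in> carrier N\<rbrakk> \<Longrightarrow> b' m n \<in> carrier T"
  shows "sweedler K T X (\<lambda>m n. b m n \<oplus>\<^bsub>T\<^esub> b' m n) = sweedler K T X b \<oplus>\<^bsub>T\<^esub> sweedler K T X b'"
proof -
  interpret T: module K T by fact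
  let ?p = "rep X"
  note supp = free_module_support[OF rep_closed[OF assms(2)]]
  have "sweedler K T X (\<lambda>m n. b m n \<oplus>\<^bsub>T\<^esub> b' m n)
      = (\<Oplus>\<^bsub>T\<^esub>z\<in>{z. ?p z \<noteq> \<zero>}. ?p z \<odot>\<^bsub>T\<^esub> b (fst z) (snd z) \<oplus>\<^bsub>T\<^esub> ?p z \<odot>\<^bsub>T\<^esub> b' (fst z) (snd z))"
    unfolding sweedler_rep lin_ext_def
    by (rule finsum_cong_strong) (use supp assms in \<open>auto simp: T.smult_r_distr\<close>)
  also have "\<dots> = sweedler K T X b \<oplus>\<^bsub>T\<^esub> sweedler K T X b'"
    unfolding sweedler_rep lin_ext_def
    by (rule T.M.finsum_addf) (use supp assms in auto)
  finally show ?thesis .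
qed

lemma sweedler_linear_parameter:
  assumes T: "module K T" and "module K P" and X: "X \<in> carrier (M \<boxtimes>\<^bsub>K\<^esub> N)"
    and b: "\<And>m n. \<lbrakk>m \<in> carrier M; n \<in> carrier N\<rbrakk> \<Longrightarrow> (\<lambda>p. b p m n) \<in> linmaps K P T"
  shows "(\<lambda>p. sweedler K T X (b p)) \<in> linmaps K P T"
proof -
  interpret T: module K T by fact
  interpret P: module K P by fact
  note bl = linmaps_closed[OF b] linmaps_add[OF b] linmaps_smult[OF b]
  show ?thesis
  proof (rule linmapsI)
    fix p assume p: "p \<in> carrier P"
    show "sweedler K T X (b p) \<in> carrier T"
      by (rule sweedler_closed[OF T X]) (rule bl(1)[OF _ _ p])
    fix q assume q: "q \<in> carrier P"
    have "sweedler K T X (b (p \<oplus>\<^bsub>P\<^esub> q)) = sweedler K T X (\<lambda>m n. b p m n \<oplus>\<^bsub>T\<^esub> b q m n)"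
      by (rule sweedler_cong[OF X]) (simp add: bl p q)
    also have "\<dots> = sweedler K T X (b p) \<oplus>\<^bsub>T\<^esub> sweedler K T X (b q)"
      by (rule sweedler_add[OF T X]) (simp_all add: bl p q)
    finally show "sweedler K T X (b (p \<oplus>\<^bsub>P\<^esub> q)) = sweedler K T X (b p) \<oplus>\<^bsub>T\<^esub> sweedler K T X (b q)" .
  next
    fix r p assume r: "r \<in> carrier K" and p: "p \<in> carrier P"
    have scale: "(\<lambda>x. r \<odot>\<^bsub>T\<^esub> x) \<in> linmaps K T T"
      using r by (intro linmapsI) (auto simp: T.smult_r_distr T.smult_assoc1[symmetric] m_comm)
    have "sweedler K T X (b (r \<odot>\<^bsub>P\<^esub> p)) = sweedler K T X (\<lambda>m n. r \<odot>\<^bsub>T\<^esub> b p m n)"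
      by (rule sweedler_cong[OF X]) (simp add: bl p r)
    then show "sweedler K T X (b (r \<odot>\<^bsub>P\<^esub> p)) = r \<odot>\<^bsub>T\<^esub> sweedler K T X (b p)"
      using linmaps_sweedler[OF T T X scale, of "b p"] bl(1) p by simp
  qed
qed

lemma sweedler_sum:
  assumes "module K T" "X \<in> carrier (M \<boxtimes>\<^bsub>K\<^esub> N)"
    and "\<And>m n i. \<lbrakk>m \<in> carrier M; n \<in> carrier N; i \<in> I\<rbrakk> \<Longrightarrow> b i m n \<in> carrier T"
  shows "sweedler K T X (\<lambda>m n. \<Oplus>\<^bsub>T\<^esub>i\<in>I. b i m n) = (\<Oplus>\<^bsub>T\<^esub>i\<in>I. sweedler K T X (b i))"
proof -
  interpret T: module K T by fact
  let ?p = "rep X"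
  note p = rep_closed[OF assms(2)] sweedler_rep[of _ X]
  note supp = free_module_support[OF p(1)]
  show ?thesis
    using assms(3)
  proof (induction I rule: infinite_finite_induct)
    case (infinite I)
    have "(\<Oplus>\<^bsub>T\<^esub>z\<in>{z. ?p z \<noteq> \<zero>}. ?p z \<odot>\<^bsub>T\<^esub> \<zero>\<^bsub>T\<^esub>) = \<zero>\<^bsub>T\<^esub>"
      by (rule T.M.add.finprod_one_eqI) (use supp in auto)
    with infinite show ?case by (simp add: p lin_ext_def)
  next
    case empty
    have "(\<Oplus>\<^bsub>T\<^esub>z\<in>{z. ?p z \<noteq> \<zero>}. ?p z \<odot>\<^bsub>T\<^esub> \<zero>\<^bsub>T\<^esub>) = \<zero>\<^bsub>T\<^esub>"
      by (rule T.M.add.finprod_one_eqI) (use supp in auto)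
    then show ?case by (simp add: p lin_ext_def)
  next
    case (insert i I)
    have closed: "(\<Oplus>\<^bsub>T\<^esub>i\<in>I. b i m n) \<in> carrier T" if "m \<in> carrier M" "n \<in> carrier N" for m n
      using insert that by (intro T.M.finsum_closed) auto
    have sw: "sweedler K T X (b j) \<in> carrier T" if "j \<in> insert i I" for j
      by (rule sweedler_closed[OF assms(1,2)]) (use insert.prems that in auto)
    have "sweedler K T X (\<lambda>m n. \<Oplus>\<^bsub>T\<^esub>i\<in>insert i I. b i m n)
        = sweedler K T X (\<lambda>m n. b i m n \<oplus>\<^bsub>T\<^esub> (\<Oplus>\<^bsub>T\<^esub>i\<in>I. b i m n))"
      by (rule sweedler_cong[OF assms(2)]) (use insert in \<open>auto simp: Pi_iff\<close>)
    also have "\<dots> = sweedler K T X (b i) \<oplus>\<^bsub>T\<^esub> sweedler K T X (\<lambda>m n. \<Oplus>\<^bsub>T\<^esub>i\<in>I. b i m n)"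
      by (rule sweedler_add[OF assms(1,2)]) (use insert.prems closed in auto)
    finally show ?case
      using insert sw by (simp add: Pi_iff)
  qed
qed

text \<open>
  Every tensor is the sum of pure tensors read off from a representative; this is the source of the
  principle that linear maps are determined by pure tensors.
\<close>

lemma sweedler_tens_id:
  assumes "X \<in> carrier (M \<boxtimes>\<^bsub>K\<^esub> N)"
  shows "sweedler K (M \<boxtimes>\<^bsub>K\<^esub> N) X (tens K M N) = X"
proof -
  let ?p = "rep X"
  note p = rep_closed[OF assms] sweedler_rep[of _ X]
  note supp = free_module_support[OF p(1)]
  have cls_lin: "cls \<in> linmaps K F (M \<boxtimes>\<^bsub>K\<^esub> N)"
    by (rule linmapsI) (auto simp: tensor_carrier tensor_add tensor_smult)
  have gen: "free_gen K (fst z, snd z) \<in> carrier F" if "?p z \<noteq> \<zero>" for z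
    using supp(3)[OF that] by (intro free_gen_closed) (simp add: mem_Times_iff)
  have free_sum: "(\<Oplus>\<^bsub>F\<^esub>z\<in>I. ?p z \<odot>\<^bsub>F\<^esub> free_gen K (fst z, snd z)) = (\<lambda>z. if z \<in> I then ?p z else \<zero>)"
    if "I \<subseteq> {z. ?p z \<noteq> \<zero>}" for I
    using finite_subset[OF that supp(1)] that
  proof (induction I rule: finite_induct)
    case empty
    show ?case using F.M.finsum_empty by (simp add: free_module_ops)
  next
    case (insert z I)
    have "?p z \<odot>\<^bsub>F\<^esub> free_gen K (fst z, snd z) = (\<lambda>y. if y = z then ?p z else \<zero>)"
      using supp(2) by (auto simp: free_module_def free_gen_def fun_eq_iff)
    moreover have "?p z \<odot>\<^bsub>F\<^esub> free_gen K (fst z, snd z) \<in> carrier F"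
      and "(\<lambda>z. ?p z \<odot>\<^bsub>F\<^esub> free_gen K (fst z, snd z)) \<in> I \<rightarrow> carrier F"
      using insert.prems gen supp(2) by auto
    ultimately show ?case
      using insert supp(2) by (auto simp: free_module_ops fun_eq_iff)
  qed
  have "X = cls (\<Oplus>\<^bsub>F\<^esub>z\<in>{z. ?p z \<noteq> \<zero>}. ?p z \<odot>\<^bsub>F\<^esub> free_gen K (fst z, snd z))"
    unfolding free_sum[OF order_refl] by (subst cls_rep[OF assms, symmetric], rule arg_cong[of _ _ cls]) (simp add: fun_eq_iff)
  also have "\<dots> = (\<Oplus>\<^bsub>M \<boxtimes>\<^bsub>K\<^esub> N\<^esub>z\<in>{z. ?p z \<noteq> \<zero>}. cls (?p z \<odot>\<^bsub>F\<^esub> free_gen K (fst z, snd z)))"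
    by (rule linmaps_finsum[OF F.module_axioms T.module_axioms cls_lin]) (use supp gen in auto)
  also have "\<dots> = lin_ext (M \<boxtimes>\<^bsub>K\<^esub> N) (tens K M N) ?p"
    unfolding lin_ext_def
    by (rule T.M.finsum_cong')
      (use supp gen bilinear_closed[OF tens_bilinear] in \<open>auto simp: tensor_smult tens_cls\<close>)
  finally show ?thesis by (simp add: p(2))
qed

lemma tensor_ext:
  assumes "module K T" "f \<in> linmaps K (M \<boxtimes>\<^bsub>K\<^esub> N) T" "g \<in> linmaps K (M \<boxtimes>\<^bsub>K\<^esub> N) T"
    and "\<And>m n. \<lbrakk>m \<in> carrier M; n \<in> carrier N\<rbrakk> \<Longrightarrow> f (tens K M N m n) = g (tens K M N m n)"
    and X: "X \<in> carrier (M \<boxtimes>\<^bsub>K\<^esub> N)"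
  shows "f X = g X"
proof -
  have tens: "\<And>m n. \<lbrakk>m \<in> carrier M; n \<in> carrier N\<rbrakk> \<Longrightarrow> tens K M N m n \<in> carrier (M \<boxtimes>\<^bsub>K\<^esub> N)"
    by (rule bilinear_closed[OF tens_bilinear])
  have "f X = sweedler K T X (\<lambda>m n. f (tens K M N m n))"
    using linmaps_sweedler[OF tensor_module assms(1) X assms(2), of "tens K M N"] tens
    by (simp add: sweedler_tens_id[OF X])
  also have "\<dots> = sweedler K T X (\<lambda>m n. g (tens K M N m n))"
    using assms(4) by (rule sweedler_cong[OF X])
  also have "\<dots> = g X"
    using linmaps_sweedler[OF tensor_module assms(1) X assms(3), of "tens K M N"] tens
    by (simp add: sweedler_tens_id[OF X])
  finally show ?thesis .
qed

end

text \<open>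
  An interchange of two finite sums, as the representatives of \<open>X\<close> and \<open>Y\<close> are chosen independently of
  each other and of \<open>b\<close>.
\<close>

lemma (in base_ring) sweedler_commute:
  assumes "module K M" "module K N" "module K P" "module K Q" "module K T"
    and X: "X \<in> carrier (M \<boxtimes>\<^bsub>K\<^esub> N)" and Y: "Y \<in> carrier (P \<boxtimes>\<^bsub>K\<^esub> Q)"
    and b: "\<And>m n p q. \<lbrakk>m \<in> carrier M; n \<in> carrier N; p \<in> carrier P; q \<in> carrier Q\<rbrakk>
      \<Longrightarrow> b m n p q \<in> carrier T"
  shows "sweedler K T X (\<lambda>m n. sweedler K T Y (\<lambda>p q. b m n p q)) =
    sweedler K T Y (\<lambda>p q. sweedler K T X (\<lambda>m n. b m n p q))"
proof -
  interpret MN: tensor_pair K M N using assms by (intro tensor_pair.intro base_ring_axioms)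
  interpret PQ: tensor_pair K P Q using assms by (intro tensor_pair.intro base_ring_axioms)
  interpret T: module K T by fact
  let ?f = "PQ.rep Y"
  note f = PQ.rep_closed[OF Y] PQ.sweedler_rep[of _ Y]
  note supp = PQ.free_module_support[OF f(1)]
  have scale: "(\<lambda>x. r \<odot>\<^bsub>T\<^esub> x) \<in> linmaps K T T" if "r \<in> carrier K" for r
    using that by (intro linmapsI) (auto simp: T.smult_r_distr T.smult_assoc1[symmetric] m_comm)
  have "sweedler K T X (\<lambda>m n. lin_ext T (\<lambda>p q. b m n p q) ?f)
      = (\<Oplus>\<^bsub>T\<^esub>z\<in>{z. ?f z \<noteq> \<zero>}. sweedler K T X (\<lambda>m n. ?f z \<odot>\<^bsub>T\<^esub> b m n (fst z) (snd z)))"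
    unfolding lin_ext_def
    by (rule MN.sweedler_sum[OF assms(5) X]) (use supp b in auto)
  also have "\<dots> = (\<Oplus>\<^bsub>T\<^esub>z\<in>{z. ?f z \<noteq> \<zero>}. ?f z \<odot>\<^bsub>T\<^esub> sweedler K T X (\<lambda>m n. b m n (fst z) (snd z)))"
    by (rule T.M.finsum_cong'[OF refl])
      (use supp b in \<open>auto intro!: MN.linmaps_sweedler[OF assms(5,5) X scale, symmetric]
        MN.sweedler_closed[OF assms(5) X]\<close>)
  finally show ?thesis
    by (simp add: f lin_ext_def)
qed

section \<open>The calculus of Sweedler-type sums\<close>

context base_ring
begin

lemma tensor_module [simp]: "\<lbrakk>module K M; module K N\<rbrakk> \<Longrightarrow> module K (M \<boxtimes>\<^bsub>K\<^esub> N)"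
  by (intro tensor_pair.tensor_module tensor_pair.intro base_ring_axioms)

lemma tensor_pairI: "\<lbrakk>module K M; module K N\<rbrakk> \<Longrightarrow> tensor_pair K M N"
  by (intro tensor_pair.intro base_ring_axioms)

lemmas tens_bilinear = tensor_pair.tens_bilinear[OF tensor_pairI]

lemma tens_closed [simp]:
  "\<lbrakk>module K M; module K N; m \<in> carrier M; n \<in> carrier N\<rbrakk> \<Longrightarrow> tens K M N m n \<in> carrier (M \<boxtimes>\<^bsub>K\<^esub> N)"
  by (rule bilinear_closed[OF tens_bilinear])

text \<open>
  This makes the nested sums in the definitions of the rebracketing maps bilinear in their two
  arguments.
\<close>

lemma bilinear_sweedler:
  assumes "module K M" "module K N" "module K P" "module K T"
    and "\<And>p. p \<in> carrier P \<Longrightarrow> bilinear K M N T (b p)"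
    and "\<And>m n. \<lbrakk>m \<in> carrier M; n \<in> carrier N\<rbrakk> \<Longrightarrow> (\<lambda>p. b p m n) \<in> linmaps K P T"
  shows "bilinear K P (M \<boxtimes>\<^bsub>K\<^esub> N) T (\<lambda>p X. sweedler K T X (b p))"
proof (rule bilinearI)
  show "(\<lambda>X. sweedler K T X (b p)) \<in> linmaps K (M \<boxtimes>\<^bsub>K\<^esub> N) T" if "p \<in> carrier P" for p
    by (rule tensor_pair.sweedler_linear[OF tensor_pairI]) (use assms that in auto)
  show "(\<lambda>p. sweedler K T X (b p)) \<in> linmaps K P T" if "X \<in> carrier (M \<boxtimes>\<^bsub>K\<^esub> N)" for X
    by (rule tensor_pair.sweedler_linear_parameter[OF tensor_pairI]) (use assms that in auto)
qed

lemma bilinear_flip: "bilinear K M N T b \<Longrightarrow> bilinear K N M T (\<lambda>n m. b m n)"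
  by (simp add: bilinear_def)

text \<open>
  \<open>sw M N T X b\<close> is \<open>sweedler K T X b\<close> for \<open>X \<in> M \<otimes> N\<close>. Naming the factors lets the congruence rule
  below supply their carriers while the simplifier works below the binders, and the guard makes that
  rule unconditional.
\<close>

definition sw where
  "sw M N T X b = (if module K M \<and> module K N \<and> X \<in> carrier (M \<boxtimes>\<^bsub>K\<^esub> N) then sweedler K T X b else undefined)"

lemma sw_eq: "\<lbrakk>module K M; module K N; X \<in> carrier (M \<boxtimes>\<^bsub>K\<^esub> N)\<rbrakk> \<Longrightarrow> sw M N T X b = sweedler K T X b"
  by (simp add: sw_def)

lemma sw_cong [cong]:
  assumes "X = Y" "\<And>m n. \<lbrakk>m \<in> carrier M; n \<in> carrier N\<rbrakk> \<Longrightarrow> b m n = b' m n"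
  shows "sw M N T X b = sw M N T Y b'"
  using assms tensor_pair.sweedler_cong[OF tensor_pairI, of M N Y b b'] by (auto simp: sw_def)

lemma sw_closed [simp]:
  assumes "module K M" "module K N" "module K T" "X \<in> carrier (M \<boxtimes>\<^bsub>K\<^esub> N)"
    and "\<And>m n. \<lbrakk>m \<in> carrier M; n \<in> carrier N\<rbrakk> \<Longrightarrow> b m n \<in> carrier T"
  shows "sw M N T X b \<in> carrier T"
  unfolding sw_eq[OF assms(1,2,4)]
  by (rule tensor_pair.sweedler_closed[OF tensor_pairI]) (use assms in auto)

lemma linmaps_sw:
  assumes "f \<in> linmaps K T T'" "module K M" "module K N" "module K T" "module K T'"
    and "X \<in> carrier (M \<boxtimes>\<^bsub>K\<^esub> N)"
    and "\<And>m n. \<lbrakk>m \<in> carrier M; n \<in> carrier N\<rbrakk> \<Longrightarrow> b m n \<in> carrier T"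
  shows "f (sw M N T X b) = sw M N T' X (\<lambda>m n. f (b m n))"
  using assms tensor_pair.linmaps_sweedler[OF tensor_pairI, of M N T T' X f b] by (simp add: sw_def)

lemma sw_tens_id:
  "\<lbrakk>module K M; module K N; X \<in> carrier (M \<boxtimes>\<^bsub>K\<^esub> N)\<rbrakk> \<Longrightarrow> sw M N (M \<boxtimes>\<^bsub>K\<^esub> N) X (\<lambda>m n. tens K M N m n) = X"
  by (simp add: sw_def tensor_pair.sweedler_tens_id[OF tensor_pairI])

lemma sw_commute:
  assumes "module K M" "module K N" "module K P" "module K Q" "module K T"
    and "X \<in> carrier (M \<boxtimes>\<^bsub>K\<^esub> N)" "Y \<in> carrier (P \<boxtimes>\<^bsub>K\<^esub> Q)"
    and "\<And>m n p q. \<lbrakk>m \<in> carrier M; n \<in> carrier N; p \<in> carrier P; q \<in> carrier Q\<rbrakk>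
      \<Longrightarrow> b m n p q \<in> carrier T"
  shows "sw M N T X (\<lambda>m n. sw P Q T Y (\<lambda>p q. b m n p q)) =
    sw P Q T Y (\<lambda>p q. sw M N T X (\<lambda>m n. b m n p q))"
  using assms sweedler_commute[of M N P Q T X Y b] by (simp add: sw_def)

lemma sw_linear_parameter:
  assumes "module K M" "module K N" "module K P" "module K T" "X \<in> carrier (M \<boxtimes>\<^bsub>K\<^esub> N)"
    and "\<And>m n. \<lbrakk>m \<in> carrier M; n \<in> carrier N\<rbrakk> \<Longrightarrow> (\<lambda>p. b p m n) \<in> linmaps K P T"
  shows "(\<lambda>p. sw M N T X (b p)) \<in> linmaps K P T"
  unfolding sw_eq[OF assms(1,2,5)]
  by (rule tensor_pair.sweedler_linear_parameter[OF tensor_pairI]) (use assms in auto)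

lemma tensor_ext:
  assumes "f \<in> linmaps K (M \<boxtimes>\<^bsub>K\<^esub> N) T" "g \<in> linmaps K (M \<boxtimes>\<^bsub>K\<^esub> N) T"
    and "module K M" "module K N" "module K T"
    and "\<And>m n. \<lbrakk>m \<in> carrier M; n \<in> carrier N\<rbrakk> \<Longrightarrow> f (tens K M N m n) = g (tens K M N m n)"
    and "X \<in> carrier (M \<boxtimes>\<^bsub>K\<^esub> N)"
  shows "f X = g X"
  using assms tensor_pair.tensor_ext[OF tensor_pairI] by blast

lemma eq_on_triple_tensorI:
  assumes "f \<in> linmaps K (M \<boxtimes>\<^bsub>K\<^esub> (N \<boxtimes>\<^bsub>K\<^esub> P)) T" "g \<in> linmaps K (M \<boxtimes>\<^bsub>K\<^esub> (N \<boxtimes>\<^bsub>K\<^esub> P)) T"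
    and "module K M" "module K N" "module K P" "module K T"
    and eq: "\<And>m n p. \<lbrakk>m \<in> carrier M; n \<in> carrier N; p \<in> carrier P\<rbrakk>
      \<Longrightarrow> f (tens K M (N \<boxtimes>\<^bsub>K\<^esub> P) m (tens K N P n p)) = g (tens K M (N \<boxtimes>\<^bsub>K\<^esub> P) m (tens K N P n p))"
  shows "eq_on (M \<boxtimes>\<^bsub>K\<^esub> (N \<boxtimes>\<^bsub>K\<^esub> P)) f g"
  unfolding eq_on_def
proof
  fix X assume X: "X \<in> carrier (M \<boxtimes>\<^bsub>K\<^esub> (N \<boxtimes>\<^bsub>K\<^esub> P))"
  have *: "f (tens K M (N \<boxtimes>\<^bsub>K\<^esub> P) m Y) = g (tens K M (N \<boxtimes>\<^bsub>K\<^esub> P) m Y)"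
    if "m \<in> carrier M" "Y \<in> carrier (N \<boxtimes>\<^bsub>K\<^esub> P)" for m Y
    by (rule tensor_ext[OF linmaps_compose[OF assms(1) bilinear_linear_right[OF tens_bilinear]]
          linmaps_compose[OF assms(2) bilinear_linear_right[OF tens_bilinear]] _ _ _ _ that(2)])
      (use assms that in auto)
  show "f X = g X"
    by (rule tensor_ext[OF assms(1,2) _ _ _ _ X]) (use assms * in auto)
qed

lemma eq_on_triple_tensorD:
  assumes "eq_on (M \<boxtimes>\<^bsub>K\<^esub> (N \<boxtimes>\<^bsub>K\<^esub> P)) f g" "module K M" "module K N" "module K P"
    "m \<in> carrier M" "n \<in> carrier N" "p \<in> carrier P"
  shows "f (tens K M (N \<boxtimes>\<^bsub>K\<^esub> P) m (tens K N P n p)) = g (tens K M (N \<boxtimes>\<^bsub>K\<^esub> P) m (tens K N P n p))"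
  using assms by (simp add: eq_on_def)

lemma tens_sw_left:
  assumes "module K P" "module K Q" "module K M" "module K N" "X \<in> carrier (P \<boxtimes>\<^bsub>K\<^esub> Q)" "n \<in> carrier N"
    and "\<And>p q. \<lbrakk>p \<in> carrier P; q \<in> carrier Q\<rbrakk> \<Longrightarrow> b p q \<in> carrier M"
  shows "tens K M N (sw P Q M X b) n = sw P Q (M \<boxtimes>\<^bsub>K\<^esub> N) X (\<lambda>p q. tens K M N (b p q) n)"
  by (rule linmaps_sw[OF bilinear_linear_left[OF tens_bilinear]]) (use assms in simp_all)

lemma tens_sw_right:
  assumes "module K P" "module K Q" "module K M" "module K N" "X \<in> carrier (P \<boxtimes>\<^bsub>K\<^esub> Q)" "m \<in> carrier M"
    and "\<And>p q. \<lbrakk>p \<in> carrier P; q \<in> carrier Q\<rbrakk> \<Longrightarrow> b p q \<in> carrier N"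
  shows "tens K M N m (sw P Q N X b) = sw P Q (M \<boxtimes>\<^bsub>K\<^esub> N) X (\<lambda>p q. tens K M N m (b p q))"
  by (rule linmaps_sw[OF bilinear_linear_right[OF tens_bilinear]]) (use assms in simp_all)

lemma
  assumes "f \<in> linmaps K M M'" "g \<in> linmaps K N N'" "module K M" "module K N" "module K M'" "module K N'"
  shows tmap_linear: "tmap K M' N' f g \<in> linmaps K (M \<boxtimes>\<^bsub>K\<^esub> N) (M' \<boxtimes>\<^bsub>K\<^esub> N')"
    and tmap_tens: "\<lbrakk>m \<in> carrier M; n \<in> carrier N\<rbrakk>
      \<Longrightarrow> tmap K M' N' f g (tens K M N m n) = tens K M' N' (f m) (g n)"
proof -
  have bl: "bilinear K M N (M' \<boxtimes>\<^bsub>K\<^esub> N') (\<lambda>x y. tens K M' N' (f x) (g y))"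
    using assms
    by (intro bilinearI linmaps_compose[OF bilinear_linear_right[OF tens_bilinear]]
        linmaps_compose[OF bilinear_linear_left[OF tens_bilinear]])
      (auto intro: linmaps_closed)
  show "tmap K M' N' f g \<in> linmaps K (M \<boxtimes>\<^bsub>K\<^esub> N) (M' \<boxtimes>\<^bsub>K\<^esub> N')"
    unfolding tmap_def[abs_def]
    by (rule tensor_pair.sweedler_linear[OF tensor_pairI _ bl]) (use assms in simp_all)
  show "tmap K M' N' f g (tens K M N m n) = tens K M' N' (f m) (g n)"
    if "m \<in> carrier M" "n \<in> carrier N"
    unfolding tmap_def
    by (rule tensor_pair.sweedler_tens[OF tensor_pairI _ bl]) (use assms that in simp_all)
qed

lemma tmap_sw:
  assumes "f \<in> linmaps K M M'" "g \<in> linmaps K N N'"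
    and "module K P" "module K Q" "module K M" "module K N" "module K M'" "module K N'"
    and "X \<in> carrier (P \<boxtimes>\<^bsub>K\<^esub> Q)"
    and "\<And>p q. \<lbrakk>p \<in> carrier P; q \<in> carrier Q\<rbrakk> \<Longrightarrow> b p q \<in> carrier (M \<boxtimes>\<^bsub>K\<^esub> N)"
  shows "tmap K M' N' f g (sw P Q (M \<boxtimes>\<^bsub>K\<^esub> N) X b)
    = sw P Q (M' \<boxtimes>\<^bsub>K\<^esub> N') X (\<lambda>p q. tmap K M' N' f g (b p q))"
  by (rule linmaps_sw[OF tmap_linear]) (use assms in simp_all)

lemma
  assumes "module K M" "module K N" "module K P"
  shows assocr_linear: "assocr K M N P \<in> linmaps K ((M \<boxtimes>\<^bsub>K\<^esub> N) \<boxtimes>\<^bsub>K\<^esub> P) (M \<boxtimes>\<^bsub>K\<^esub> (N \<boxtimes>\<^bsub>K\<^esub> P))"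
    and assocr_tens: "\<lbrakk>m \<in> carrier M; n \<in> carrier N; p \<in> carrier P\<rbrakk> \<Longrightarrow>
      assocr K M N P (tens K (M \<boxtimes>\<^bsub>K\<^esub> N) P (tens K M N m n) p) = tens K M (N \<boxtimes>\<^bsub>K\<^esub> P) m (tens K N P n p)"
proof -
  let ?T = "M \<boxtimes>\<^bsub>K\<^esub> (N \<boxtimes>\<^bsub>K\<^esub> P)"
  let ?b = "\<lambda>p m n. tens K M (N \<boxtimes>\<^bsub>K\<^esub> P) m (tens K N P n p)"
  note lin = bilinear_linear_left[OF tens_bilinear] bilinear_linear_right[OF tens_bilinear]
  have b1: "bilinear K M N ?T (?b p)" if "p \<in> carrier P" for p
    using assms that by (intro bilinearI linmaps_compose[OF lin(2) lin(1)] lin(1)) auto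
  have bl: "bilinear K (M \<boxtimes>\<^bsub>K\<^esub> N) P ?T (\<lambda>Y p. sweedler K ?T Y (?b p))"
    by (rule bilinear_flip[OF bilinear_sweedler])
      (use assms b1 in \<open>auto intro!: linmaps_compose[OF lin(2) lin(2)]\<close>)
  show "assocr K M N P \<in> linmaps K ((M \<boxtimes>\<^bsub>K\<^esub> N) \<boxtimes>\<^bsub>K\<^esub> P) ?T"
    unfolding assocr_def[abs_def]
    by (rule tensor_pair.sweedler_linear[OF tensor_pairI _ bl]) (use assms in simp_all)
  show "assocr K M N P (tens K (M \<boxtimes>\<^bsub>K\<^esub> N) P (tens K M N m n) p) = tens K M (N \<boxtimes>\<^bsub>K\<^esub> P) m (tens K N P n p)"
    if "m \<in> carrier M" "n \<in> carrier N" "p \<in> carrier P"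
    unfolding assocr_def
    by (subst tensor_pair.sweedler_tens[OF tensor_pairI _ bl])
      (use assms that in \<open>simp_all add: tensor_pair.sweedler_tens[OF tensor_pairI _ b1]\<close>)
qed

lemma
  assumes "module K M" "module K N" "module K P"
  shows assocl_linear: "assocl K M N P \<in> linmaps K (M \<boxtimes>\<^bsub>K\<^esub> (N \<boxtimes>\<^bsub>K\<^esub> P)) ((M \<boxtimes>\<^bsub>K\<^esub> N) \<boxtimes>\<^bsub>K\<^esub> P)"
    and assocl_tens: "\<lbrakk>m \<in> carrier M; n \<in> carrier N; p \<in> carrier P\<rbrakk> \<Longrightarrow>
      assocl K M N P (tens K M (N \<boxtimes>\<^bsub>K\<^esub> P) m (tens K N P n p)) = tens K (M \<boxtimes>\<^bsub>K\<^esub> N) P (tens K M N m n) p"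
proof -
  let ?T = "(M \<boxtimes>\<^bsub>K\<^esub> N) \<boxtimes>\<^bsub>K\<^esub> P"
  let ?b = "\<lambda>m n p. tens K (M \<boxtimes>\<^bsub>K\<^esub> N) P (tens K M N m n) p"
  note lin = bilinear_linear_left[OF tens_bilinear] bilinear_linear_right[OF tens_bilinear]
  have b1: "bilinear K N P ?T (?b m)" if "m \<in> carrier M" for m
    using assms that by (intro bilinearI linmaps_compose[OF lin(1) lin(2)] lin(2)) auto
  have bl: "bilinear K M (N \<boxtimes>\<^bsub>K\<^esub> P) ?T (\<lambda>m Y. sweedler K ?T Y (?b m))"
    by (rule bilinear_sweedler)
      (use assms b1 in \<open>auto intro!: linmaps_compose[OF lin(1) lin(1)]\<close>)
  show "assocl K M N P \<in> linmaps K (M \<boxtimes>\<^bsub>K\<^esub> (N \<boxtimes>\<^bsub>K\<^esub> P)) ?T"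
    unfolding assocl_def[abs_def]
    by (rule tensor_pair.sweedler_linear[OF tensor_pairI _ bl]) (use assms in simp_all)
  show "assocl K M N P (tens K M (N \<boxtimes>\<^bsub>K\<^esub> P) m (tens K N P n p)) = tens K (M \<boxtimes>\<^bsub>K\<^esub> N) P (tens K M N m n) p"
    if "m \<in> carrier M" "n \<in> carrier N" "p \<in> carrier P"
    unfolding assocl_def
    by (subst tensor_pair.sweedler_tens[OF tensor_pairI _ bl])
      (use assms that in \<open>simp_all add: tensor_pair.sweedler_tens[OF tensor_pairI _ b1]\<close>)
qed

lemma assocr_sw:
  assumes "module K P" "module K Q" "module K M" "module K N" "module K L" "X \<in> carrier (P \<boxtimes>\<^bsub>K\<^esub> Q)"
    and "\<And>p q. \<lbrakk>p \<in> carrier P; q \<in> carrier Q\<rbrakk> \<Longrightarrow> b p q \<in> carrier ((M \<boxtimes>\<^bsub>K\<^esub> N) \<boxtimes>\<^bsub>K\<^esub> L)"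
  shows "assocr K M N L (sw P Q ((M \<boxtimes>\<^bsub>K\<^esub> N) \<boxtimes>\<^bsub>K\<^esub> L) X b)
    = sw P Q (M \<boxtimes>\<^bsub>K\<^esub> (N \<boxtimes>\<^bsub>K\<^esub> L)) X (\<lambda>p q. assocr K M N L (b p q))"
  by (rule linmaps_sw[OF assocr_linear]) (use assms in simp_all)

lemma assocl_sw:
  assumes "module K P" "module K Q" "module K M" "module K N" "module K L" "X \<in> carrier (P \<boxtimes>\<^bsub>K\<^esub> Q)"
    and "\<And>p q. \<lbrakk>p \<in> carrier P; q \<in> carrier Q\<rbrakk> \<Longrightarrow> b p q \<in> carrier (M \<boxtimes>\<^bsub>K\<^esub> (N \<boxtimes>\<^bsub>K\<^esub> L))"
  shows "assocl K M N L (sw P Q (M \<boxtimes>\<^bsub>K\<^esub> (N \<boxtimes>\<^bsub>K\<^esub> L)) X b)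
    = sw P Q ((M \<boxtimes>\<^bsub>K\<^esub> N) \<boxtimes>\<^bsub>K\<^esub> L) X (\<lambda>p q. assocl K M N L (b p q))"
  by (rule linmaps_sw[OF assocl_linear]) (use assms in simp_all)

lemma assocl_assocr:
  assumes "module K M" "module K N" "module K P" "X \<in> carrier ((M \<boxtimes>\<^bsub>K\<^esub> N) \<boxtimes>\<^bsub>K\<^esub> P)"
  shows "assocl K M N P (assocr K M N P X) = X"
proof -
  have *: "assocl K M N P (assocr K M N P (tens K (M \<boxtimes>\<^bsub>K\<^esub> N) P Y p)) = tens K (M \<boxtimes>\<^bsub>K\<^esub> N) P Y p"
    if "Y \<in> carrier (M \<boxtimes>\<^bsub>K\<^esub> N)" "p \<in> carrier P" for Y p
    by (rule tensor_ext[OF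
          linmaps_compose[OF linmaps_compose[OF assocl_linear assocr_linear] bilinear_linear_left[OF tens_bilinear]]
          bilinear_linear_left[OF tens_bilinear] _ _ _ _ that(1)])
      (use assms that in \<open>auto simp: assocl_tens assocr_tens\<close>)
  show ?thesis
    by (rule tensor_ext[OF linmaps_compose[OF assocl_linear assocr_linear] linmaps_id(2) _ _ _ _ assms(4)])
      (use assms * in auto)
qed

lemma assocr_assocl:
  assumes "module K M" "module K N" "module K P" "X \<in> carrier (M \<boxtimes>\<^bsub>K\<^esub> (N \<boxtimes>\<^bsub>K\<^esub> P))"
  shows "assocr K M N P (assocl K M N P X) = X"
proof -
  have *: "assocr K M N P (assocl K M N P (tens K M (N \<boxtimes>\<^bsub>K\<^esub> P) m Y)) = tens K M (N \<boxtimes>\<^bsub>K\<^esub> P) m Y"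
    if "Y \<in> carrier (N \<boxtimes>\<^bsub>K\<^esub> P)" "m \<in> carrier M" for Y m
    by (rule tensor_ext[OF
          linmaps_compose[OF linmaps_compose[OF assocr_linear assocl_linear] bilinear_linear_right[OF tens_bilinear]]
          bilinear_linear_right[OF tens_bilinear] _ _ _ _ that(1)])
      (use assms that in \<open>auto simp: assocl_tens assocr_tens\<close>)
  show ?thesis
    by (rule tensor_ext[OF linmaps_compose[OF assocr_linear assocl_linear] linmaps_id(2) _ _ _ _ assms(4)])
      (use assms * in auto)
qed

lemma
  assumes "assoc_algebra K A"
  shows mul_linear: "mul K A \<in> linmaps K (A \<boxtimes>\<^bsub>K\<^esub> A) A"
    and mul_tens: "\<lbrakk>a \<in> carrier A; a' \<in> carrier A\<rbrakk> \<Longrightarrow> mul K A (tens K A A a a') = a \<otimes>\<^bsub>A\<^esub> a'"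
proof -
  interpret A: assoc_algebra K A by fact
  have bl: "bilinear K A A A (\<lambda>a a'. a \<otimes>\<^bsub>A\<^esub> a')"
    by (intro bilinearI linmapsI)
      (auto simp: A.smult_mult_left A.smult_mult_right A.l_distr A.r_distr)
  show "mul K A \<in> linmaps K (A \<boxtimes>\<^bsub>K\<^esub> A) A"
    unfolding mul_def[abs_def]
    by (rule tensor_pair.sweedler_linear[OF tensor_pairI _ bl]) (rule A.module_axioms)+
  show "mul K A (tens K A A a a') = a \<otimes>\<^bsub>A\<^esub> a'" if "a \<in> carrier A" "a' \<in> carrier A"
    unfolding mul_def
    by (rule tensor_pair.sweedler_tens[OF tensor_pairI _ bl]) (intro A.module_axioms that)+
qed

lemma mul_sw:
  assumes "assoc_algebra K A" "module K P" "module K Q" "module K A" "X \<in> carrier (P \<boxtimes>\<^bsub>K\<^esub> Q)"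
    and "\<And>p q. \<lbrakk>p \<in> carrier P; q \<in> carrier Q\<rbrakk> \<Longrightarrow> b p q \<in> carrier (A \<boxtimes>\<^bsub>K\<^esub> A)"
  shows "mul K A (sw P Q (A \<boxtimes>\<^bsub>K\<^esub> A) X b) = sw P Q A X (\<lambda>p q. mul K A (b p q))"
  by (rule linmaps_sw[OF mul_linear]) (use assms in simp_all)

text \<open>
  As rewrite rules these push every structure map through the sums down to the pure tensors and evaluate
  it there. The result is an iterated sum whose innermost summand is a pure tensor.
\<close>

lemmas sweedler_calculus =
  linmaps_id tens_sw_left tens_sw_right tmap_linear tmap_tens tmap_sw assocr_linear assocr_tens assocr_sw
  assocl_linear assocl_tens assocl_sw mul_linear mul_tens mul_sw

end

section \<open>Crossed products from associativity\<close>

lemma assoc_algebra_of_bilinear: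
  fixes T :: "('k, 't) module"
  assumes "module K T" "bilinear K T T T m" "u \<in> carrier T"
    and "\<And>x y z. \<lbrakk>x \<in> carrier T; y \<in> carrier T; z \<in> carrier T\<rbrakk> \<Longrightarrow> m (m x y) z = m x (m y z)"
    and "\<And>x. x \<in> carrier T \<Longrightarrow> m u x = x" "\<And>x. x \<in> carrier T \<Longrightarrow> m x u = x"
  shows "assoc_algebra K (T\<lparr>monoid.mult := m, one := u\<rparr>)" (is "assoc_algebra K ?X")
proof -
  interpret T: module K T by fact
  note m = bilinear_closed[OF assms(2)] bilinear_add_left[OF assms(2)] bilinear_add_right[OF assms(2)]
    bilinear_smult_left[OF assms(2)] bilinear_smult_right[OF assms(2)]
  have group: "abelian_group ?X"
  proof (rule abelian_groupI)
    fix x assume "x \<in> carrier ?X"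
    then show "\<exists>y\<in>carrier ?X. y \<oplus>\<^bsub>?X\<^esub> x = \<zero>\<^bsub>?X\<^esub>"
      by (intro bexI[of _ "\<ominus>\<^bsub>T\<^esub> x"]) (simp_all add: T.M.l_neg)
  qed (simp_all add: T.M.a_ac)
  have "module K ?X"
    by (rule moduleI)
      (use group in \<open>simp_all add: T.smult_l_distr T.smult_r_distr T.smult_assoc1 T.is_cring\<close>)
  moreover have "monoid ?X"
    by (rule monoidI) (simp_all add: assms m)
  then have "ring ?X"
    by (intro ringI group) (simp_all add: m monoid.m_assoc)
  ultimately show ?thesis
    by (intro assoc_algebra.intro assoc_algebra_axioms.intro) (simp_all add: m)
qed

text \<open>
  Crossed product data with the linearity and unit conditions only. The remaining three conditions are
  derived below from associativity.
\<close>

locale crossed_datum = base_ring K for K :: "'k ring" (structure) +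
  fixes A :: "('k, 'a) module" and W :: "('k, 'w) module" and e :: 'w
    and R :: "('k, 'w, 'a) tensor \<Rightarrow> ('k, 'a, 'w) tensor"
    and \<sigma> :: "('k, 'w, 'w) tensor \<Rightarrow> ('k, 'a, 'w) tensor"
  assumes A_algebra [simp]: "assoc_algebra K A" and W_module [simp]: "module K W"
    and e_closed [simp]: "e \<in> carrier W"
    and R_linear: "R \<in> linmaps K (W \<boxtimes>\<^bsub>K\<^esub> A) (A \<boxtimes>\<^bsub>K\<^esub> W)"
    and \<sigma>_linear: "\<sigma> \<in> linmaps K (W \<boxtimes>\<^bsub>K\<^esub> W) (A \<boxtimes>\<^bsub>K\<^esub> W)"
    and R_unit_left: "a \<in> carrier A \<Longrightarrow> R (tens K W A e a) = tens K A W a e"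
    and R_unit_right: "w \<in> carrier W \<Longrightarrow> R (tens K W A w \<one>\<^bsub>A\<^esub>) = tens K A W \<one>\<^bsub>A\<^esub> w"
    and \<sigma>_unit_left: "w \<in> carrier W \<Longrightarrow> \<sigma> (tens K W W e w) = tens K A W \<one>\<^bsub>A\<^esub> w"
    and \<sigma>_unit_right: "w \<in> carrier W \<Longrightarrow> \<sigma> (tens K W W w e) = tens K A W \<one>\<^bsub>A\<^esub> w"
begin

sublocale A: assoc_algebra K A by (rule A_algebra)

lemma A_module [simp]: "module K A" ..

abbreviation "T \<equiv> A \<boxtimes>\<^bsub>K\<^esub> W"

text \<open>
  Second names for the values \<open>R (w \<otimes> a)\<close> and \<open>\<sigma> (w \<otimes> w')\<close>. The simplifier expands such a value to
  the Sweedler-type sum over itself (\<open>R_tens\<close>, \<open>\<sigma>_tens\<close> below), and the new name keeps it from expanding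
  the same value again. The \<open>NO_MATCH\<close> guards leave the arguments to which a unit condition applies, as
  there the value is itself a pure tensor.
\<close>

definition "rt w a = R (tens K W A w a)"
definition "st w w' = \<sigma> (tens K W W w w')"

lemma rt_closed [simp]: "\<lbrakk>w \<in> carrier W; a \<in> carrier A\<rbrakk> \<Longrightarrow> rt w a \<in> carrier T"
  by (simp add: rt_def linmaps_closed[OF R_linear])

lemma st_closed [simp]: "\<lbrakk>w \<in> carrier W; w' \<in> carrier W\<rbrakk> \<Longrightarrow> st w w' \<in> carrier T"
  by (simp add: st_def linmaps_closed[OF \<sigma>_linear])

lemma R_tens: "\<lbrakk>NO_MATCH e w; NO_MATCH \<one>\<^bsub>A\<^esub> a; w \<in> carrier W; a \<in> carrier A\<rbrakk>
    \<Longrightarrow> R (tens K W A w a) = sw A W T (rt w a) (\<lambda>a w. tens K A W a w)"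
  by (simp add: sw_tens_id) (simp add: rt_def)

lemma \<sigma>_tens: "\<lbrakk>NO_MATCH e w; NO_MATCH e w'; w \<in> carrier W; w' \<in> carrier W\<rbrakk>
    \<Longrightarrow> \<sigma> (tens K W W w w') = sw A W T (st w w') (\<lambda>a w. tens K A W a w)"
  by (simp add: sw_tens_id) (simp add: st_def)

lemmas R_sw = linmaps_sw[OF R_linear]
lemmas \<sigma>_sw = linmaps_sw[OF \<sigma>_linear]

lemmas NF = sweedler_calculus R_linear \<sigma>_linear R_sw \<sigma>_sw R_tens \<sigma>_tens
lemmas NF_unit = R_unit_left R_unit_right \<sigma>_unit_left \<sigma>_unit_right

lemma mul_mul_linear: "mul K A \<circ> tmap K A A id (mul K A) \<in> linmaps K (A \<boxtimes>\<^bsub>K\<^esub> (A \<boxtimes>\<^bsub>K\<^esub> A)) A"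
  by (rule linmaps_o[OF tmap_linear mul_linear]) (simp_all add: mul_linear linmaps_id)

definition mult (infixl \<open>\<star>\<close> 70) where
  "x \<star> y = crossed_mult K A W R \<sigma> (tens K T T x y)"

lemma crossed_mult_linear: "crossed_mult K A W R \<sigma> \<in> linmaps K (T \<boxtimes>\<^bsub>K\<^esub> T) T"
  unfolding crossed_mult_def
  by (rule linmaps_o tmap_linear assocl_linear assocr_linear linmaps_id R_linear \<sigma>_linear mul_mul_linear
      | simp)+

lemma mult_bilinear: "bilinear K T T T (\<star>)"
  unfolding mult_def[abs_def]
  by (rule bilinear_compose[OF tens_bilinear crossed_mult_linear]) simp_all

lemma mult_tens_unit:
  assumes [simp]: "a \<in> carrier A" "w \<in> carrier W" "a' \<in> carrier A"
  shows "tens K A W a w \<star> tens K A W a' e = sw A W T (rt w a') (\<lambda>a\<^sub>1 w\<^sub>1. tens K A W (a \<otimes>\<^bsub>A\<^esub> a\<^sub>1) w\<^sub>1)"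
  by (simp add: NF_unit mult_def crossed_mult_def NF mul_mul_linear)

lemma mult_unit_tens:
  assumes [simp]: "w \<in> carrier W" "a \<in> carrier A" "w' \<in> carrier W"
  shows "tens K A W \<one>\<^bsub>A\<^esub> w \<star> tens K A W a w' =
    sw A W T (rt w a) (\<lambda>a\<^sub>1 w\<^sub>1. sw A W T (st w\<^sub>1 w') (\<lambda>a\<^sub>2 w\<^sub>2. tens K A W (a\<^sub>1 \<otimes>\<^bsub>A\<^esub> a\<^sub>2) w\<^sub>2))"
  by (simp add: mult_def crossed_mult_def NF mul_mul_linear NF_unit)

lemma mult_e_tens:
  assumes [simp]: "a \<in> carrier A" "a' \<in> carrier A" "w \<in> carrier W"
  shows "tens K A W a e \<star> tens K A W a' w = tens K A W (a \<otimes>\<^bsub>A\<^esub> a') w"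
  by (simp add: mult_def crossed_mult_def NF mul_mul_linear NF_unit)

lemma mult_tens_one:
  assumes [simp]: "a \<in> carrier A" "w \<in> carrier W" "w' \<in> carrier W"
  shows "tens K A W a w \<star> tens K A W \<one>\<^bsub>A\<^esub> w' =
    sw A W T (st w w') (\<lambda>a\<^sub>1 w\<^sub>1. tens K A W (a \<otimes>\<^bsub>A\<^esub> a\<^sub>1) w\<^sub>1)"
  by (simp add: mult_def crossed_mult_def NF mul_mul_linear NF_unit)

lemma mult_closed [simp]: "\<lbrakk>x \<in> carrier T; y \<in> carrier T\<rbrakk> \<Longrightarrow> x \<star> y \<in> carrier T"
  by (rule bilinear_closed[OF mult_bilinear])

lemmas mult_sw_left = linmaps_sw[OF bilinear_linear_left[OF mult_bilinear]]
lemmas mult_sw_right = linmaps_sw[OF bilinear_linear_right[OF mult_bilinear]]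

lemma one_mult: "x \<in> carrier T \<Longrightarrow> tens K A W \<one>\<^bsub>A\<^esub> e \<star> x = x"
  by (rule tensor_ext[OF bilinear_linear_right[OF mult_bilinear] linmaps_id(2)])
    (simp_all add: mult_e_tens)

lemma mult_one: "x \<in> carrier T \<Longrightarrow> x \<star> tens K A W \<one>\<^bsub>A\<^esub> e = x"
  by (rule tensor_ext[OF bilinear_linear_left[OF mult_bilinear] linmaps_id(2)])
    (simp_all add: mult_def crossed_mult_def NF mul_mul_linear NF_unit)

context
  assumes mult_assoc: "\<And>x y z. \<lbrakk>x \<in> carrier T; y \<in> carrier T; z \<in> carrier T\<rbrakk> \<Longrightarrow> (x \<star> y) \<star> z = x \<star> (y \<star> z)"
begin

text \<open>
  \<open>R\<close> and \<open>\<sigma>\<close> are products in the algebra, so that associativity can be applied to them.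
\<close>

lemma R_mult: "\<lbrakk>w \<in> carrier W; a \<in> carrier A\<rbrakk>
    \<Longrightarrow> R (tens K W A w a) = tens K A W \<one>\<^bsub>A\<^esub> w \<star> tens K A W a e"
  by (simp add: mult_tens_unit sw_tens_id) (simp add: rt_def)

lemma \<sigma>_mult: "\<lbrakk>w \<in> carrier W; w' \<in> carrier W\<rbrakk>
    \<Longrightarrow> \<sigma> (tens K W W w w') = tens K A W \<one>\<^bsub>A\<^esub> w \<star> tens K A W \<one>\<^bsub>A\<^esub> w'"
  by (simp add: mult_tens_one sw_tens_id) (simp add: st_def)

text \<open>
  A sum over \<open>R (w \<otimes> a)\<close> or \<open>\<sigma> (w \<otimes> w')\<close> of products is a triple product. The two sides of each crossed
  product condition are sums of this kind, and they become the two bracketings of one triple product.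
\<close>

lemma rt_mult_right: "\<lbrakk>w \<in> carrier W; a \<in> carrier A; y \<in> carrier T\<rbrakk>
    \<Longrightarrow> sw A W T (rt w a) (\<lambda>a w. tens K A W a w \<star> y) = tens K A W \<one>\<^bsub>A\<^esub> w \<star> (tens K A W a e \<star> y)"
  by (simp add: mult_sw_left[symmetric] sw_tens_id mult_assoc[symmetric]) (simp add: R_mult rt_def)

lemma st_mult_right: "\<lbrakk>w \<in> carrier W; w' \<in> carrier W; y \<in> carrier T\<rbrakk>
    \<Longrightarrow> sw A W T (st w w') (\<lambda>a w. tens K A W a w \<star> y) =
      tens K A W \<one>\<^bsub>A\<^esub> w \<star> (tens K A W \<one>\<^bsub>A\<^esub> w' \<star> y)"
  by (simp add: mult_sw_left[symmetric] sw_tens_id mult_assoc[symmetric]) (simp add: \<sigma>_mult st_def)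

lemma rt_mult_left: "\<lbrakk>w \<in> carrier W; a \<in> carrier A; y \<in> carrier T\<rbrakk>
    \<Longrightarrow> sw A W T (rt w a) (\<lambda>a w. y \<star> tens K A W a w) = y \<star> (tens K A W \<one>\<^bsub>A\<^esub> w \<star> tens K A W a e)"
  by (simp add: mult_sw_right[symmetric] sw_tens_id) (simp add: R_mult rt_def)

lemma st_mult_left: "\<lbrakk>w \<in> carrier W; w' \<in> carrier W; y \<in> carrier T\<rbrakk>
    \<Longrightarrow> sw A W T (st w w') (\<lambda>a w. y \<star> tens K A W a w) =
      y \<star> (tens K A W \<one>\<^bsub>A\<^esub> w \<star> tens K A W \<one>\<^bsub>A\<^esub> w')"
  by (simp add: mult_sw_right[symmetric] sw_tens_id) (simp add: \<sigma>_mult st_def)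

text \<open>
  Associativity of \<open>(1 \<otimes> w) (a \<otimes> 1) (a' \<otimes> 1)\<close>.
\<close>

lemma eq_on_R:
  "eq_on (W \<boxtimes>\<^bsub>K\<^esub> (A \<boxtimes>\<^bsub>K\<^esub> A))
      (R \<circ> tmap K W A id (mul K A))
      (tmap K A W (mul K A) id \<circ> assocl K A A W \<circ> tmap K A (A \<boxtimes>\<^bsub>K\<^esub> W) id R \<circ> assocr K A W A
        \<circ> tmap K (A \<boxtimes>\<^bsub>K\<^esub> W) A R id \<circ> assocl K W A A)"
proof (rule eq_on_triple_tensorI, goal_cases)
  case (7 w a a')
  note [simp] = this
  have "tens K A W \<one>\<^bsub>A\<^esub> w \<star> tens K A W (a \<otimes>\<^bsub>A\<^esub> a') e
    = sw A W T (rt w a) (\<lambda>a\<^sub>1 w\<^sub>1. tens K A W a\<^sub>1 w\<^sub>1 \<star> tens K A W a' e)"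
    by (simp only: rt_mult_right tens_closed 7 A_module W_module e_closed mult_e_tens)
  then show ?case
    by (simp add: NF mult_tens_unit)
qed (rule linmaps_o tmap_linear mul_linear assocl_linear assocr_linear linmaps_id R_linear | simp)+

text \<open>
  Associativity of \<open>(1 \<otimes> w) (1 \<otimes> w') (1 \<otimes> w'')\<close>.
\<close>

lemma eq_on_cocycle:
  "eq_on (W \<boxtimes>\<^bsub>K\<^esub> (W \<boxtimes>\<^bsub>K\<^esub> W))
      (tmap K A W (mul K A) id \<circ> assocl K A A W \<circ> tmap K A (A \<boxtimes>\<^bsub>K\<^esub> W) id \<sigma> \<circ> assocr K A W W
        \<circ> tmap K (A \<boxtimes>\<^bsub>K\<^esub> W) W R id \<circ> assocl K W A W \<circ> tmap K W (A \<boxtimes>\<^bsub>K\<^esub> W) id \<sigma>)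
      (tmap K A W (mul K A) id \<circ> assocl K A A W \<circ> tmap K A (A \<boxtimes>\<^bsub>K\<^esub> W) id \<sigma> \<circ> assocr K A W W
        \<circ> tmap K (A \<boxtimes>\<^bsub>K\<^esub> W) W \<sigma> id \<circ> assocl K W W W)"
proof (rule eq_on_triple_tensorI, goal_cases)
  case (7 w w' w'')
  note [simp] = this
  have "sw A W T (st w' w'') (\<lambda>a\<^sub>1 w\<^sub>1. tens K A W \<one>\<^bsub>A\<^esub> w \<star> tens K A W a\<^sub>1 w\<^sub>1)
    = sw A W T (st w w') (\<lambda>a\<^sub>1 w\<^sub>1. tens K A W a\<^sub>1 w\<^sub>1 \<star> tens K A W \<one>\<^bsub>A\<^esub> w'')"
    by (simp add: st_mult_left st_mult_right)
  then show ?case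
    by (simp add: NF mult_unit_tens mult_tens_one)
qed (rule linmaps_o tmap_linear mul_linear assocl_linear assocr_linear linmaps_id R_linear \<sigma>_linear | simp)+

text \<open>
  Associativity of \<open>(1 \<otimes> w) (1 \<otimes> w') (a \<otimes> 1)\<close>.
\<close>

lemma eq_on_twisted_module:
  "eq_on (W \<boxtimes>\<^bsub>K\<^esub> (W \<boxtimes>\<^bsub>K\<^esub> A))
      (tmap K A W (mul K A) id \<circ> assocl K A A W \<circ> tmap K A (A \<boxtimes>\<^bsub>K\<^esub> W) id \<sigma> \<circ> assocr K A W W
        \<circ> tmap K (A \<boxtimes>\<^bsub>K\<^esub> W) W R id \<circ> assocl K W A W \<circ> tmap K W (A \<boxtimes>\<^bsub>K\<^esub> W) id R)
      (tmap K A W (mul K A) id \<circ> assocl K A A W \<circ> tmap K A (A \<boxtimes>\<^bsub>K\<^esub> W) id R \<circ> assocr K A W A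
        \<circ> tmap K (A \<boxtimes>\<^bsub>K\<^esub> W) A \<sigma> id \<circ> assocl K W W A)"
proof (rule eq_on_triple_tensorI, goal_cases)
  case (7 w w' a)
  note [simp] = this
  have "sw A W T (rt w' a) (\<lambda>a\<^sub>1 w\<^sub>1. tens K A W \<one>\<^bsub>A\<^esub> w \<star> tens K A W a\<^sub>1 w\<^sub>1)
    = sw A W T (st w w') (\<lambda>a\<^sub>1 w\<^sub>1. tens K A W a\<^sub>1 w\<^sub>1 \<star> tens K A W a e)"
    by (simp add: rt_mult_left st_mult_right)
  then show ?case
    by (simp add: NF mult_unit_tens mult_tens_unit)
qed (rule linmaps_o tmap_linear mul_linear assocl_linear assocr_linear linmaps_id R_linear \<sigma>_linear | simp)+

theorem crossed_product_of_assoc: "crossed_product K A W e R \<sigma>"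
  using eq_on_R eq_on_cocycle eq_on_twisted_module
  by (simp add: crossed_product_def R_linear \<sigma>_linear NF_unit)

theorem crossed_algebra_of_assoc: "assoc_algebra K (crossed_algebra K A W e R \<sigma>)"
  unfolding crossed_algebra_def mult_def[symmetric]
  by (rule assoc_algebra_of_bilinear)
    (simp_all add: mult_bilinear mult_assoc one_mult mult_one)

end

end

text \<open>
  The mirror image of the previous development, with the algebra on the right and all products reversed.
\<close>

locale mirror_crossed_datum = base_ring K for K :: "'k ring" (structure) +
  fixes W :: "('k, 'w) module" and B :: "('k, 'b) module" and e :: 'w
    and P :: "('k, 'b, 'w) tensor \<Rightarrow> ('k, 'w, 'b) tensor"
    and \<nu> :: "('k, 'w, 'w) tensor \<Rightarrow> ('k, 'w, 'b) tensor"
  assumes B_algebra [simp]: "assoc_algebra K B" and W_module [simp]: "module K W"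
    and e_closed [simp]: "e \<in> carrier W"
    and P_linear: "P \<in> linmaps K (B \<boxtimes>\<^bsub>K\<^esub> W) (W \<boxtimes>\<^bsub>K\<^esub> B)"
    and \<nu>_linear: "\<nu> \<in> linmaps K (W \<boxtimes>\<^bsub>K\<^esub> W) (W \<boxtimes>\<^bsub>K\<^esub> B)"
    and P_unit_right: "b \<in> carrier B \<Longrightarrow> P (tens K B W b e) = tens K W B e b"
    and P_unit_left: "w \<in> carrier W \<Longrightarrow> P (tens K B W \<one>\<^bsub>B\<^esub> w) = tens K W B w \<one>\<^bsub>B\<^esub>"
    and \<nu>_unit_left: "w \<in> carrier W \<Longrightarrow> \<nu> (tens K W W e w) = tens K W B w \<one>\<^bsub>B\<^esub>"
    and \<nu>_unit_right: "w \<in> carrier W \<Longrightarrow> \<nu> (tens K W W w e) = tens K W B w \<one>\<^bsub>B\<^esub>"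
begin

sublocale B: assoc_algebra K B by (rule B_algebra)

lemma B_module [simp]: "module K B" ..

abbreviation "T \<equiv> W \<boxtimes>\<^bsub>K\<^esub> B"

definition "pt b w = P (tens K B W b w)"
definition "nt w w' = \<nu> (tens K W W w w')"

lemma pt_closed [simp]: "\<lbrakk>b \<in> carrier B; w \<in> carrier W\<rbrakk> \<Longrightarrow> pt b w \<in> carrier T"
  by (simp add: pt_def linmaps_closed[OF P_linear])

lemma nt_closed [simp]: "\<lbrakk>w \<in> carrier W; w' \<in> carrier W\<rbrakk> \<Longrightarrow> nt w w' \<in> carrier T"
  by (simp add: nt_def linmaps_closed[OF \<nu>_linear])

lemma P_tens: "\<lbrakk>NO_MATCH \<one>\<^bsub>B\<^esub> b; NO_MATCH e w; b \<in> carrier B; w \<in> carrier W\<rbrakk>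
    \<Longrightarrow> P (tens K B W b w) = sw W B T (pt b w) (\<lambda>w b. tens K W B w b)"
  by (simp add: sw_tens_id) (simp add: pt_def)

lemma \<nu>_tens: "\<lbrakk>NO_MATCH e w; NO_MATCH e w'; w \<in> carrier W; w' \<in> carrier W\<rbrakk>
    \<Longrightarrow> \<nu> (tens K W W w w') = sw W B T (nt w w') (\<lambda>w b. tens K W B w b)"
  by (simp add: sw_tens_id) (simp add: nt_def)

lemmas P_sw = linmaps_sw[OF P_linear]
lemmas \<nu>_sw = linmaps_sw[OF \<nu>_linear]

lemmas NF = sweedler_calculus P_linear \<nu>_linear P_sw \<nu>_sw P_tens \<nu>_tens
lemmas NF_unit = P_unit_left P_unit_right \<nu>_unit_left \<nu>_unit_right

lemma mul_mul_linear: "mul K B \<circ> tmap K B B id (mul K B) \<in> linmaps K (B \<boxtimes>\<^bsub>K\<^esub> (B \<boxtimes>\<^bsub>K\<^esub> B)) B"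
  by (rule linmaps_o[OF tmap_linear mul_linear]) (simp_all add: mul_linear linmaps_id)

definition mult (infixl \<open>\<star>\<close> 70) where
  "x \<star> y = mirror_crossed_mult K W B P \<nu> (tens K T T x y)"

lemma mirror_crossed_mult_linear: "mirror_crossed_mult K W B P \<nu> \<in> linmaps K (T \<boxtimes>\<^bsub>K\<^esub> T) T"
  unfolding mirror_crossed_mult_def
  by (rule linmaps_o tmap_linear assocl_linear assocr_linear linmaps_id P_linear \<nu>_linear mul_mul_linear
      | simp)+

lemma mult_bilinear: "bilinear K T T T (\<star>)"
  unfolding mult_def[abs_def]
  by (rule bilinear_compose[OF tens_bilinear mirror_crossed_mult_linear]) simp_all

lemma mult_unit_tens:
  assumes [simp]: "b \<in> carrier B" "w \<in> carrier W" "b' \<in> carrier B"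
  shows "tens K W B e b \<star> tens K W B w b' = sw W B T (pt b w) (\<lambda>w\<^sub>1 b\<^sub>1. tens K W B w\<^sub>1 (b\<^sub>1 \<otimes>\<^bsub>B\<^esub> b'))"
  by (simp add: mult_def mirror_crossed_mult_def NF mul_mul_linear NF_unit)

lemma mult_tens_unit:
  assumes [simp]: "w \<in> carrier W" "b \<in> carrier B" "w' \<in> carrier W"
  shows "tens K W B w b \<star> tens K W B w' \<one>\<^bsub>B\<^esub> =
    sw W B T (pt b w') (\<lambda>w\<^sub>1 b\<^sub>1. sw W B T (nt w w\<^sub>1) (\<lambda>w\<^sub>2 b\<^sub>2. tens K W B w\<^sub>2 (b\<^sub>2 \<otimes>\<^bsub>B\<^esub> b\<^sub>1)))"
  by (simp add: mult_def mirror_crossed_mult_def NF mul_mul_linear NF_unit)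

lemma mult_tens_e:
  assumes [simp]: "w \<in> carrier W" "b \<in> carrier B" "b' \<in> carrier B"
  shows "tens K W B w b \<star> tens K W B e b' = tens K W B w (b \<otimes>\<^bsub>B\<^esub> b')"
  by (simp add: mult_def mirror_crossed_mult_def NF mul_mul_linear NF_unit)

lemma mult_one_tens:
  assumes [simp]: "w \<in> carrier W" "w' \<in> carrier W" "b \<in> carrier B"
  shows "tens K W B w \<one>\<^bsub>B\<^esub> \<star> tens K W B w' b =
    sw W B T (nt w w') (\<lambda>w\<^sub>1 b\<^sub>1. tens K W B w\<^sub>1 (b\<^sub>1 \<otimes>\<^bsub>B\<^esub> b))"
  by (simp add: mult_def mirror_crossed_mult_def NF mul_mul_linear NF_unit)

lemma mult_closed [simp]: "\<lbrakk>x \<in> carrier T; y \<in> carrier T\<rbrakk> \<Longrightarrow> x \<star> y \<in> carrier T"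
  by (rule bilinear_closed[OF mult_bilinear])

lemmas mult_sw_left = linmaps_sw[OF bilinear_linear_left[OF mult_bilinear]]
lemmas mult_sw_right = linmaps_sw[OF bilinear_linear_right[OF mult_bilinear]]

lemma one_mult: "x \<in> carrier T \<Longrightarrow> tens K W B e \<one>\<^bsub>B\<^esub> \<star> x = x"
  by (rule tensor_ext[OF bilinear_linear_right[OF mult_bilinear] linmaps_id(2)])
    (simp_all add: mult_def mirror_crossed_mult_def NF mul_mul_linear NF_unit)

lemma mult_one: "x \<in> carrier T \<Longrightarrow> x \<star> tens K W B e \<one>\<^bsub>B\<^esub> = x"
  by (rule tensor_ext[OF bilinear_linear_left[OF mult_bilinear] linmaps_id(2)])
    (simp_all add: mult_tens_e)

context
  assumes mult_assoc: "\<And>x y z. \<lbrakk>x \<in> carrier T; y \<in> carrier T; z \<in> carrier T\<rbrakk> \<Longrightarrow> (x \<star> y) \<star> z = x \<star> (y \<star> z)"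
begin

lemma P_mult: "\<lbrakk>b \<in> carrier B; w \<in> carrier W\<rbrakk>
    \<Longrightarrow> P (tens K B W b w) = tens K W B e b \<star> tens K W B w \<one>\<^bsub>B\<^esub>"
  by (simp add: mult_unit_tens sw_tens_id) (simp add: pt_def)

lemma \<nu>_mult: "\<lbrakk>w \<in> carrier W; w' \<in> carrier W\<rbrakk>
    \<Longrightarrow> \<nu> (tens K W W w w') = tens K W B w \<one>\<^bsub>B\<^esub> \<star> tens K W B w' \<one>\<^bsub>B\<^esub>"
  by (simp add: mult_one_tens sw_tens_id) (simp add: nt_def)

lemma pt_mult_right: "\<lbrakk>b \<in> carrier B; w \<in> carrier W; y \<in> carrier T\<rbrakk>
    \<Longrightarrow> sw W B T (pt b w) (\<lambda>w b. tens K W B w b \<star> y) = tens K W B e b \<star> (tens K W B w \<one>\<^bsub>B\<^esub> \<star> y)"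
  by (simp add: mult_sw_left[symmetric] sw_tens_id mult_assoc[symmetric]) (simp add: P_mult pt_def)

lemma nt_mult_right: "\<lbrakk>w \<in> carrier W; w' \<in> carrier W; y \<in> carrier T\<rbrakk>
    \<Longrightarrow> sw W B T (nt w w') (\<lambda>w b. tens K W B w b \<star> y) =
      tens K W B w \<one>\<^bsub>B\<^esub> \<star> (tens K W B w' \<one>\<^bsub>B\<^esub> \<star> y)"
  by (simp add: mult_sw_left[symmetric] sw_tens_id mult_assoc[symmetric]) (simp add: \<nu>_mult nt_def)

lemma pt_mult_left: "\<lbrakk>b \<in> carrier B; w \<in> carrier W; y \<in> carrier T\<rbrakk>
    \<Longrightarrow> sw W B T (pt b w) (\<lambda>w b. y \<star> tens K W B w b) = y \<star> (tens K W B e b \<star> tens K W B w \<one>\<^bsub>B\<^esub>)"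
  by (simp add: mult_sw_right[symmetric] sw_tens_id) (simp add: P_mult pt_def)

lemma nt_mult_left: "\<lbrakk>w \<in> carrier W; w' \<in> carrier W; y \<in> carrier T\<rbrakk>
    \<Longrightarrow> sw W B T (nt w w') (\<lambda>w b. y \<star> tens K W B w b) =
      y \<star> (tens K W B w \<one>\<^bsub>B\<^esub> \<star> tens K W B w' \<one>\<^bsub>B\<^esub>)"
  by (simp add: mult_sw_right[symmetric] sw_tens_id) (simp add: \<nu>_mult nt_def)

text \<open>
  Associativity of \<open>(1 \<otimes> b) (1 \<otimes> b') (w \<otimes> 1)\<close>; the next two lemmas are that of
  \<open>(w \<otimes> 1) (w' \<otimes> 1) (w'' \<otimes> 1)\<close> and of \<open>(1 \<otimes> b) (w \<otimes> 1) (w' \<otimes> 1)\<close>.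
\<close>

lemma eq_on_P:
  "eq_on (B \<boxtimes>\<^bsub>K\<^esub> (B \<boxtimes>\<^bsub>K\<^esub> W))
      (P \<circ> tmap K B W (mul K B) id \<circ> assocl K B B W)
      (tmap K W B id (mul K B) \<circ> assocr K W B B \<circ> tmap K (W \<boxtimes>\<^bsub>K\<^esub> B) B P id \<circ> assocl K B W B
        \<circ> tmap K B (W \<boxtimes>\<^bsub>K\<^esub> B) id P)"
proof (rule eq_on_triple_tensorI, goal_cases)
  case (7 b b' w)
  note [simp] = this
  have "tens K W B e (b \<otimes>\<^bsub>B\<^esub> b') \<star> tens K W B w \<one>\<^bsub>B\<^esub>
    = sw W B T (pt b' w) (\<lambda>w\<^sub>1 b\<^sub>1. tens K W B e b \<star> tens K W B w\<^sub>1 b\<^sub>1)"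
    by (simp only: pt_mult_left tens_closed 7 B_module W_module e_closed mult_tens_e mult_assoc[symmetric]
        B.one_closed)
  then show ?case
    by (simp add: NF mult_unit_tens)
qed (rule linmaps_o tmap_linear mul_linear assocl_linear assocr_linear linmaps_id P_linear | simp)+

lemma eq_on_cocycle:
  "eq_on (W \<boxtimes>\<^bsub>K\<^esub> (W \<boxtimes>\<^bsub>K\<^esub> W))
      (tmap K W B id (mul K B) \<circ> assocr K W B B \<circ> tmap K (W \<boxtimes>\<^bsub>K\<^esub> B) B \<nu> id \<circ> assocl K W W B
        \<circ> tmap K W (W \<boxtimes>\<^bsub>K\<^esub> B) id P \<circ> assocr K W B W \<circ> tmap K (W \<boxtimes>\<^bsub>K\<^esub> B) W \<nu> id \<circ> assocl K W W W)
      (tmap K W B id (mul K B) \<circ> assocr K W B B \<circ> tmap K (W \<boxtimes>\<^bsub>K\<^esub> B) B \<nu> id \<circ> assocl K W W B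
        \<circ> tmap K W (W \<boxtimes>\<^bsub>K\<^esub> B) id \<nu>)"
proof (rule eq_on_triple_tensorI, goal_cases)
  case (7 w w' w'')
  note [simp] = this
  have "sw W B T (nt w w') (\<lambda>w\<^sub>1 b\<^sub>1. tens K W B w\<^sub>1 b\<^sub>1 \<star> tens K W B w'' \<one>\<^bsub>B\<^esub>)
    = sw W B T (nt w' w'') (\<lambda>w\<^sub>1 b\<^sub>1. tens K W B w \<one>\<^bsub>B\<^esub> \<star> tens K W B w\<^sub>1 b\<^sub>1)"
    by (simp add: nt_mult_left nt_mult_right)
  then show ?case
    by (simp add: NF mult_tens_unit mult_one_tens)
qed (rule linmaps_o tmap_linear mul_linear assocl_linear assocr_linear linmaps_id P_linear \<nu>_linear | simp)+

lemma eq_on_twisted_module: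
  "eq_on (B \<boxtimes>\<^bsub>K\<^esub> (W \<boxtimes>\<^bsub>K\<^esub> W))
      (tmap K W B id (mul K B) \<circ> assocr K W B B \<circ> tmap K (W \<boxtimes>\<^bsub>K\<^esub> B) B \<nu> id \<circ> assocl K W W B
        \<circ> tmap K W (W \<boxtimes>\<^bsub>K\<^esub> B) id P \<circ> assocr K W B W \<circ> tmap K (W \<boxtimes>\<^bsub>K\<^esub> B) W P id \<circ> assocl K B W W)
      (tmap K W B id (mul K B) \<circ> assocr K W B B \<circ> tmap K (W \<boxtimes>\<^bsub>K\<^esub> B) B P id \<circ> assocl K B W B
        \<circ> tmap K B (W \<boxtimes>\<^bsub>K\<^esub> B) id \<nu>)"
proof (rule eq_on_triple_tensorI, goal_cases)
  case (7 b w w')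
  note [simp] = this
  have "sw W B T (pt b w) (\<lambda>w\<^sub>1 b\<^sub>1. tens K W B w\<^sub>1 b\<^sub>1 \<star> tens K W B w' \<one>\<^bsub>B\<^esub>)
    = sw W B T (nt w w') (\<lambda>w\<^sub>1 b\<^sub>1. tens K W B e b \<star> tens K W B w\<^sub>1 b\<^sub>1)"
    by (simp add: nt_mult_left pt_mult_right)
  then show ?case
    by (simp add: NF mult_tens_unit mult_unit_tens)
qed (rule linmaps_o tmap_linear mul_linear assocl_linear assocr_linear linmaps_id P_linear \<nu>_linear | simp)+

theorem mirror_crossed_product_of_assoc: "mirror_crossed_product K W B e P \<nu>"
  using eq_on_P eq_on_cocycle eq_on_twisted_module
  by (simp add: mirror_crossed_product_def P_linear \<nu>_linear NF_unit)

theorem mirror_crossed_algebra_of_assoc: "assoc_algebra K (mirror_crossed_algebra K W B e P \<nu>)"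
  unfolding mirror_crossed_algebra_def mult_def[symmetric]
  by (rule assoc_algebra_of_bilinear)
    (simp_all add: mult_bilinear mult_assoc one_mult mult_one)

end

end

section \<open>Two-sided crossed products\<close>

locale two_sided_datum = base_ring K for K :: "'k ring" (structure) +
  fixes A :: "('k, 'a) module" and V :: "('k, 'v) module" and C :: "('k, 'c) module"
    and oneV :: 'v
    and R1 :: "('k, 'v, 'a) tensor \<Rightarrow> ('k, 'a, 'v) tensor"
    and R2 :: "('k, 'c, 'v) tensor \<Rightarrow> ('k, 'v, 'c) tensor"
    and R3 :: "('k, 'c, 'a) tensor \<Rightarrow> ('k, 'a, 'c) tensor"
    and E :: "('k, 'v, 'v) tensor \<Rightarrow> ('k, 'a, ('k, 'v, 'c) tensor) tensor"
  assumes A_algebra [simp]: "assoc_algebra K A" and C_algebra [simp]: "assoc_algebra K C"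
    and V_module [simp]: "module K V" and oneV_closed [simp]: "oneV \<in> carrier V"
    and R1_linear: "R1 \<in> linmaps K (V \<boxtimes>\<^bsub>K\<^esub> A) (A \<boxtimes>\<^bsub>K\<^esub> V)"
    and R2_linear: "R2 \<in> linmaps K (C \<boxtimes>\<^bsub>K\<^esub> V) (V \<boxtimes>\<^bsub>K\<^esub> C)"
    and R3_linear: "R3 \<in> linmaps K (C \<boxtimes>\<^bsub>K\<^esub> A) (A \<boxtimes>\<^bsub>K\<^esub> C)"
    and E_linear: "E \<in> linmaps K (V \<boxtimes>\<^bsub>K\<^esub> V) (A \<boxtimes>\<^bsub>K\<^esub> (V \<boxtimes>\<^bsub>K\<^esub> C))"
    and R3_twisting: "twisting_map K A C R3"
    and R1_unit_left: "\<forall>a\<in>carrier A. R1 (tens K V A oneV a) = tens K A V a oneV"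
    and R1_unit_right: "\<forall>v\<in>carrier V. R1 (tens K V A v \<one>\<^bsub>A\<^esub>) = tens K A V \<one>\<^bsub>A\<^esub> v"
    and R2_unit_right: "\<forall>c\<in>carrier C. R2 (tens K C V c oneV) = tens K V C oneV c"
    and R2_unit_left: "\<forall>v\<in>carrier V. R2 (tens K C V \<one>\<^bsub>C\<^esub> v) = tens K V C v \<one>\<^bsub>C\<^esub>"
    and E_unit_left: "\<forall>v\<in>carrier V. E (tens K V V oneV v) = tens K A (V \<boxtimes>\<^bsub>K\<^esub> C) \<one>\<^bsub>A\<^esub> (tens K V C v \<one>\<^bsub>C\<^esub>)"
    and E_unit_right: "\<forall>v\<in>carrier V. E (tens K V V v oneV) = tens K A (V \<boxtimes>\<^bsub>K\<^esub> C) \<one>\<^bsub>A\<^esub> (tens K V C v \<one>\<^bsub>C\<^esub>)"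
    and R1_mult: "eq_on (V \<boxtimes>\<^bsub>K\<^esub> (A \<boxtimes>\<^bsub>K\<^esub> A))
      (R1 \<circ> tmap K V A id (mul K A))
      (tmap K A V (mul K A) id \<circ> assocl K A A V \<circ> tmap K A (A \<boxtimes>\<^bsub>K\<^esub> V) id R1 \<circ> assocr K A V A
        \<circ> tmap K (A \<boxtimes>\<^bsub>K\<^esub> V) A R1 id \<circ> assocl K V A A)"
    and R2_mult: "eq_on (C \<boxtimes>\<^bsub>K\<^esub> (C \<boxtimes>\<^bsub>K\<^esub> V))
      (R2 \<circ> tmap K C V (mul K C) id \<circ> assocl K C C V)
      (tmap K V C id (mul K C) \<circ> assocr K V C C \<circ> tmap K (V \<boxtimes>\<^bsub>K\<^esub> C) C R2 id \<circ> assocl K C V C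
        \<circ> tmap K C (V \<boxtimes>\<^bsub>K\<^esub> C) id R2)"
    and R_hexagon: "eq_on (C \<boxtimes>\<^bsub>K\<^esub> (V \<boxtimes>\<^bsub>K\<^esub> A))
      (tmap K A (V \<boxtimes>\<^bsub>K\<^esub> C) id R2 \<circ> assocr K A C V \<circ> tmap K (A \<boxtimes>\<^bsub>K\<^esub> C) V R3 id \<circ> assocl K C A V
        \<circ> tmap K C (A \<boxtimes>\<^bsub>K\<^esub> V) id R1)
      (assocr K A V C \<circ> tmap K (A \<boxtimes>\<^bsub>K\<^esub> V) C R1 id \<circ> assocl K V A C
        \<circ> tmap K V (A \<boxtimes>\<^bsub>K\<^esub> C) id R3 \<circ> assocr K V C A
        \<circ> tmap K (V \<boxtimes>\<^bsub>K\<^esub> C) A R2 id \<circ> assocl K C V A)"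
    and E_R1: "eq_on (V \<boxtimes>\<^bsub>K\<^esub> (V \<boxtimes>\<^bsub>K\<^esub> A))
      (tmap K A (V \<boxtimes>\<^bsub>K\<^esub> C) (mul K A) id \<circ> assocl K A A (V \<boxtimes>\<^bsub>K\<^esub> C)
        \<circ> tmap K A (A \<boxtimes>\<^bsub>K\<^esub> (V \<boxtimes>\<^bsub>K\<^esub> C)) id E \<circ> assocr K A V V
        \<circ> tmap K (A \<boxtimes>\<^bsub>K\<^esub> V) V R1 id \<circ> assocl K V A V
        \<circ> tmap K V (A \<boxtimes>\<^bsub>K\<^esub> V) id R1)
      (tmap K A (V \<boxtimes>\<^bsub>K\<^esub> C) (mul K A) id \<circ> assocl K A A (V \<boxtimes>\<^bsub>K\<^esub> C)
        \<circ> tmap K A (A \<boxtimes>\<^bsub>K\<^esub> (V \<boxtimes>\<^bsub>K\<^esub> C)) id (assocr K A V C)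
        \<circ> tmap K A ((A \<boxtimes>\<^bsub>K\<^esub> V) \<boxtimes>\<^bsub>K\<^esub> C) id (tmap K (A \<boxtimes>\<^bsub>K\<^esub> V) C R1 id)
        \<circ> tmap K A ((V \<boxtimes>\<^bsub>K\<^esub> A) \<boxtimes>\<^bsub>K\<^esub> C) id (assocl K V A C)
        \<circ> tmap K A (V \<boxtimes>\<^bsub>K\<^esub> (A \<boxtimes>\<^bsub>K\<^esub> C)) id (tmap K V (A \<boxtimes>\<^bsub>K\<^esub> C) id R3)
        \<circ> tmap K A (V \<boxtimes>\<^bsub>K\<^esub> (C \<boxtimes>\<^bsub>K\<^esub> A)) id (assocr K V C A) \<circ> assocr K A (V \<boxtimes>\<^bsub>K\<^esub> C) A
        \<circ> tmap K (A \<boxtimes>\<^bsub>K\<^esub> (V \<boxtimes>\<^bsub>K\<^esub> C)) A E id \<circ> assocl K V V A)"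
    and E_R2: "eq_on (C \<boxtimes>\<^bsub>K\<^esub> (V \<boxtimes>\<^bsub>K\<^esub> V))
      (tmap K A (V \<boxtimes>\<^bsub>K\<^esub> C) id (tmap K V C id (mul K C))
        \<circ> tmap K A (V \<boxtimes>\<^bsub>K\<^esub> (C \<boxtimes>\<^bsub>K\<^esub> C)) id (assocr K V C C) \<circ> assocr K A (V \<boxtimes>\<^bsub>K\<^esub> C) C
        \<circ> tmap K (A \<boxtimes>\<^bsub>K\<^esub> (V \<boxtimes>\<^bsub>K\<^esub> C)) C E id \<circ> assocl K V V C
        \<circ> tmap K V (V \<boxtimes>\<^bsub>K\<^esub> C) id R2 \<circ> assocr K V C V
        \<circ> tmap K (V \<boxtimes>\<^bsub>K\<^esub> C) V R2 id \<circ> assocl K C V V)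
      (tmap K A (V \<boxtimes>\<^bsub>K\<^esub> C) id (tmap K V C id (mul K C))
        \<circ> tmap K A (V \<boxtimes>\<^bsub>K\<^esub> (C \<boxtimes>\<^bsub>K\<^esub> C)) id (assocr K V C C)
        \<circ> tmap K A ((V \<boxtimes>\<^bsub>K\<^esub> C) \<boxtimes>\<^bsub>K\<^esub> C) id (tmap K (V \<boxtimes>\<^bsub>K\<^esub> C) C R2 id)
        \<circ> tmap K A ((C \<boxtimes>\<^bsub>K\<^esub> V) \<boxtimes>\<^bsub>K\<^esub> C) id (assocl K C V C) \<circ> assocr K A C (V \<boxtimes>\<^bsub>K\<^esub> C)
        \<circ> tmap K (A \<boxtimes>\<^bsub>K\<^esub> C) (V \<boxtimes>\<^bsub>K\<^esub> C) R3 id \<circ> assocl K C A (V \<boxtimes>\<^bsub>K\<^esub> C)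
        \<circ> tmap K C (A \<boxtimes>\<^bsub>K\<^esub> (V \<boxtimes>\<^bsub>K\<^esub> C)) id E)"
    and E_cocycle: "eq_on (V \<boxtimes>\<^bsub>K\<^esub> (V \<boxtimes>\<^bsub>K\<^esub> V))
      (tmap K A (V \<boxtimes>\<^bsub>K\<^esub> C) (mul K A) (tmap K V C id (mul K C))
        \<circ> assocl K A A (V \<boxtimes>\<^bsub>K\<^esub> (C \<boxtimes>\<^bsub>K\<^esub> C))
        \<circ> tmap K A (A \<boxtimes>\<^bsub>K\<^esub> (V \<boxtimes>\<^bsub>K\<^esub> (C \<boxtimes>\<^bsub>K\<^esub> C))) id
            (tmap K A (V \<boxtimes>\<^bsub>K\<^esub> (C \<boxtimes>\<^bsub>K\<^esub> C)) id (assocr K V C C))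
        \<circ> tmap K A (A \<boxtimes>\<^bsub>K\<^esub> ((V \<boxtimes>\<^bsub>K\<^esub> C) \<boxtimes>\<^bsub>K\<^esub> C)) id (assocr K A (V \<boxtimes>\<^bsub>K\<^esub> C) C)
        \<circ> tmap K A ((A \<boxtimes>\<^bsub>K\<^esub> (V \<boxtimes>\<^bsub>K\<^esub> C)) \<boxtimes>\<^bsub>K\<^esub> C) id (tmap K (A \<boxtimes>\<^bsub>K\<^esub> (V \<boxtimes>\<^bsub>K\<^esub> C)) C E id)
        \<circ> tmap K A ((V \<boxtimes>\<^bsub>K\<^esub> V) \<boxtimes>\<^bsub>K\<^esub> C) id (assocl K V V C) \<circ> assocr K A V (V \<boxtimes>\<^bsub>K\<^esub> C)
        \<circ> tmap K (A \<boxtimes>\<^bsub>K\<^esub> V) (V \<boxtimes>\<^bsub>K\<^esub> C) R1 id \<circ> assocl K V A (V \<boxtimes>\<^bsub>K\<^esub> C)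
        \<circ> tmap K V (A \<boxtimes>\<^bsub>K\<^esub> (V \<boxtimes>\<^bsub>K\<^esub> C)) id E)
      (tmap K A (V \<boxtimes>\<^bsub>K\<^esub> C) (mul K A) (tmap K V C id (mul K C))
        \<circ> assocl K A A (V \<boxtimes>\<^bsub>K\<^esub> (C \<boxtimes>\<^bsub>K\<^esub> C))
        \<circ> tmap K A (A \<boxtimes>\<^bsub>K\<^esub> (V \<boxtimes>\<^bsub>K\<^esub> (C \<boxtimes>\<^bsub>K\<^esub> C))) id
            (tmap K A (V \<boxtimes>\<^bsub>K\<^esub> (C \<boxtimes>\<^bsub>K\<^esub> C)) id (assocr K V C C))
        \<circ> tmap K A (A \<boxtimes>\<^bsub>K\<^esub> ((V \<boxtimes>\<^bsub>K\<^esub> C) \<boxtimes>\<^bsub>K\<^esub> C)) id (assocr K A (V \<boxtimes>\<^bsub>K\<^esub> C) C)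
        \<circ> tmap K A ((A \<boxtimes>\<^bsub>K\<^esub> (V \<boxtimes>\<^bsub>K\<^esub> C)) \<boxtimes>\<^bsub>K\<^esub> C) id (tmap K (A \<boxtimes>\<^bsub>K\<^esub> (V \<boxtimes>\<^bsub>K\<^esub> C)) C E id)
        \<circ> tmap K A ((V \<boxtimes>\<^bsub>K\<^esub> V) \<boxtimes>\<^bsub>K\<^esub> C) id (assocl K V V C)
        \<circ> tmap K A (V \<boxtimes>\<^bsub>K\<^esub> (V \<boxtimes>\<^bsub>K\<^esub> C)) id (tmap K V (V \<boxtimes>\<^bsub>K\<^esub> C) id R2)
        \<circ> tmap K A (V \<boxtimes>\<^bsub>K\<^esub> (C \<boxtimes>\<^bsub>K\<^esub> V)) id (assocr K V C V) \<circ> assocr K A (V \<boxtimes>\<^bsub>K\<^esub> C) V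
        \<circ> tmap K (A \<boxtimes>\<^bsub>K\<^esub> (V \<boxtimes>\<^bsub>K\<^esub> C)) V E id \<circ> assocl K V V V)"
begin

sublocale A: assoc_algebra K A by (rule A_algebra)
sublocale C: assoc_algebra K C by (rule C_algebra)

lemma A_module [simp]: "module K A" ..
lemma C_module [simp]: "module K C" ..

abbreviation "T \<equiv> A \<boxtimes>\<^bsub>K\<^esub> (V \<boxtimes>\<^bsub>K\<^esub> C)"
abbreviation "pure a v c \<equiv> tens K A (V \<boxtimes>\<^bsub>K\<^esub> C) a (tens K V C v c)"

text \<open>
  As for general crossed products, these second names for the values on pure tensors, together with the
  \<open>NO_MATCH\<close> guards, let the simplifier expand each value once and try the unit conditions first.
\<close>

definition "r1 v a = R1 (tens K V A v a)"
definition "r2 c v = R2 (tens K C V c v)"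
definition "r3 c a = R3 (tens K C A c a)"
definition "ee v v' = E (tens K V V v v')"

lemma r_closed [simp]:
  "\<lbrakk>v \<in> carrier V; a \<in> carrier A\<rbrakk> \<Longrightarrow> r1 v a \<in> carrier (A \<boxtimes>\<^bsub>K\<^esub> V)"
  "\<lbrakk>c \<in> carrier C; v \<in> carrier V\<rbrakk> \<Longrightarrow> r2 c v \<in> carrier (V \<boxtimes>\<^bsub>K\<^esub> C)"
  "\<lbrakk>c \<in> carrier C; a \<in> carrier A\<rbrakk> \<Longrightarrow> r3 c a \<in> carrier (A \<boxtimes>\<^bsub>K\<^esub> C)"
  "\<lbrakk>v \<in> carrier V; v' \<in> carrier V\<rbrakk> \<Longrightarrow> ee v v' \<in> carrier T"
  by (simp_all add: r1_def r2_def r3_def ee_def linmaps_closed[OF R1_linear] linmaps_closed[OF R2_linear]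
      linmaps_closed[OF R3_linear] linmaps_closed[OF E_linear])

lemma R1_tens: "\<lbrakk>NO_MATCH oneV v; NO_MATCH \<one>\<^bsub>A\<^esub> a; v \<in> carrier V; a \<in> carrier A\<rbrakk>
    \<Longrightarrow> R1 (tens K V A v a) = sw A V (A \<boxtimes>\<^bsub>K\<^esub> V) (r1 v a) (\<lambda>a v. tens K A V a v)"
  by (simp add: sw_tens_id) (simp add: r1_def)

lemma R2_tens: "\<lbrakk>NO_MATCH \<one>\<^bsub>C\<^esub> c; NO_MATCH oneV v; c \<in> carrier C; v \<in> carrier V\<rbrakk>
    \<Longrightarrow> R2 (tens K C V c v) = sw V C (V \<boxtimes>\<^bsub>K\<^esub> C) (r2 c v) (\<lambda>v c. tens K V C v c)"
  by (simp add: sw_tens_id) (simp add: r2_def)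

lemma R3_tens: "\<lbrakk>NO_MATCH \<one>\<^bsub>C\<^esub> c; NO_MATCH \<one>\<^bsub>A\<^esub> a; c \<in> carrier C; a \<in> carrier A\<rbrakk>
    \<Longrightarrow> R3 (tens K C A c a) = sw A C (A \<boxtimes>\<^bsub>K\<^esub> C) (r3 c a) (\<lambda>a c. tens K A C a c)"
  by (simp add: sw_tens_id) (simp add: r3_def)

lemma E_tens: "\<lbrakk>NO_MATCH oneV v; NO_MATCH oneV v'; v \<in> carrier V; v' \<in> carrier V\<rbrakk>
    \<Longrightarrow> E (tens K V V v v') = sw A (V \<boxtimes>\<^bsub>K\<^esub> C) T (ee v v') (\<lambda>x w. sw V C T w (\<lambda>y z. pure x y z))"
  by (simp add: tens_sw_right[symmetric] sw_tens_id) (simp add: ee_def)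

lemmas R1_sw = linmaps_sw[OF R1_linear]
lemmas R2_sw = linmaps_sw[OF R2_linear]
lemmas R3_sw = linmaps_sw[OF R3_linear]
lemmas E_sw = linmaps_sw[OF E_linear]

lemma R3_unit:
  "c \<in> carrier C \<Longrightarrow> R3 (tens K C A c \<one>\<^bsub>A\<^esub>) = tens K A C \<one>\<^bsub>A\<^esub> c"
  "a \<in> carrier A \<Longrightarrow> R3 (tens K C A \<one>\<^bsub>C\<^esub> a) = tens K A C a \<one>\<^bsub>C\<^esub>"
  using R3_twisting by (auto simp: twisting_map_def)

lemmas NF_linear = R1_linear R2_linear R3_linear E_linear
lemmas NF = sweedler_calculus NF_linear R1_sw R2_sw R3_sw E_sw R1_tens R2_tens R3_tens E_tens
  A.m_assoc C.m_assoc
lemmas NF_unit = R1_unit_left[rule_format] R1_unit_right[rule_format] R2_unit_left[rule_format]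
  R2_unit_right[rule_format] E_unit_left[rule_format] E_unit_right[rule_format] R3_unit

lemma R3_mult_left:
  assumes [simp]: "c \<in> carrier C" "a \<in> carrier A" "a' \<in> carrier A"
  shows "R3 (tens K C A c (a \<otimes>\<^bsub>A\<^esub> a')) = sw A C (A \<boxtimes>\<^bsub>K\<^esub> C) (r3 c a) (\<lambda>a\<^sub>1 c\<^sub>1.
    sw A C (A \<boxtimes>\<^bsub>K\<^esub> C) (r3 c\<^sub>1 a') (\<lambda>a\<^sub>2 c\<^sub>2. tens K A C (a\<^sub>1 \<otimes>\<^bsub>A\<^esub> a\<^sub>2) c\<^sub>2))"
  using R3_twisting by (simp add: sw_eq twisting_map_def) (simp add: r3_def)

lemma R3_mult_right:
  assumes [simp]: "c \<in> carrier C" "c' \<in> carrier C" "a \<in> carrier A"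
  shows "R3 (tens K C A (c \<otimes>\<^bsub>C\<^esub> c') a) = sw A C (A \<boxtimes>\<^bsub>K\<^esub> C) (r3 c' a) (\<lambda>a\<^sub>1 c\<^sub>1.
    sw A C (A \<boxtimes>\<^bsub>K\<^esub> C) (r3 c a\<^sub>1) (\<lambda>a\<^sub>2 c\<^sub>2. tens K A C a\<^sub>2 (c\<^sub>2 \<otimes>\<^bsub>C\<^esub> c\<^sub>1)))"
  using R3_twisting by (simp add: sw_eq twisting_map_def) (simp add: r3_def)

text \<open>
  The relations for \<open>R\<^sub>1\<close> and \<open>R\<^sub>2\<close> on elements, in the form that \<open>R3_mult_left\<close> and \<open>R3_mult_right\<close> have.
\<close>

lemma R1_mult_tens:
  assumes [simp]: "v \<in> carrier V" "a \<in> carrier A" "a' \<in> carrier A"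
  shows "R1 (tens K V A v (a \<otimes>\<^bsub>A\<^esub> a')) = sw A V (A \<boxtimes>\<^bsub>K\<^esub> V) (r1 v a) (\<lambda>a\<^sub>1 v\<^sub>1.
    sw A V (A \<boxtimes>\<^bsub>K\<^esub> V) (r1 v\<^sub>1 a') (\<lambda>a\<^sub>2 v\<^sub>2. tens K A V (a\<^sub>1 \<otimes>\<^bsub>A\<^esub> a\<^sub>2) v\<^sub>2))"
  using eq_on_triple_tensorD[OF R1_mult, of v a a'] by (simp add: NF)

lemma R2_mult_tens:
  assumes [simp]: "c \<in> carrier C" "c' \<in> carrier C" "v \<in> carrier V"
  shows "R2 (tens K C V (c \<otimes>\<^bsub>C\<^esub> c') v) = sw V C (V \<boxtimes>\<^bsub>K\<^esub> C) (r2 c' v) (\<lambda>v\<^sub>1 c\<^sub>1.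
    sw V C (V \<boxtimes>\<^bsub>K\<^esub> C) (r2 c v\<^sub>1) (\<lambda>v\<^sub>2 c\<^sub>2. tens K V C v\<^sub>2 (c\<^sub>2 \<otimes>\<^bsub>C\<^esub> c\<^sub>1)))"
  using eq_on_triple_tensorD[OF R2_mult, of c c' v] by (simp add: NF)

subsection \<open>The multiplication on the threefold tensor product\<close>

abbreviation "R \<equiv> two_sided_R K A V C R1 R3"
abbreviation "P \<equiv> two_sided_P K A V C R2 R3"
abbreviation "\<sigma> \<equiv> two_sided_sigma K A V C R2 E"
abbreviation "\<nu> \<equiv> two_sided_nu K A V C R1 E"

lemma R_linear: "R \<in> linmaps K ((V \<boxtimes>\<^bsub>K\<^esub> C) \<boxtimes>\<^bsub>K\<^esub> A) T"
  unfolding two_sided_R_def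
  by (rule linmaps_o tmap_linear mul_linear assocl_linear assocr_linear linmaps_id NF_linear | simp)+

lemma P_linear: "P \<in> linmaps K (C \<boxtimes>\<^bsub>K\<^esub> (A \<boxtimes>\<^bsub>K\<^esub> V)) ((A \<boxtimes>\<^bsub>K\<^esub> V) \<boxtimes>\<^bsub>K\<^esub> C)"
  unfolding two_sided_P_def
  by (rule linmaps_o tmap_linear mul_linear assocl_linear assocr_linear linmaps_id NF_linear | simp)+

lemma \<sigma>_linear: "\<sigma> \<in> linmaps K ((V \<boxtimes>\<^bsub>K\<^esub> C) \<boxtimes>\<^bsub>K\<^esub> (V \<boxtimes>\<^bsub>K\<^esub> C)) T"
  unfolding two_sided_sigma_def
  by (rule linmaps_o tmap_linear mul_linear assocl_linear assocr_linear linmaps_id NF_linear | simp)+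

lemma \<nu>_linear: "\<nu> \<in> linmaps K ((A \<boxtimes>\<^bsub>K\<^esub> V) \<boxtimes>\<^bsub>K\<^esub> (A \<boxtimes>\<^bsub>K\<^esub> V)) ((A \<boxtimes>\<^bsub>K\<^esub> V) \<boxtimes>\<^bsub>K\<^esub> C)"
  unfolding two_sided_nu_def
  by (rule linmaps_o tmap_linear mul_linear assocl_linear assocr_linear linmaps_id NF_linear | simp)+

lemmas linear_right = bilinear_linear_right[OF tens_bilinear]
lemmas linear_left = bilinear_linear_left[OF tens_bilinear]

lemma \<sigma>_unit:
  assumes "w \<in> carrier (V \<boxtimes>\<^bsub>K\<^esub> C)"
  shows "\<sigma> (tens K (V \<boxtimes>\<^bsub>K\<^esub> C) (V \<boxtimes>\<^bsub>K\<^esub> C) (tens K V C oneV \<one>\<^bsub>C\<^esub>) w) = tens K A (V \<boxtimes>\<^bsub>K\<^esub> C) \<one>\<^bsub>A\<^esub> w"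
    and "\<sigma> (tens K (V \<boxtimes>\<^bsub>K\<^esub> C) (V \<boxtimes>\<^bsub>K\<^esub> C) w (tens K V C oneV \<one>\<^bsub>C\<^esub>)) = tens K A (V \<boxtimes>\<^bsub>K\<^esub> C) \<one>\<^bsub>A\<^esub> w"
  by (rule tensor_ext[OF linmaps_compose[OF \<sigma>_linear linear_right] linear_right _ _ _ _ assms];
      simp add: two_sided_sigma_def NF NF_unit)
    (rule tensor_ext[OF linmaps_compose[OF \<sigma>_linear linear_left] linear_right _ _ _ _ assms];
      simp add: two_sided_sigma_def NF NF_unit)

lemma \<nu>_unit:
  assumes "w \<in> carrier (A \<boxtimes>\<^bsub>K\<^esub> V)"
  shows "\<nu> (tens K (A \<boxtimes>\<^bsub>K\<^esub> V) (A \<boxtimes>\<^bsub>K\<^esub> V) (tens K A V \<one>\<^bsub>A\<^esub> oneV) w) = tens K (A \<boxtimes>\<^bsub>K\<^esub> V) C w \<one>\<^bsub>C\<^esub>"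
    and "\<nu> (tens K (A \<boxtimes>\<^bsub>K\<^esub> V) (A \<boxtimes>\<^bsub>K\<^esub> V) w (tens K A V \<one>\<^bsub>A\<^esub> oneV)) = tens K (A \<boxtimes>\<^bsub>K\<^esub> V) C w \<one>\<^bsub>C\<^esub>"
  by (rule tensor_ext[OF linmaps_compose[OF \<nu>_linear linear_right] linear_left _ _ _ _ assms];
      simp add: two_sided_nu_def NF NF_unit)
    (rule tensor_ext[OF linmaps_compose[OF \<nu>_linear linear_left] linear_left _ _ _ _ assms];
      simp add: two_sided_nu_def NF NF_unit)

lemma R_unit:
  assumes "w \<in> carrier (V \<boxtimes>\<^bsub>K\<^esub> C)"
  shows "R (tens K (V \<boxtimes>\<^bsub>K\<^esub> C) A w \<one>\<^bsub>A\<^esub>) = tens K A (V \<boxtimes>\<^bsub>K\<^esub> C) \<one>\<^bsub>A\<^esub> w"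
  by (rule tensor_ext[OF linmaps_compose[OF R_linear linear_left] linear_right _ _ _ _ assms];
      simp add: two_sided_R_def NF NF_unit)

lemma P_unit:
  assumes "w \<in> carrier (A \<boxtimes>\<^bsub>K\<^esub> V)"
  shows "P (tens K C (A \<boxtimes>\<^bsub>K\<^esub> V) \<one>\<^bsub>C\<^esub> w) = tens K (A \<boxtimes>\<^bsub>K\<^esub> V) C w \<one>\<^bsub>C\<^esub>"
  by (rule tensor_ext[OF linmaps_compose[OF P_linear linear_right] linear_left _ _ _ _ assms];
      simp add: two_sided_P_def NF NF_unit)

sublocale X: crossed_datum K A "V \<boxtimes>\<^bsub>K\<^esub> C" "tens K V C oneV \<one>\<^bsub>C\<^esub>" R \<sigma>
proof (intro crossed_datum.intro crossed_datum_axioms.intro base_ring_axioms)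
  show "R (tens K (V \<boxtimes>\<^bsub>K\<^esub> C) A (tens K V C oneV \<one>\<^bsub>C\<^esub>) a) = tens K A (V \<boxtimes>\<^bsub>K\<^esub> C) a (tens K V C oneV \<one>\<^bsub>C\<^esub>)"
    if "a \<in> carrier A" for a
    using that by (simp add: two_sided_R_def NF NF_unit)
qed (simp_all add: R_linear \<sigma>_linear \<sigma>_unit R_unit)

sublocale Y: mirror_crossed_datum K "A \<boxtimes>\<^bsub>K\<^esub> V" C "tens K A V \<one>\<^bsub>A\<^esub> oneV" P \<nu>
proof (intro mirror_crossed_datum.intro mirror_crossed_datum_axioms.intro base_ring_axioms)
  show "P (tens K C (A \<boxtimes>\<^bsub>K\<^esub> V) c (tens K A V \<one>\<^bsub>A\<^esub> oneV)) = tens K (A \<boxtimes>\<^bsub>K\<^esub> V) C (tens K A V \<one>\<^bsub>A\<^esub> oneV) c"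
    if "c \<in> carrier C" for c
    using that by (simp add: two_sided_P_def NF NF_unit)
qed (simp_all add: P_linear \<nu>_linear \<nu>_unit P_unit)

text \<open>
  The multiplication \<open>\<star>\<close> is that of the crossed product \<open>A \<otimes> (V \<otimes> C)\<close>; its associativity is the aim of the
  next three subsections. The three embeddings below are written out as pure tensors so that the unit
  conditions remain applicable by rewriting.
\<close>

notation X.mult (infixl \<open>\<star>\<close> 70)

abbreviation "iA a \<equiv> pure a oneV \<one>\<^bsub>C\<^esub>"
abbreviation "iV v \<equiv> pure \<one>\<^bsub>A\<^esub> v \<one>\<^bsub>C\<^esub>"
abbreviation "iC c \<equiv> pure \<one>\<^bsub>A\<^esub> oneV c"

lemmas R_apply = two_sided_R_def[THEN fun_cong, unfolded o_apply]
lemmas \<sigma>_apply = two_sided_sigma_def[THEN fun_cong, unfolded o_apply]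
lemmas X_defs = X.mult_def crossed_mult_def R_apply \<sigma>_apply R_linear \<sigma>_linear X.mul_mul_linear

lemma pure_mult_pure:
  assumes [simp]: "a \<in> carrier A" "v \<in> carrier V" "c \<in> carrier C"
    "a' \<in> carrier A" "v' \<in> carrier V" "c' \<in> carrier C"
  shows "pure a v c \<star> pure a' v' c' =
    sw A C T (r3 c a') (\<lambda>a\<^sub>3 c\<^sub>3. sw A V T (r1 v a\<^sub>3) (\<lambda>a\<^sub>1 v\<^sub>1. sw V C T (r2 c\<^sub>3 v') (\<lambda>v\<^sub>2 c\<^sub>2.
    sw A (V \<boxtimes>\<^bsub>K\<^esub> C) T (ee v\<^sub>1 v\<^sub>2) (\<lambda>x w. sw V C T w (\<lambda>y z.
      pure (a \<otimes>\<^bsub>A\<^esub> a\<^sub>1 \<otimes>\<^bsub>A\<^esub> x) y (z \<otimes>\<^bsub>C\<^esub> c\<^sub>2 \<otimes>\<^bsub>C\<^esub> c'))))))"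
  by (simp add: X_defs NF)

text \<open>
  The guards exclude multiplication by \<open>a \<otimes> 1 \<otimes> 1\<close> on the left and by \<open>1 \<otimes> 1 \<otimes> c\<close> on the right, for which
  the simpler formulas \<open>iA_mult\<close> and \<open>mult_iC\<close> below are to be used.
\<close>

lemma pure_mult_generic:
  assumes "NO_MATCH oneV v" "NO_MATCH oneV v'" and [simp]: "a \<in> carrier A" "v \<in> carrier V" "c \<in> carrier C"
    "a' \<in> carrier A" "v' \<in> carrier V" "c' \<in> carrier C"
  shows "pure a v c \<star> pure a' v' c' =
    sw A C T (r3 c a') (\<lambda>a\<^sub>3 c\<^sub>3. sw A V T (r1 v a\<^sub>3) (\<lambda>a\<^sub>1 v\<^sub>1. sw V C T (r2 c\<^sub>3 v') (\<lambda>v\<^sub>2 c\<^sub>2.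
    sw A (V \<boxtimes>\<^bsub>K\<^esub> C) T (ee v\<^sub>1 v\<^sub>2) (\<lambda>x w. sw V C T w (\<lambda>y z.
      pure (a \<otimes>\<^bsub>A\<^esub> a\<^sub>1 \<otimes>\<^bsub>A\<^esub> x) y (z \<otimes>\<^bsub>C\<^esub> c\<^sub>2 \<otimes>\<^bsub>C\<^esub> c'))))))"
  by (rule pure_mult_pure) simp_all

lemma iA_mult:
  assumes [simp]: "a \<in> carrier A" "a' \<in> carrier A" "v \<in> carrier V" "c \<in> carrier C"
  shows "iA a \<star> pure a' v c = pure (a \<otimes>\<^bsub>A\<^esub> a') v c"
  by (simp add: X_defs NF NF_unit)

lemma mult_iC:
  assumes [simp]: "a \<in> carrier A" "v \<in> carrier V" "c \<in> carrier C" "c' \<in> carrier C"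
  shows "pure a v c \<star> iC c' = pure a v (c \<otimes>\<^bsub>C\<^esub> c')"
  by (simp add: X_defs NF NF_unit)

lemma iV_mult:
  assumes [simp]: "v \<in> carrier V" "a \<in> carrier A" "v' \<in> carrier V" "c \<in> carrier C"
  shows "iV v \<star> pure a v' c = sw A V T (r1 v a) (\<lambda>a\<^sub>1 v\<^sub>1.
    sw A (V \<boxtimes>\<^bsub>K\<^esub> C) T (ee v\<^sub>1 v') (\<lambda>x w. sw V C T w (\<lambda>y z. pure (a\<^sub>1 \<otimes>\<^bsub>A\<^esub> x) y (z \<otimes>\<^bsub>C\<^esub> c))))"
  by (simp add: X_defs NF NF_unit)

lemma iC_mult:
  assumes [simp]: "c \<in> carrier C" "a \<in> carrier A" "v \<in> carrier V" "c' \<in> carrier C"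
  shows "iC c \<star> pure a v c' = sw A C T (r3 c a) (\<lambda>a\<^sub>1 c\<^sub>1.
    sw V C T (r2 c\<^sub>1 v) (\<lambda>v\<^sub>1 c\<^sub>2. pure a\<^sub>1 v\<^sub>1 (c\<^sub>2 \<otimes>\<^bsub>C\<^esub> c')))"
  by (simp add: X_defs NF NF_unit)

lemma mult_iA:
  assumes [simp]: "c \<in> carrier C" "a \<in> carrier A" "v \<in> carrier V" "a' \<in> carrier A"
  shows "pure a v c \<star> iA a' = sw A C T (r3 c a') (\<lambda>a\<^sub>1 c\<^sub>1.
    sw A V T (r1 v a\<^sub>1) (\<lambda>a\<^sub>2 v\<^sub>1. pure (a \<otimes>\<^bsub>A\<^esub> a\<^sub>2) v\<^sub>1 c\<^sub>1))"
  by (simp add: X_defs NF NF_unit)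

lemma mult_iV:
  assumes [simp]: "a \<in> carrier A" "v \<in> carrier V" "c \<in> carrier C" "v' \<in> carrier V"
  shows "pure a v c \<star> iV v' = sw V C T (r2 c v') (\<lambda>v\<^sub>1 c\<^sub>1.
    sw A (V \<boxtimes>\<^bsub>K\<^esub> C) T (ee v v\<^sub>1) (\<lambda>x w. sw V C T w (\<lambda>y z. pure (a \<otimes>\<^bsub>A\<^esub> x) y (z \<otimes>\<^bsub>C\<^esub> c\<^sub>1))))"
  by (simp add: X_defs NF NF_unit)

lemma iV_iA: "\<lbrakk>v \<in> carrier V; a \<in> carrier A\<rbrakk>
    \<Longrightarrow> iV v \<star> iA a = sw A V T (r1 v a) (\<lambda>a\<^sub>1 v\<^sub>1. pure a\<^sub>1 v\<^sub>1 \<one>\<^bsub>C\<^esub>)"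
  by (simp add: X_defs NF NF_unit)

lemma iV_iV: "\<lbrakk>v \<in> carrier V; v' \<in> carrier V\<rbrakk> \<Longrightarrow> iV v \<star> iV v' =
    sw A (V \<boxtimes>\<^bsub>K\<^esub> C) T (ee v v') (\<lambda>x w. sw V C T w (\<lambda>y z. pure x y z))"
  by (simp add: X_defs NF NF_unit)

lemma iC_iV: "\<lbrakk>c \<in> carrier C; v \<in> carrier V\<rbrakk>
    \<Longrightarrow> iC c \<star> iV v = sw V C T (r2 c v) (\<lambda>v\<^sub>1 c\<^sub>1. pure \<one>\<^bsub>A\<^esub> v\<^sub>1 c\<^sub>1)"
  by (simp add: X_defs NF NF_unit)

lemma threefold_ext:
  assumes "f \<in> linmaps K T N" "g \<in> linmaps K T N" "module K N" "x \<in> carrier T"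
    and "\<And>a v c. \<lbrakk>a \<in> carrier A; v \<in> carrier V; c \<in> carrier C\<rbrakk> \<Longrightarrow> f (pure a v c) = g (pure a v c)"
  shows "f x = g x"
  using eq_on_triple_tensorI[OF assms(1,2)] assms(3-) by (simp add: eq_on_def)

lemmas mult_linear_right = bilinear_linear_right[OF X.mult_bilinear]
lemmas mult_linear_left = bilinear_linear_left[OF X.mult_bilinear]
lemmas mult_sw = X.mult_sw_left X.mult_sw_right

subsection \<open>Associativity on generators\<close>

text \<open>
  Here the four relations that involve \<open>V\<close> twice or all of \<open>R\<^sub>1, R\<^sub>2, R\<^sub>3\<close> enter: the two sides of each
  relation, evaluated at a pure tensor, are the two bracketings of a product of three generators. The inner
  products are unfolded before the general formulas, which would not see the units.
\<close>

lemma iV_iV_iA: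
  assumes [simp]: "v \<in> carrier V" "v' \<in> carrier V" "a \<in> carrier A"
  shows "iV v \<star> (iV v' \<star> iA a) = (iV v \<star> iV v') \<star> iA a"
  using eq_on_triple_tensorD[OF E_R1, of v v' a]
  unfolding iV_iA[OF assms(2,3)] iV_iV[OF assms(1,2)]
  by (simp add: NF mult_sw iV_mult mult_iA)

lemma iC_iV_iV:
  assumes [simp]: "c \<in> carrier C" "v \<in> carrier V" "v' \<in> carrier V"
  shows "iC c \<star> (iV v \<star> iV v') = (iC c \<star> iV v) \<star> iV v'"
  using eq_on_triple_tensorD[OF E_R2, of c v v']
  unfolding iC_iV[OF assms(1,2)] iV_iV[OF assms(2,3)]
  by (simp add: NF mult_sw iC_mult mult_iV)

lemma iC_iV_iA:
  assumes [simp]: "c \<in> carrier C" "v \<in> carrier V" "a \<in> carrier A"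
  shows "iC c \<star> (iV v \<star> iA a) = (iC c \<star> iV v) \<star> iA a"
  using eq_on_triple_tensorD[OF R_hexagon, of c v a]
  unfolding iC_iV[OF assms(1,2)] iV_iA[OF assms(2,3)]
  by (simp add: NF mult_sw iC_mult mult_iA)

lemma iV_iV_iV:
  assumes [simp]: "v \<in> carrier V" "v' \<in> carrier V" "v'' \<in> carrier V"
  shows "iV v \<star> (iV v' \<star> iV v'') = (iV v \<star> iV v') \<star> iV v''"
  using eq_on_triple_tensorD[OF E_cocycle, of v v' v'']
  unfolding iV_iV[OF assms(1,2)] iV_iV[OF assms(2,3)]
  by (simp add: NF mult_sw iV_mult mult_iV)

text \<open>
  Left multiplication by \<open>a\<close> affects only the factor \<open>A\<close>, on which it is left multiplication in \<open>A\<close>; it is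
  therefore compatible with every right multiplication. The same holds for \<open>C\<close> on the other side.
\<close>

lemma iA_assoc:
  assumes "a \<in> carrier A" "x \<in> carrier T" "y \<in> carrier T"
  shows "iA a \<star> (x \<star> y) = (iA a \<star> x) \<star> y"
proof -
  note [simp] = assms
  have *: "iA a \<star> (pure b v c \<star> y) = (iA a \<star> pure b v c) \<star> y"
    if [simp]: "b \<in> carrier A" "v \<in> carrier V" "c \<in> carrier C" for b v c
    by (rule threefold_ext[OF linmaps_compose[OF mult_linear_right mult_linear_right] mult_linear_right])
      (simp_all add: pure_mult_generic iA_mult mult_sw A.m_assoc)
  show ?thesis
    by (rule threefold_ext[OF linmaps_compose[OF mult_linear_right mult_linear_left]
          linmaps_compose[OF mult_linear_left mult_linear_right]])
      (simp_all add: *)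
qed

lemma iC_assoc:
  assumes "c \<in> carrier C" "x \<in> carrier T" "y \<in> carrier T"
  shows "x \<star> (y \<star> iC c) = (x \<star> y) \<star> iC c"
proof -
  note [simp] = assms
  have *: "pure b v c' \<star> (y \<star> iC c) = (pure b v c' \<star> y) \<star> iC c"
    if [simp]: "b \<in> carrier A" "v \<in> carrier V" "c' \<in> carrier C" for b v c'
    by (rule threefold_ext[OF linmaps_compose[OF mult_linear_right mult_linear_left]
          linmaps_compose[OF mult_linear_left mult_linear_right]])
      (simp_all add: pure_mult_generic mult_iC mult_sw C.m_assoc)
  show ?thesis
    by (rule threefold_ext[OF mult_linear_left linmaps_compose[OF mult_linear_left mult_linear_left]])
      (simp_all add: *)
qed

subsection \<open>Moving coefficients past generators\<close>

text \<open>
  In \<open>c (a x)\<close> the coefficients of \<open>a\<close> and \<open>x\<close> are multiplied before \<open>R\<^sub>3\<close> is applied, and the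
  multiplicativity of \<open>R\<^sub>3\<close> splits the value at this product into an iterated sum. To substitute an
  iterated sum for a tensor, the product \<open>c (a x)\<close> is first written as a linear function of
  \<open>R\<^sub>3 (c \<otimes> a a')\<close>. The maps \<open>a \<otimes> c \<mapsto> a \<otimes> 1 \<otimes> c\<close> and \<open>a \<otimes> v \<mapsto> a \<otimes> v \<otimes> 1\<close>, followed by a
  multiplication, provide these linear functions.
\<close>

abbreviation "embAC \<equiv> tmap K A (V \<boxtimes>\<^bsub>K\<^esub> C) id (tens K V C oneV)"
abbreviation "embAV \<equiv> tmap K A (V \<boxtimes>\<^bsub>K\<^esub> C) id (\<lambda>v. tens K V C v \<one>\<^bsub>C\<^esub>)"

lemma iC_iA_skew:
  assumes [simp]: "c \<in> carrier C" "a \<in> carrier A" "x \<in> carrier T"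
  shows "iC c \<star> (iA a \<star> x) = sw A C T (r3 c a) (\<lambda>a\<^sub>1 c\<^sub>1. iA a\<^sub>1 \<star> (iC c\<^sub>1 \<star> x))"
proof (rule threefold_ext[OF linmaps_compose[OF mult_linear_right mult_linear_right]
      sw_linear_parameter[OF _ _ _ _ _ linmaps_compose[OF mult_linear_right mult_linear_right]]])
  fix a' v c' assume [simp]: "a' \<in> carrier A" "v \<in> carrier V" "c' \<in> carrier C"
  have *: "pure b oneV d \<star> pure \<one>\<^bsub>A\<^esub> v c' = sw V C T (r2 d v) (\<lambda>v\<^sub>1 c\<^sub>1. pure b v\<^sub>1 (c\<^sub>1 \<otimes>\<^bsub>C\<^esub> c'))"
    if "b \<in> carrier A" "d \<in> carrier C" for b d
    using that by (simp add: X_defs NF NF_unit)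
  have "iC c \<star> (iA a \<star> pure a' v c') = embAC (R3 (tens K C A c (a \<otimes>\<^bsub>A\<^esub> a'))) \<star> pure \<one>\<^bsub>A\<^esub> v c'"
    by (simp add: NF linear_right iA_mult iC_mult mult_sw *)
  also have "\<dots> = sw A C T (r3 c a) (\<lambda>a\<^sub>1 c\<^sub>1. iA a\<^sub>1 \<star> (iC c\<^sub>1 \<star> pure a' v c'))"
    by (simp add: R3_mult_left sweedler_calculus linear_right iA_mult iC_mult mult_sw *)
  finally show "iC c \<star> (iA a \<star> pure a' v c') =
    sw A C T (r3 c a) (\<lambda>a\<^sub>1 c\<^sub>1. iA a\<^sub>1 \<star> (iC c\<^sub>1 \<star> pure a' v c'))" .
qed simp_all

lemma iV_iA_skew:
  assumes [simp]: "v \<in> carrier V" "a \<in> carrier A" "x \<in> carrier T"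
  shows "iV v \<star> (iA a \<star> x) = sw A V T (r1 v a) (\<lambda>a\<^sub>1 v\<^sub>1. iA a\<^sub>1 \<star> (iV v\<^sub>1 \<star> x))"
proof (rule threefold_ext[OF linmaps_compose[OF mult_linear_right mult_linear_right]
      sw_linear_parameter[OF _ _ _ _ _ linmaps_compose[OF mult_linear_right mult_linear_right]]])
  fix a' v' c assume [simp]: "a' \<in> carrier A" "v' \<in> carrier V" "c \<in> carrier C"
  have *: "pure b u \<one>\<^bsub>C\<^esub> \<star> pure \<one>\<^bsub>A\<^esub> v' c = sw A (V \<boxtimes>\<^bsub>K\<^esub> C) T (ee u v') (\<lambda>x w.
      sw V C T w (\<lambda>y z. pure (b \<otimes>\<^bsub>A\<^esub> x) y (z \<otimes>\<^bsub>C\<^esub> c)))"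
    if "b \<in> carrier A" "u \<in> carrier V" for b u
    using that by (simp add: X_defs NF NF_unit)
  have "iV v \<star> (iA a \<star> pure a' v' c) = embAV (R1 (tens K V A v (a \<otimes>\<^bsub>A\<^esub> a'))) \<star> pure \<one>\<^bsub>A\<^esub> v' c"
    by (simp add: NF linear_left iA_mult iV_mult mult_sw *)
  also have "\<dots> = sw A V T (r1 v a) (\<lambda>a\<^sub>1 v\<^sub>1. iA a\<^sub>1 \<star> (iV v\<^sub>1 \<star> pure a' v' c))"
    by (simp add: R1_mult_tens sweedler_calculus linear_left iA_mult iV_mult mult_sw A.m_assoc *)
  finally show "iV v \<star> (iA a \<star> pure a' v' c) =
    sw A V T (r1 v a) (\<lambda>a\<^sub>1 v\<^sub>1. iA a\<^sub>1 \<star> (iV v\<^sub>1 \<star> pure a' v' c))" .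
qed simp_all

lemma iC_iV_skew:
  assumes [simp]: "c \<in> carrier C" "v \<in> carrier V" "x \<in> carrier T"
  shows "(x \<star> iC c) \<star> iV v = sw V C T (r2 c v) (\<lambda>v\<^sub>1 c\<^sub>1. (x \<star> iV v\<^sub>1) \<star> iC c\<^sub>1)"
proof (rule threefold_ext[OF linmaps_compose[OF mult_linear_left mult_linear_left]
      sw_linear_parameter[OF _ _ _ _ _ linmaps_compose[OF mult_linear_left mult_linear_left]]])
  fix a v' c' assume [simp]: "a \<in> carrier A" "v' \<in> carrier V" "c' \<in> carrier C"
  have *: "pure a v' \<one>\<^bsub>C\<^esub> \<star> pure \<one>\<^bsub>A\<^esub> u d = sw A (V \<boxtimes>\<^bsub>K\<^esub> C) T (ee v' u) (\<lambda>x w.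
      sw V C T w (\<lambda>y z. pure (a \<otimes>\<^bsub>A\<^esub> x) y (z \<otimes>\<^bsub>C\<^esub> d)))"
    if "u \<in> carrier V" "d \<in> carrier C" for u d
    using that by (simp add: X_defs NF NF_unit)
  have "(pure a v' c' \<star> iC c) \<star> iV v =
      pure a v' \<one>\<^bsub>C\<^esub> \<star> tens K A (V \<boxtimes>\<^bsub>K\<^esub> C) \<one>\<^bsub>A\<^esub> (R2 (tens K C V (c' \<otimes>\<^bsub>C\<^esub> c) v))"
    by (simp add: NF mult_iC mult_iV mult_sw *)
  also have "\<dots> = sw V C T (r2 c v) (\<lambda>v\<^sub>1 c\<^sub>1. (pure a v' c' \<star> iV v\<^sub>1) \<star> iC c\<^sub>1)"
    by (simp add: R2_mult_tens sweedler_calculus mult_iC mult_iV mult_sw C.m_assoc *)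
  finally show "(pure a v' c' \<star> iC c) \<star> iV v =
    sw V C T (r2 c v) (\<lambda>v\<^sub>1 c\<^sub>1. (pure a v' c' \<star> iV v\<^sub>1) \<star> iC c\<^sub>1)" .
qed simp_all

lemma iC_iA_skew_right:
  assumes [simp]: "c \<in> carrier C" "a \<in> carrier A" "x \<in> carrier T"
  shows "(x \<star> iC c) \<star> iA a = sw A C T (r3 c a) (\<lambda>a\<^sub>1 c\<^sub>1. (x \<star> iA a\<^sub>1) \<star> iC c\<^sub>1)"
proof (rule threefold_ext[OF linmaps_compose[OF mult_linear_left mult_linear_left]
      sw_linear_parameter[OF _ _ _ _ _ linmaps_compose[OF mult_linear_left mult_linear_left]]])
  fix a' v c' assume [simp]: "a' \<in> carrier A" "v \<in> carrier V" "c' \<in> carrier C"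
  have *: "pure a' v \<one>\<^bsub>C\<^esub> \<star> pure b oneV d = sw A V T (r1 v b) (\<lambda>a\<^sub>1 v\<^sub>1. pure (a' \<otimes>\<^bsub>A\<^esub> a\<^sub>1) v\<^sub>1 d)"
    if "b \<in> carrier A" "d \<in> carrier C" for b d
    using that by (simp add: X_defs NF NF_unit)
  have "(pure a' v c' \<star> iC c) \<star> iA a = pure a' v \<one>\<^bsub>C\<^esub> \<star> embAC (R3 (tens K C A (c' \<otimes>\<^bsub>C\<^esub> c) a))"
    by (simp add: NF linear_right mult_iC mult_iA mult_sw *)
  also have "\<dots> = sw A C T (r3 c a) (\<lambda>a\<^sub>1 c\<^sub>1. (pure a' v c' \<star> iA a\<^sub>1) \<star> iC c\<^sub>1)"
    by (simp add: R3_mult_right sweedler_calculus linear_right mult_iC mult_iA mult_sw *)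
  finally show "(pure a' v c' \<star> iC c) \<star> iA a =
    sw A C T (r3 c a) (\<lambda>a\<^sub>1 c\<^sub>1. (pure a' v c' \<star> iA a\<^sub>1) \<star> iC c\<^sub>1)" .
qed simp_all

subsection \<open>Associativity\<close>

text \<open>
  Let \<open>g\<close> act from the left and \<open>h\<close> from the right. If \<open>g\<close> moves past left multiplications by \<open>A\<close>, and \<open>h\<close>
  past right multiplications by \<open>C\<close>, then writing \<open>x = a v c\<close> reduces \<open>g (x h) = (g x) h\<close> to \<open>x = v\<close>. The
  statement covers the four pairs with \<open>g\<close> in \<open>V\<close> or \<open>C\<close> and \<open>h\<close> in \<open>A\<close> or \<open>V\<close>; the maps \<open>i\<close> and \<open>j\<close>
  are the respective embeddings, and \<open>r\<close> and \<open>s\<close> the maps \<open>R\<^sub>i\<close> that occur when moving past.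
\<close>

lemma exchange:
  fixes G :: "('k, 'g) module" and H :: "('k, 'h) module"
  assumes G: "module K G" and H: "module K H"
    and i: "\<And>g. g \<in> carrier G \<Longrightarrow> i g \<in> carrier T" and j: "\<And>h. h \<in> carrier H \<Longrightarrow> j h \<in> carrier T"
    and r: "\<And>g a. \<lbrakk>g \<in> carrier G; a \<in> carrier A\<rbrakk> \<Longrightarrow> r g a \<in> carrier (A \<boxtimes>\<^bsub>K\<^esub> G)"
    and s: "\<And>c h. \<lbrakk>c \<in> carrier C; h \<in> carrier H\<rbrakk> \<Longrightarrow> s c h \<in> carrier (H \<boxtimes>\<^bsub>K\<^esub> C)"
    and left: "\<And>g a x. \<lbrakk>g \<in> carrier G; a \<in> carrier A; x \<in> carrier T\<rbrakk>
      \<Longrightarrow> i g \<star> (iA a \<star> x) = sw A G T (r g a) (\<lambda>a\<^sub>1 g\<^sub>1. iA a\<^sub>1 \<star> (i g\<^sub>1 \<star> x))"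
    and right: "\<And>c h x. \<lbrakk>c \<in> carrier C; h \<in> carrier H; x \<in> carrier T\<rbrakk>
      \<Longrightarrow> (x \<star> iC c) \<star> j h = sw H C T (s c h) (\<lambda>h\<^sub>1 c\<^sub>1. (x \<star> j h\<^sub>1) \<star> iC c\<^sub>1)"
    and gen: "\<And>g v h. \<lbrakk>g \<in> carrier G; v \<in> carrier V; h \<in> carrier H\<rbrakk>
      \<Longrightarrow> i g \<star> (iV v \<star> j h) = (i g \<star> iV v) \<star> j h"
    and g: "g \<in> carrier G" and h: "h \<in> carrier H" and x: "x \<in> carrier T"
  shows "i g \<star> (x \<star> j h) = (i g \<star> x) \<star> j h"
proof (rule threefold_ext[OF linmaps_compose[OF mult_linear_right mult_linear_left]
      linmaps_compose[OF mult_linear_left mult_linear_right]])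
  fix a v c assume [simp]: "a \<in> carrier A" "v \<in> carrier V" "c \<in> carrier C"
  note [simp] = G H g h
  have pure: "pure a v c = (iA a \<star> iV v) \<star> iC c"
    by (simp add: iA_mult mult_iC)
  \<comment> \<open>The right factor is restricted so that this does not undo \<open>iC_assoc\<close>.\<close>
  have iA_assoc': "(iA b \<star> x) \<star> j k = iA b \<star> (x \<star> j k)"
    if "b \<in> carrier A" "x \<in> carrier T" "k \<in> carrier H" for b x k
    using that by (simp add: iA_assoc j)
  have "i g \<star> (pure a v c \<star> j h)
      = sw H C T (s c h) (\<lambda>h\<^sub>1 c\<^sub>1. sw A G T (r g a) (\<lambda>a\<^sub>1 g\<^sub>1.
          (iA a\<^sub>1 \<star> (i g\<^sub>1 \<star> (iV v \<star> j h\<^sub>1))) \<star> iC c\<^sub>1))"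
    unfolding pure by (simp add: i j r s right left mult_sw iA_assoc' iC_assoc)
  also have "\<dots> = sw A G T (r g a) (\<lambda>a\<^sub>1 g\<^sub>1. sw H C T (s c h) (\<lambda>h\<^sub>1 c\<^sub>1.
          (iA a\<^sub>1 \<star> (i g\<^sub>1 \<star> (iV v \<star> j h\<^sub>1))) \<star> iC c\<^sub>1))"
    by (rule sw_commute) (simp_all add: i j r s)
  also have "\<dots> = sw A G T (r g a) (\<lambda>a\<^sub>1 g\<^sub>1. sw H C T (s c h) (\<lambda>h\<^sub>1 c\<^sub>1.
          (iA a\<^sub>1 \<star> ((i g\<^sub>1 \<star> iV v) \<star> j h\<^sub>1)) \<star> iC c\<^sub>1))"
    by (simp add: gen)
  also have "\<dots> = (i g \<star> pure a v c) \<star> j h"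
    unfolding pure by (simp add: i j r s right left mult_sw iA_assoc' iC_assoc)
  finally show "i g \<star> (pure a v c \<star> j h) = (i g \<star> pure a v c) \<star> j h" .
qed (use i j g h x in simp_all)

text \<open>
  Applying \<open>c\<close> and then \<open>v\<close> uses \<open>R\<^sub>2\<close> before \<open>R\<^sub>1\<close>, while the product formula has \<open>R\<^sub>1\<close> first. The two
  sums are over independent tensors and can be interchanged.
\<close>

lemma pure_mult_left:
  assumes [simp]: "a \<in> carrier A" "v \<in> carrier V" "c \<in> carrier C" and y: "y \<in> carrier T"
  shows "pure a v c \<star> y = iA a \<star> (iV v \<star> (iC c \<star> y))"
proof (rule threefold_ext[OF mult_linear_right
      linmaps_compose[OF mult_linear_right linmaps_compose[OF mult_linear_right mult_linear_right]]])
  fix a' v' c' assume [simp]: "a' \<in> carrier A" "v' \<in> carrier V" "c' \<in> carrier C"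
  have "iA a \<star> (iV v \<star> (iC c \<star> pure a' v' c')) =
    sw A C T (r3 c a') (\<lambda>a\<^sub>3 c\<^sub>3. sw V C T (r2 c\<^sub>3 v') (\<lambda>v\<^sub>2 c\<^sub>2. sw A V T (r1 v a\<^sub>3) (\<lambda>a\<^sub>1 v\<^sub>1.
    sw A (V \<boxtimes>\<^bsub>K\<^esub> C) T (ee v\<^sub>1 v\<^sub>2) (\<lambda>x w. sw V C T w (\<lambda>y z.
      pure (a \<otimes>\<^bsub>A\<^esub> a\<^sub>1 \<otimes>\<^bsub>A\<^esub> x) y (z \<otimes>\<^bsub>C\<^esub> c\<^sub>2 \<otimes>\<^bsub>C\<^esub> c'))))))"
    by (simp add: iC_mult iV_mult iA_mult mult_sw A.m_assoc C.m_assoc)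
  then show "pure a v c \<star> pure a' v' c' = iA a \<star> (iV v \<star> (iC c \<star> pure a' v' c'))"
    by (simp add: pure_mult_pure sw_commute[of V C A V])
qed (use y in simp_all)

lemma pure_mult_right:
  assumes [simp]: "a \<in> carrier A" "v \<in> carrier V" "c \<in> carrier C" and x: "x \<in> carrier T"
  shows "x \<star> pure a v c = ((x \<star> iA a) \<star> iV v) \<star> iC c"
proof (rule threefold_ext[OF mult_linear_left
      linmaps_compose[OF mult_linear_left linmaps_compose[OF mult_linear_left mult_linear_left]]])
  fix a' v' c' assume [simp]: "a' \<in> carrier A" "v' \<in> carrier V" "c' \<in> carrier C"
  have "((pure a' v' c' \<star> iA a) \<star> iV v) \<star> iC c =
    sw A C T (r3 c' a) (\<lambda>a\<^sub>3 c\<^sub>3. sw A V T (r1 v' a\<^sub>3) (\<lambda>a\<^sub>1 v\<^sub>1. sw V C T (r2 c\<^sub>3 v) (\<lambda>v\<^sub>2 c\<^sub>2.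
    sw A (V \<boxtimes>\<^bsub>K\<^esub> C) T (ee v\<^sub>1 v\<^sub>2) (\<lambda>x w. sw V C T w (\<lambda>y z.
      pure (a' \<otimes>\<^bsub>A\<^esub> a\<^sub>1 \<otimes>\<^bsub>A\<^esub> x) y (z \<otimes>\<^bsub>C\<^esub> c\<^sub>2 \<otimes>\<^bsub>C\<^esub> c))))))"
    by (simp add: mult_iA mult_iV mult_iC mult_sw A.m_assoc C.m_assoc)
  then show "pure a' v' c' \<star> pure a v c = ((pure a' v' c' \<star> iA a) \<star> iV v) \<star> iC c"
    by (simp add: pure_mult_pure)
qed (use x in simp_all)

lemmas exchange_rules =
  exchange[OF V_module A_module _ _ _ _ iV_iA_skew iC_iA_skew_right iV_iV_iA]
  exchange[OF V_module V_module _ _ _ _ iV_iA_skew iC_iV_skew iV_iV_iV]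
  exchange[OF C_module A_module _ _ _ _ iC_iA_skew iC_iA_skew_right iC_iV_iA]
  exchange[OF C_module V_module _ _ _ _ iC_iA_skew iC_iV_skew iC_iV_iV]

lemma mult_assoc:
  assumes "x \<in> carrier T" "y \<in> carrier T" "z \<in> carrier T"
  shows "(x \<star> y) \<star> z = x \<star> (y \<star> z)"
proof -
  note [simp] = assms
  have pure: "(pure a v c \<star> y) \<star> pure a' v' c' = pure a v c \<star> (y \<star> pure a' v' c')"
    if [simp]: "a \<in> carrier A" "v \<in> carrier V" "c \<in> carrier C" "a' \<in> carrier A" "v' \<in> carrier V" "c' \<in> carrier C"
    for a v c a' v' c'
  proof -
    have iA_assoc': "iA b \<star> (x \<star> iA b') = (iA b \<star> x) \<star> iA b'"
      if "b \<in> carrier A" "x \<in> carrier T" "b' \<in> carrier A" for b x b'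
      using that by (simp add: iA_assoc)
    have iA_assoc'': "iA b \<star> (x \<star> iV u) = (iA b \<star> x) \<star> iV u"
      if "b \<in> carrier A" "x \<in> carrier T" "u \<in> carrier V" for b x u
      using that by (simp add: iA_assoc)
    \<comment> \<open>\<open>iA_assoc\<close> in general form would also rebracket \<open>a (v (c y))\<close>, hence its two instances.\<close>
    have "(pure a v c \<star> y) \<star> pure a' v' c' =
        (((iA a \<star> (iV v \<star> (iC c \<star> y))) \<star> iA a') \<star> iV v') \<star> iC c'"
      by (subst pure_mult_right, simp_all) (subst pure_mult_left, simp_all)
    also have "\<dots> = iA a \<star> (iV v \<star> (iC c \<star> (((y \<star> iA a') \<star> iV v') \<star> iC c')))"
      by (simp add: exchange_rules iA_assoc' iA_assoc'' iC_assoc)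
    also have "\<dots> = pure a v c \<star> (y \<star> pure a' v' c')"
      by (subst pure_mult_left, simp_all) (subst pure_mult_right, simp_all)
    finally show ?thesis .
  qed
  have "(pure a v c \<star> y) \<star> z = pure a v c \<star> (y \<star> z)"
    if [simp]: "a \<in> carrier A" "v \<in> carrier V" "c \<in> carrier C" for a v c
    by (rule threefold_ext[OF mult_linear_right linmaps_compose[OF mult_linear_right mult_linear_right]])
      (simp_all add: pure)
  then show ?thesis
    by - (rule threefold_ext[OF linmaps_compose[OF mult_linear_left mult_linear_left] mult_linear_left], simp_all)
qed

subsection \<open>The two presentations\<close>

lemmas P_apply = two_sided_P_def[THEN fun_cong, unfolded o_apply]
lemmas \<nu>_apply = two_sided_nu_def[THEN fun_cong, unfolded o_apply]
lemmas Y_defs = Y.mult_def mirror_crossed_mult_def P_apply \<nu>_apply P_linear \<nu>_linear Y.mul_mul_linear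

abbreviation "rebracket \<equiv> assocl K A V C"

lemma rebracket_linear: "rebracket \<in> linmaps K T ((A \<boxtimes>\<^bsub>K\<^esub> V) \<boxtimes>\<^bsub>K\<^esub> C)"
  by (rule assocl_linear) simp_all

text \<open>
  The formula for the mirrored product applies \<open>R\<^sub>3\<close>, \<open>R\<^sub>2\<close>, \<open>R\<^sub>1\<close>, \<open>E\<close> in this order, the other one \<open>R\<^sub>3\<close>,
  \<open>R\<^sub>1\<close>, \<open>R\<^sub>2\<close>, \<open>E\<close>; after interchanging the two middle sums the normal forms agree.
\<close>

lemma rebracket_mult:
  assumes "x \<in> carrier T" "y \<in> carrier T"
  shows "rebracket (x \<star> y) = Y.mult (rebracket x) (rebracket y)"
proof -
  note [simp] = assms
  note linear = linmaps_compose[OF rebracket_linear mult_linear_right] linmaps_compose[OF rebracket_linear mult_linear_left]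
    linmaps_compose[OF bilinear_linear_right[OF Y.mult_bilinear] rebracket_linear]
    linmaps_compose[OF bilinear_linear_left[OF Y.mult_bilinear] rebracket_linear]
  have pure: "rebracket (pure a v c \<star> pure a' v' c') = Y.mult (rebracket (pure a v c)) (rebracket (pure a' v' c'))"
    if [simp]: "a \<in> carrier A" "v \<in> carrier V" "c \<in> carrier C" "a' \<in> carrier A" "v' \<in> carrier V" "c' \<in> carrier C"
    for a v c a' v' c'
    by (simp add: pure_mult_pure Y_defs NF sw_commute[of V C A V])
  have "rebracket (pure a v c \<star> y) = Y.mult (rebracket (pure a v c)) (rebracket y)"
    if [simp]: "a \<in> carrier A" "v \<in> carrier V" "c \<in> carrier C" for a v c
    by (rule threefold_ext[OF linear(1) linear(3)]) (simp_all add: pure linmaps_closed[OF rebracket_linear])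
  then show ?thesis
    by - (rule threefold_ext[OF linear(2) linear(4)], simp_all add: linmaps_closed[OF rebracket_linear])
qed

lemma Y_mult_assoc:
  assumes "x \<in> carrier Y.T" "y \<in> carrier Y.T" "z \<in> carrier Y.T"
  shows "Y.mult (Y.mult x y) z = Y.mult x (Y.mult y z)"
proof -
  define x' y' z' where "x' = assocr K A V C x" "y' = assocr K A V C y" "z' = assocr K A V C z"
  have closed [simp]: "x' \<in> carrier T" "y' \<in> carrier T" "z' \<in> carrier T"
    using assms by (simp_all add: x'_y'_z'_def linmaps_closed[OF assocr_linear])
  have "rebracket x' = x" "rebracket y' = y" "rebracket z' = z"
    using assms by (simp_all add: x'_y'_z'_def assocl_assocr)
  then show ?thesis
    using rebracket_mult mult_assoc[of x' y' z'] by (metis X.mult_closed closed)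
qed

lemma rebracket_bij: "bij_betw rebracket (carrier T) (carrier Y.T)"
  by (rule bij_betw_byWitness[of _ "assocr K A V C"])
    (auto simp: assocr_assocl assocl_assocr linmaps_closed[OF rebracket_linear] linmaps_closed[OF assocr_linear])

theorem two_sided_crossed_product:
  defines "X \<equiv> crossed_algebra K A (V \<boxtimes>\<^bsub>K\<^esub> C) (tens K V C oneV \<one>\<^bsub>C\<^esub>) R \<sigma>"
    and "Y \<equiv> mirror_crossed_algebra K (A \<boxtimes>\<^bsub>K\<^esub> V) C (tens K A V \<one>\<^bsub>A\<^esub> oneV) P \<nu>"
  shows "crossed_product K A (V \<boxtimes>\<^bsub>K\<^esub> C) (tens K V C oneV \<one>\<^bsub>C\<^esub>) R \<sigma>"
    and "mirror_crossed_product K (A \<boxtimes>\<^bsub>K\<^esub> V) C (tens K A V \<one>\<^bsub>A\<^esub> oneV) P \<nu>"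
    and "assoc_algebra K X" and "assoc_algebra K Y"
    and "rebracket \<in> ring_iso X Y \<inter> linmaps K X Y"
    and "\<one>\<^bsub>X\<^esub> = pure \<one>\<^bsub>A\<^esub> oneV \<one>\<^bsub>C\<^esub>"
    and "\<lbrakk>a \<in> carrier A; a' \<in> carrier A; v \<in> carrier V; v' \<in> carrier V; c \<in> carrier C; c' \<in> carrier C\<rbrakk> \<Longrightarrow>
      pure a v c \<otimes>\<^bsub>X\<^esub> pure a' v' c' =
           sweedler K T (R3 (tens K C A c a')) (\<lambda>a'\<^sub>3 c\<^sub>3.
           sweedler K T (R1 (tens K V A v a'\<^sub>3)) (\<lambda>a'\<^sub>3\<^sub>1 v\<^sub>1.
           sweedler K T (R2 (tens K C V c\<^sub>3 v')) (\<lambda>v'\<^sub>2 c\<^sub>3\<^sub>2.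
           sweedler K T (E (tens K V V v\<^sub>1 v'\<^sub>2)) (\<lambda>E\<^sub>A E\<^sub>V\<^sub>C.
           sweedler K T E\<^sub>V\<^sub>C (\<lambda>E\<^sub>V E\<^sub>C.
             pure (a \<otimes>\<^bsub>A\<^esub> a'\<^sub>3\<^sub>1 \<otimes>\<^bsub>A\<^esub> E\<^sub>A) E\<^sub>V (E\<^sub>C \<otimes>\<^bsub>C\<^esub> c\<^sub>3\<^sub>2 \<otimes>\<^bsub>C\<^esub> c'))))))"
proof -
  show "crossed_product K A (V \<boxtimes>\<^bsub>K\<^esub> C) (tens K V C oneV \<one>\<^bsub>C\<^esub>) R \<sigma>"
    by (rule X.crossed_product_of_assoc[OF mult_assoc])
  show "mirror_crossed_product K (A \<boxtimes>\<^bsub>K\<^esub> V) C (tens K A V \<one>\<^bsub>A\<^esub> oneV) P \<nu>"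
    by (rule Y.mirror_crossed_product_of_assoc[OF Y_mult_assoc])
  show "assoc_algebra K X"
    unfolding X_def by (rule X.crossed_algebra_of_assoc[OF mult_assoc])
  show "assoc_algebra K Y"
    unfolding Y_def by (rule Y.mirror_crossed_algebra_of_assoc[OF Y_mult_assoc])
  have X: "X = T\<lparr>monoid.mult := (\<star>), one := pure \<one>\<^bsub>A\<^esub> oneV \<one>\<^bsub>C\<^esub>\<rparr>"
    by (simp add: X_def crossed_algebra_def X.mult_def[abs_def])
  have Y: "Y = Y.T\<lparr>monoid.mult := Y.mult, one := tens K (A \<boxtimes>\<^bsub>K\<^esub> V) C (tens K A V \<one>\<^bsub>A\<^esub> oneV) \<one>\<^bsub>C\<^esub>\<rparr>"
    by (simp add: Y_def mirror_crossed_algebra_def Y.mult_def[abs_def])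
  have "rebracket \<in> ring_hom X Y"
    by (rule ring_hom_memI)
      (simp_all add: X Y rebracket_mult linmaps_closed[OF rebracket_linear] linmaps_add[OF rebracket_linear] assocl_tens)
  then show "rebracket \<in> ring_iso X Y \<inter> linmaps K X Y"
    using rebracket_bij rebracket_linear by (simp add: ring_iso_def X Y linmaps_def)
  show "\<one>\<^bsub>X\<^esub> = pure \<one>\<^bsub>A\<^esub> oneV \<one>\<^bsub>C\<^esub>"
    by (simp add: X)
  assume [simp]: "a \<in> carrier A" "a' \<in> carrier A" "v \<in> carrier V" "v' \<in> carrier V" "c \<in> carrier C" "c' \<in> carrier C"
  have "pure a v c \<otimes>\<^bsub>X\<^esub> pure a' v' c' = pure a v c \<star> pure a' v' c'"
    by (simp add: X)
  then show "pure a v c \<otimes>\<^bsub>X\<^esub> pure a' v' c' =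
           sweedler K T (R3 (tens K C A c a')) (\<lambda>a'\<^sub>3 c\<^sub>3.
           sweedler K T (R1 (tens K V A v a'\<^sub>3)) (\<lambda>a'\<^sub>3\<^sub>1 v\<^sub>1.
           sweedler K T (R2 (tens K C V c\<^sub>3 v')) (\<lambda>v'\<^sub>2 c\<^sub>3\<^sub>2.
           sweedler K T (E (tens K V V v\<^sub>1 v'\<^sub>2)) (\<lambda>E\<^sub>A E\<^sub>V\<^sub>C.
           sweedler K T E\<^sub>V\<^sub>C (\<lambda>E\<^sub>V E\<^sub>C.
             pure (a \<otimes>\<^bsub>A\<^esub> a'\<^sub>3\<^sub>1 \<otimes>\<^bsub>A\<^esub> E\<^sub>A) E\<^sub>V (E\<^sub>C \<otimes>\<^bsub>C\<^esub> c\<^sub>3\<^sub>2 \<otimes>\<^bsub>C\<^esub> c'))))))"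
    by (simp add: pure_mult_pure sw_eq) (simp add: r1_def r2_def r3_def ee_def)
qed

end

theorem theorem2p1:
  fixes K :: "'k ring"
    and A :: "('k, 'a) module" and V :: "('k, 'v) module" and C :: "('k, 'c) module"
    and oneV :: 'v
    and R1 :: "('k, 'v, 'a) tensor \<Rightarrow> ('k, 'a, 'v) tensor"
    and R2 :: "('k, 'c, 'v) tensor \<Rightarrow> ('k, 'v, 'c) tensor"
    and R3 :: "('k, 'c, 'a) tensor \<Rightarrow> ('k, 'a, 'c) tensor"
    and E :: "('k, 'v, 'v) tensor \<Rightarrow> ('k, 'a, ('k, 'v, 'c) tensor) tensor"
  assumes "field K"
    and "assoc_algebra K A" and "assoc_algebra K C" and "module K V"
    and "oneV \<in> carrier V" and "oneV \<noteq> \<zero>\<^bsub>V\<^esub>"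
    and "R1 \<in> linmaps K (V \<boxtimes>\<^bsub>K\<^esub> A) (A \<boxtimes>\<^bsub>K\<^esub> V)"
    and "R2 \<in> linmaps K (C \<boxtimes>\<^bsub>K\<^esub> V) (V \<boxtimes>\<^bsub>K\<^esub> C)"
    and "R3 \<in> linmaps K (C \<boxtimes>\<^bsub>K\<^esub> A) (A \<boxtimes>\<^bsub>K\<^esub> C)"
    and "E \<in> linmaps K (V \<boxtimes>\<^bsub>K\<^esub> V) (A \<boxtimes>\<^bsub>K\<^esub> (V \<boxtimes>\<^bsub>K\<^esub> C))"
    and "twisting_map K A C R3"
    and "\<forall>a\<in>carrier A. R1 (tens K V A oneV a) = tens K A V a oneV"
    and "\<forall>v\<in>carrier V. R1 (tens K V A v \<one>\<^bsub>A\<^esub>) = tens K A V \<one>\<^bsub>A\<^esub> v"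
    and "\<forall>c\<in>carrier C. R2 (tens K C V c oneV) = tens K V C oneV c"
    and "\<forall>v\<in>carrier V. R2 (tens K C V \<one>\<^bsub>C\<^esub> v) = tens K V C v \<one>\<^bsub>C\<^esub>"
    and "\<forall>v\<in>carrier V. E (tens K V V oneV v) = tens K A (V \<boxtimes>\<^bsub>K\<^esub> C) \<one>\<^bsub>A\<^esub> (tens K V C v \<one>\<^bsub>C\<^esub>)"
    and "\<forall>v\<in>carrier V. E (tens K V V v oneV) = tens K A (V \<boxtimes>\<^bsub>K\<^esub> C) \<one>\<^bsub>A\<^esub> (tens K V C v \<one>\<^bsub>C\<^esub>)"
    and "eq_on (V \<boxtimes>\<^bsub>K\<^esub> (A \<boxtimes>\<^bsub>K\<^esub> A))
      (R1 \<circ> tmap K V A id (mul K A))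
      (tmap K A V (mul K A) id \<circ> assocl K A A V \<circ> tmap K A (A \<boxtimes>\<^bsub>K\<^esub> V) id R1 \<circ> assocr K A V A
        \<circ> tmap K (A \<boxtimes>\<^bsub>K\<^esub> V) A R1 id \<circ> assocl K V A A)"
    and "eq_on (C \<boxtimes>\<^bsub>K\<^esub> (C \<boxtimes>\<^bsub>K\<^esub> V))
      (R2 \<circ> tmap K C V (mul K C) id \<circ> assocl K C C V)
      (tmap K V C id (mul K C) \<circ> assocr K V C C \<circ> tmap K (V \<boxtimes>\<^bsub>K\<^esub> C) C R2 id \<circ> assocl K C V C
        \<circ> tmap K C (V \<boxtimes>\<^bsub>K\<^esub> C) id R2)"
    and "eq_on (C \<boxtimes>\<^bsub>K\<^esub> (V \<boxtimes>\<^bsub>K\<^esub> A))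
      (tmap K A (V \<boxtimes>\<^bsub>K\<^esub> C) id R2 \<circ> assocr K A C V \<circ> tmap K (A \<boxtimes>\<^bsub>K\<^esub> C) V R3 id \<circ> assocl K C A V
        \<circ> tmap K C (A \<boxtimes>\<^bsub>K\<^esub> V) id R1)
      (assocr K A V C \<circ> tmap K (A \<boxtimes>\<^bsub>K\<^esub> V) C R1 id \<circ> assocl K V A C
        \<circ> tmap K V (A \<boxtimes>\<^bsub>K\<^esub> C) id R3 \<circ> assocr K V C A
        \<circ> tmap K (V \<boxtimes>\<^bsub>K\<^esub> C) A R2 id \<circ> assocl K C V A)"
    and "eq_on (V \<boxtimes>\<^bsub>K\<^esub> (V \<boxtimes>\<^bsub>K\<^esub> A))
      (tmap K A (V \<boxtimes>\<^bsub>K\<^esub> C) (mul K A) id \<circ> assocl K A A (V \<boxtimes>\<^bsub>K\<^esub> C)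
        \<circ> tmap K A (A \<boxtimes>\<^bsub>K\<^esub> (V \<boxtimes>\<^bsub>K\<^esub> C)) id E \<circ> assocr K A V V
        \<circ> tmap K (A \<boxtimes>\<^bsub>K\<^esub> V) V R1 id \<circ> assocl K V A V
        \<circ> tmap K V (A \<boxtimes>\<^bsub>K\<^esub> V) id R1)
      (tmap K A (V \<boxtimes>\<^bsub>K\<^esub> C) (mul K A) id \<circ> assocl K A A (V \<boxtimes>\<^bsub>K\<^esub> C)
        \<circ> tmap K A (A \<boxtimes>\<^bsub>K\<^esub> (V \<boxtimes>\<^bsub>K\<^esub> C)) id (assocr K A V C)
        \<circ> tmap K A ((A \<boxtimes>\<^bsub>K\<^esub> V) \<boxtimes>\<^bsub>K\<^esub> C) id (tmap K (A \<boxtimes>\<^bsub>K\<^esub> V) C R1 id)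
        \<circ> tmap K A ((V \<boxtimes>\<^bsub>K\<^esub> A) \<boxtimes>\<^bsub>K\<^esub> C) id (assocl K V A C)
        \<circ> tmap K A (V \<boxtimes>\<^bsub>K\<^esub> (A \<boxtimes>\<^bsub>K\<^esub> C)) id (tmap K V (A \<boxtimes>\<^bsub>K\<^esub> C) id R3)
        \<circ> tmap K A (V \<boxtimes>\<^bsub>K\<^esub> (C \<boxtimes>\<^bsub>K\<^esub> A)) id (assocr K V C A) \<circ> assocr K A (V \<boxtimes>\<^bsub>K\<^esub> C) A
        \<circ> tmap K (A \<boxtimes>\<^bsub>K\<^esub> (V \<boxtimes>\<^bsub>K\<^esub> C)) A E id \<circ> assocl K V V A)"
    and "eq_on (C \<boxtimes>\<^bsub>K\<^esub> (V \<boxtimes>\<^bsub>K\<^esub> V))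
      (tmap K A (V \<boxtimes>\<^bsub>K\<^esub> C) id (tmap K V C id (mul K C))
        \<circ> tmap K A (V \<boxtimes>\<^bsub>K\<^esub> (C \<boxtimes>\<^bsub>K\<^esub> C)) id (assocr K V C C) \<circ> assocr K A (V \<boxtimes>\<^bsub>K\<^esub> C) C
        \<circ> tmap K (A \<boxtimes>\<^bsub>K\<^esub> (V \<boxtimes>\<^bsub>K\<^esub> C)) C E id \<circ> assocl K V V C
        \<circ> tmap K V (V \<boxtimes>\<^bsub>K\<^esub> C) id R2 \<circ> assocr K V C V
        \<circ> tmap K (V \<boxtimes>\<^bsub>K\<^esub> C) V R2 id \<circ> assocl K C V V)
      (tmap K A (V \<boxtimes>\<^bsub>K\<^esub> C) id (tmap K V C id (mul K C))
        \<circ> tmap K A (V \<boxtimes>\<^bsub>K\<^esub> (C \<boxtimes>\<^bsub>K\<^esub> C)) id (assocr K V C C)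
        \<circ> tmap K A ((V \<boxtimes>\<^bsub>K\<^esub> C) \<boxtimes>\<^bsub>K\<^esub> C) id (tmap K (V \<boxtimes>\<^bsub>K\<^esub> C) C R2 id)
        \<circ> tmap K A ((C \<boxtimes>\<^bsub>K\<^esub> V) \<boxtimes>\<^bsub>K\<^esub> C) id (assocl K C V C) \<circ> assocr K A C (V \<boxtimes>\<^bsub>K\<^esub> C)
        \<circ> tmap K (A \<boxtimes>\<^bsub>K\<^esub> C) (V \<boxtimes>\<^bsub>K\<^esub> C) R3 id \<circ> assocl K C A (V \<boxtimes>\<^bsub>K\<^esub> C)
        \<circ> tmap K C (A \<boxtimes>\<^bsub>K\<^esub> (V \<boxtimes>\<^bsub>K\<^esub> C)) id E)"
    and "eq_on (V \<boxtimes>\<^bsub>K\<^esub> (V \<boxtimes>\<^bsub>K\<^esub> V))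
      (tmap K A (V \<boxtimes>\<^bsub>K\<^esub> C) (mul K A) (tmap K V C id (mul K C))
        \<circ> assocl K A A (V \<boxtimes>\<^bsub>K\<^esub> (C \<boxtimes>\<^bsub>K\<^esub> C))
        \<circ> tmap K A (A \<boxtimes>\<^bsub>K\<^esub> (V \<boxtimes>\<^bsub>K\<^esub> (C \<boxtimes>\<^bsub>K\<^esub> C))) id
            (tmap K A (V \<boxtimes>\<^bsub>K\<^esub> (C \<boxtimes>\<^bsub>K\<^esub> C)) id (assocr K V C C))
        \<circ> tmap K A (A \<boxtimes>\<^bsub>K\<^esub> ((V \<boxtimes>\<^bsub>K\<^esub> C) \<boxtimes>\<^bsub>K\<^esub> C)) id (assocr K A (V \<boxtimes>\<^bsub>K\<^esub> C) C)
        \<circ> tmap K A ((A \<boxtimes>\<^bsub>K\<^esub> (V \<boxtimes>\<^bsub>K\<^esub> C)) \<boxtimes>\<^bsub>K\<^esub> C) id (tmap K (A \<boxtimes>\<^bsub>K\<^esub> (V \<boxtimes>\<^bsub>K\<^esub> C)) C E id)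
        \<circ> tmap K A ((V \<boxtimes>\<^bsub>K\<^esub> V) \<boxtimes>\<^bsub>K\<^esub> C) id (assocl K V V C) \<circ> assocr K A V (V \<boxtimes>\<^bsub>K\<^esub> C)
        \<circ> tmap K (A \<boxtimes>\<^bsub>K\<^esub> V) (V \<boxtimes>\<^bsub>K\<^esub> C) R1 id \<circ> assocl K V A (V \<boxtimes>\<^bsub>K\<^esub> C)
        \<circ> tmap K V (A \<boxtimes>\<^bsub>K\<^esub> (V \<boxtimes>\<^bsub>K\<^esub> C)) id E)
      (tmap K A (V \<boxtimes>\<^bsub>K\<^esub> C) (mul K A) (tmap K V C id (mul K C))
        \<circ> assocl K A A (V \<boxtimes>\<^bsub>K\<^esub> (C \<boxtimes>\<^bsub>K\<^esub> C))
        \<circ> tmap K A (A \<boxtimes>\<^bsub>K\<^esub> (V \<boxtimes>\<^bsub>K\<^esub> (C \<boxtimes>\<^bsub>K\<^esub> C))) id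
            (tmap K A (V \<boxtimes>\<^bsub>K\<^esub> (C \<boxtimes>\<^bsub>K\<^esub> C)) id (assocr K V C C))
        \<circ> tmap K A (A \<boxtimes>\<^bsub>K\<^esub> ((V \<boxtimes>\<^bsub>K\<^esub> C) \<boxtimes>\<^bsub>K\<^esub> C)) id (assocr K A (V \<boxtimes>\<^bsub>K\<^esub> C) C)
        \<circ> tmap K A ((A \<boxtimes>\<^bsub>K\<^esub> (V \<boxtimes>\<^bsub>K\<^esub> C)) \<boxtimes>\<^bsub>K\<^esub> C) id (tmap K (A \<boxtimes>\<^bsub>K\<^esub> (V \<boxtimes>\<^bsub>K\<^esub> C)) C E id)
        \<circ> tmap K A ((V \<boxtimes>\<^bsub>K\<^esub> V) \<boxtimes>\<^bsub>K\<^esub> C) id (assocl K V V C)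
        \<circ> tmap K A (V \<boxtimes>\<^bsub>K\<^esub> (V \<boxtimes>\<^bsub>K\<^esub> C)) id (tmap K V (V \<boxtimes>\<^bsub>K\<^esub> C) id R2)
        \<circ> tmap K A (V \<boxtimes>\<^bsub>K\<^esub> (C \<boxtimes>\<^bsub>K\<^esub> V)) id (assocr K V C V) \<circ> assocr K A (V \<boxtimes>\<^bsub>K\<^esub> C) V
        \<circ> tmap K (A \<boxtimes>\<^bsub>K\<^esub> (V \<boxtimes>\<^bsub>K\<^esub> C)) V E id \<circ> assocl K V V V)"
  shows "let
      R = two_sided_R K A V C R1 R3;
      P = two_sided_P K A V C R2 R3;
      \<sigma> = two_sided_sigma K A V C R2 E;
      \<nu> = two_sided_nu K A V C R1 E;
      X = crossed_algebra K A (V \<boxtimes>\<^bsub>K\<^esub> C) (tens K V C oneV \<one>\<^bsub>C\<^esub>) R \<sigma>;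
      Y = mirror_crossed_algebra K (A \<boxtimes>\<^bsub>K\<^esub> V) C (tens K A V \<one>\<^bsub>A\<^esub> oneV) P \<nu>;
      T = A \<boxtimes>\<^bsub>K\<^esub> (V \<boxtimes>\<^bsub>K\<^esub> C)
    in
      crossed_product K A (V \<boxtimes>\<^bsub>K\<^esub> C) (tens K V C oneV \<one>\<^bsub>C\<^esub>) R \<sigma> \<and>
      mirror_crossed_product K (A \<boxtimes>\<^bsub>K\<^esub> V) C (tens K A V \<one>\<^bsub>A\<^esub> oneV) P \<nu> \<and>
      assoc_algebra K X \<and> assoc_algebra K Y \<and>
      assocl K A V C \<in> ring_iso X Y \<inter> linmaps K X Y \<and>
      \<one>\<^bsub>X\<^esub> = tens K A (V \<boxtimes>\<^bsub>K\<^esub> C) \<one>\<^bsub>A\<^esub> (tens K V C oneV \<one>\<^bsub>C\<^esub>) \<and>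
      (\<forall>a\<in>carrier A. \<forall>a'\<in>carrier A. \<forall>v\<in>carrier V. \<forall>v'\<in>carrier V.
       \<forall>c\<in>carrier C. \<forall>c'\<in>carrier C.
         tens K A (V \<boxtimes>\<^bsub>K\<^esub> C) a (tens K V C v c) \<otimes>\<^bsub>X\<^esub> tens K A (V \<boxtimes>\<^bsub>K\<^esub> C) a' (tens K V C v' c') =
           sweedler K T (R3 (tens K C A c a')) (\<lambda>a'\<^sub>3 c\<^sub>3.
           sweedler K T (R1 (tens K V A v a'\<^sub>3)) (\<lambda>a'\<^sub>3\<^sub>1 v\<^sub>1.
           sweedler K T (R2 (tens K C V c\<^sub>3 v')) (\<lambda>v'\<^sub>2 c\<^sub>3\<^sub>2.
           sweedler K T (E (tens K V V v\<^sub>1 v'\<^sub>2)) (\<lambda>E\<^sub>A E\<^sub>V\<^sub>C.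
           sweedler K T E\<^sub>V\<^sub>C (\<lambda>E\<^sub>V E\<^sub>C.
             tens K A (V \<boxtimes>\<^bsub>K\<^esub> C) (a \<otimes>\<^bsub>A\<^esub> a'\<^sub>3\<^sub>1 \<otimes>\<^bsub>A\<^esub> E\<^sub>A)
               (tens K V C E\<^sub>V (E\<^sub>C \<otimes>\<^bsub>C\<^esub> c\<^sub>3\<^sub>2 \<otimes>\<^bsub>C\<^esub> c'))))))))"
proof -
  interpret field K by fact
  interpret two_sided_datum K A V C oneV R1 R2 R3 E
    by (intro two_sided_datum.intro base_ring.intro two_sided_datum_axioms.intro cring_axioms assms)
  show ?thesis
    unfolding Let_def by (intro conjI ballI two_sided_crossed_product)
qed

end
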